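(* Let $n\ge3$ be an odd integer, $\mathsf{k}$ an infinite field of characteristic zero or of characteristic greater than $n$, and $Q=\mathsf{k}[x_1,\dots,x_n]$. A general quotient $R$ of $Q$ defined by $n+1$ quadrics $f_1,\dots,f_{n+1}$ satisfies the following, where $A$ is the Gorenstein ring associated to $R$: $$\beta_{i,j}^Q(R)\le\beta_{i,j}^Q(\widetilde R)\qquad\text{and}\qquad\beta_{i,j}^Q(A)\le\beta_{i,j}^Q(\widetilde A)\qquad\text{for all } i,j\ge0,$$ where $\widetilde R=Q/\bigl(x_1^2,\dots,x_n^2,(x_1+\dots+x_n)^2\bigr)$ and $\widetilde A=Q/\bigl((x_1^2,\dots,x_n^2):(x_1+\dots+x_n)^2\bigr)$.
   Context: General quotients. $Q$ is standard graded. Let $\Upsilon=\{(k,i,j)\mid 1\le k\le n+1,\ 1\le i\le j\le n\}$ and $N=|\Upsilon|-1=(n+1)\binom{n+1}{2}-1$. For a point $a=(a_{kij})_{(k,i,j)\in\Upsilon}$ (with $a_{kij}\in\mathsf{k}$) of the projective space $\mathbb{P}^N$ over $\mathsf{k}$, let $f_k=\sum_{1\le i\le j\le n}a_{kij}x_ix_j$ for $1\le k\le n+1$, and $R_a=Q/(f_1,\dots,f_{n+1})$. "A general quotient $R$ of $Q$ defined by $n+1$ quadrics satisfies a property $\mathcal{P}$" means: there exists a nonempty Zariski open subset $U\subseteq\mathbb{P}^N$ such that $R_a$ satisfies $\mathcal{P}$ for all $a\in U$. Convention: in statements about a general quotient $R=R_a$ it is assumed that $f_1,\dots,f_n$ is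 a regular sequence and that $f_{n+1}$ is a maximal rank element of $Q/(f_1,\dots,f_n)$, i.e. each multiplication map by $f_{n+1}$ from degree $i$ to degree $i+2$ ($i\ge0$) has maximal rank (these conditions hold on a nonempty Zariski open set). The Gorenstein ring associated to $R$ is $A=Q/((f_1,\dots,f_n):f_{n+1})$. For a finitely generated graded $Q$-module $M$, $\beta_{i,j}^Q(M)=\dim_{\mathsf{k}}\mathrm{Tor}_i^Q(M,\mathsf{k})_j$. *)

theory Defs
  imports Complex_Main "HOL-Library.Poly_Mapping" "HOL-Library.Cardinality"
begin

section \<open>Polynomials, ideals and graded pieces\<close>

text \<open>Polynomials over a commutative ring with variables indexed by a type: finitely supported
  coefficient functions on exponent vectors, with the convolution product of Poly_Mapping.\<close>

type_synonym ('v, 'k) mpoly = "('v \<Rightarrow>\<^sub>0 nat) \<Rightarrow>\<^sub>0 'k"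

definition var :: "'v \<Rightarrow> ('v, 'k::comm_ring_1) mpoly" where
  "var v = Poly_Mapping.single (Poly_Mapping.single v 1) 1"

definition mon_deg :: "('v \<Rightarrow>\<^sub>0 nat) \<Rightarrow> nat" where
  "mon_deg m = (\<Sum>v\<in>Poly_Mapping.keys m. Poly_Mapping.lookup m v)"

text \<open>The zero polynomial is homogeneous of every degree.\<close>

definition homogeneous :: "nat \<Rightarrow> ('v, 'k::zero) mpoly \<Rightarrow> bool" where
  "homogeneous d p \<longleftrightarrow> (\<forall>m\<in>Poly_Mapping.keys p. mon_deg m = d)"

definition vars :: "('v, 'k::zero) mpoly \<Rightarrow> 'v set" where
  "vars p = (\<Union>m\<in>Poly_Mapping.keys p. Poly_Mapping.keys m)"

definition poly_eval :: "('v \<Rightarrow> 'k) \<Rightarrow> ('v, 'k::comm_ring_1) mpoly \<Rightarrow> 'k" where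
  "poly_eval a p = (\<Sum>m\<in>Poly_Mapping.keys p.
     Poly_Mapping.lookup p m * (\<Prod>v\<in>Poly_Mapping.keys m. a v ^ Poly_Mapping.lookup m v))"

text \<open>Coefficientwise multiplication.  It is used both for the scalar action of a field on
  polynomials and for the module structure of the free module on a set of basis indices (over a
  field or over a polynomial ring).\<close>

definition pm_scale :: "'a::comm_ring_1 \<Rightarrow> ('b \<Rightarrow>\<^sub>0 'a) \<Rightarrow> ('b \<Rightarrow>\<^sub>0 'a)" where
  "pm_scale c p = Poly_Mapping.map ((*) c) p"

lemma lookup_pm_scale [simp]:
  "Poly_Mapping.lookup (pm_scale c p) k = c * Poly_Mapping.lookup p k"
  by (simp add: pm_scale_def Poly_Mapping.map.rep_eq when_def)

lemma module_pm_scale: "module (pm_scale :: 'a::comm_ring_1 \<Rightarrow> ('b \<Rightarrow>\<^sub>0 'a) \<Rightarrow> _)"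
  by unfold_locales (auto intro!: poly_mapping_eqI simp: lookup_add algebra_simps)

lemma vector_space_pm_scale: "vector_space (pm_scale :: 'a::field \<Rightarrow> ('b \<Rightarrow>\<^sub>0 'a) \<Rightarrow> _)"
  by unfold_locales (auto intro!: poly_mapping_eqI simp: lookup_add algebra_simps)

lemma module_ring_mult: "module ((*) :: 'a::comm_ring_1 \<Rightarrow> 'a \<Rightarrow> 'a)"
  by unfold_locales (auto simp: algebra_simps)

definition ideal_gen :: "'a::comm_ring_1 set \<Rightarrow> 'a set" where
  "ideal_gen G = module.span (*) G"

text \<open>The colon ideal \<open>I : g\<close>.\<close>

definition colon :: "'a::comm_ring_1 set \<Rightarrow> 'a \<Rightarrow> 'a set" where
  "colon I g = {p. p * g \<in> I}"

text \<open>\<open>f 1, \<dots>, f r\<close> is a regular sequence in the ambient ring.\<close>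

definition regular_sequence :: "(nat \<Rightarrow> 'a::comm_ring_1) \<Rightarrow> nat \<Rightarrow> bool" where
  "regular_sequence f r \<longleftrightarrow>
     (\<forall>k\<in>{1..r}. \<forall>p. p * f k \<in> ideal_gen (f ` {1..<k}) \<longrightarrow> p \<in> ideal_gen (f ` {1..<k})) \<and>
     ideal_gen (f ` {1..r}) \<noteq> UNIV"

text \<open>\<open>g\<close>, homogeneous of degree \<open>e\<close>, is a maximal rank element of \<open>Q/I\<close>: for every \<open>d\<close> the
  multiplication map by \<open>g\<close> from \<open>(Q/I)\<^sub>d\<close> to \<open>(Q/I)\<^sub>d\<^sub>+\<^sub>e\<close> is injective or surjective.\<close>

definition maximal_rank_element ::
  "('v, 'k::comm_ring_1) mpoly set \<Rightarrow> nat \<Rightarrow> ('v, 'k) mpoly \<Rightarrow> bool" where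
  "maximal_rank_element I e g \<longleftrightarrow> (\<forall>d.
     (\<forall>p. homogeneous d p \<and> g * p \<in> I \<longrightarrow> p \<in> I) \<or>
     (\<forall>q. homogeneous (d + e) q \<longrightarrow> (\<exists>p. homogeneous d p \<and> q - g * p \<in> I)))"

section \<open>Graded free resolutions and graded Betti numbers\<close>

text \<open>Data of a complex of graded free modules augmented to \<open>Q/I\<close>.  The module in homological
  degree \<open>i\<close> is \<open>F\<^sub>i = \<Oplus>\<^bsub>s \<in> basis i\<^esub> Q(- bdeg i s)\<close>, whose elements are the finitely supported
  functions with support in \<open>basis i\<close>; \<open>diff i s\<close> is the image in \<open>F\<^sub>i\<close> of the \<open>s\<close>-th basis
  element of \<open>F\<^sub>i\<^sub>+\<^sub>1\<close>, and \<open>aug s\<close> represents the image in \<open>Q/I\<close> of the \<open>s\<close>-th basis element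
  of \<open>F\<^sub>0\<close>.\<close>

record (overloaded) ('v, 'k) free_cx =
  basis :: "nat \<Rightarrow> nat set"
  bdeg :: "nat \<Rightarrow> nat \<Rightarrow> nat"
  diff :: "nat \<Rightarrow> nat \<Rightarrow> (nat \<Rightarrow>\<^sub>0 ('v, 'k) mpoly)"
  aug :: "nat \<Rightarrow> ('v, 'k) mpoly"

definition free_on :: "'b set \<Rightarrow> ('b \<Rightarrow>\<^sub>0 'a::zero) set" where
  "free_on S = {v. Poly_Mapping.keys v \<subseteq> S}"

text \<open>The linear map of free modules sending the \<open>s\<close>-th basis element to \<open>D s\<close>.\<close>

definition lin_ext :: "('b \<Rightarrow> ('c \<Rightarrow>\<^sub>0 'a)) \<Rightarrow> ('b \<Rightarrow>\<^sub>0 'a::comm_ring_1) \<Rightarrow> ('c \<Rightarrow>\<^sub>0 'a)" where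
  "lin_ext D v = (\<Sum>s\<in>Poly_Mapping.keys v. pm_scale (Poly_Mapping.lookup v s) (D s))"

definition aug_map :: "('b \<Rightarrow> 'a) \<Rightarrow> ('b \<Rightarrow>\<^sub>0 'a::comm_ring_1) \<Rightarrow> 'a" where
  "aug_map \<epsilon> v = (\<Sum>s\<in>Poly_Mapping.keys v. Poly_Mapping.lookup v s * \<epsilon> s)"

definition homogeneous_vec ::
  "('b \<Rightarrow> nat) \<Rightarrow> nat \<Rightarrow> ('b \<Rightarrow>\<^sub>0 ('v, 'k::zero) mpoly) \<Rightarrow> bool" where
  "homogeneous_vec \<delta> d v \<longleftrightarrow>
     (\<forall>t. \<forall>m\<in>Poly_Mapping.keys (Poly_Mapping.lookup v t). mon_deg m + \<delta> t = d)"

text \<open>\<open>F\<close> is a graded free resolution of \<open>Q/I\<close> with degree-preserving maps.  Each \<open>F\<^sub>i\<close> is only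
  required to have finitely many basis elements in each degree; this includes the resolutions by
  finitely generated modules, and Tor does not depend on the resolution.\<close>

definition graded_free_resolution ::
  "('v, 'k::comm_ring_1) mpoly set \<Rightarrow> ('v, 'k) free_cx \<Rightarrow> bool" where
  "graded_free_resolution I F \<longleftrightarrow>
     (\<forall>i d. finite {s \<in> basis F i. bdeg F i s = d}) \<and>
     (\<forall>s\<in>basis F 0. homogeneous (bdeg F 0 s) (aug F s)) \<and>
     (\<forall>i. \<forall>s\<in>basis F (Suc i). diff F i s \<in> free_on (basis F i) \<and>
        homogeneous_vec (bdeg F i) (bdeg F (Suc i) s) (diff F i s)) \<and>
     (\<forall>q. \<exists>v\<in>free_on (basis F 0). q - aug_map (aug F) v \<in> I) \<and>
     {v \<in> free_on (basis F 0). aug_map (aug F) v \<in> I} =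
        lin_ext (diff F 0) ` free_on (basis F (Suc 0)) \<and>
     (\<forall>i. {v \<in> free_on (basis F (Suc i)). lin_ext (diff F i) v = 0} =
        lin_ext (diff F (Suc i)) ` free_on (basis F (Suc (Suc i))))"

text \<open>\<open>F \<otimes>\<^sub>Q \<k>\<close>: as \<open>Q\<close> acts on \<open>\<k>\<close> through the constant term, \<open>F\<^sub>i \<otimes>\<^sub>Q \<k>\<close> is the vector space
  on \<open>basis i\<close>, with the matrices of the differentials replaced by their constant terms.  Its
  piece of internal degree \<open>j\<close> is spanned by the basis elements of degree \<open>j\<close>.\<close>

definition diff_tensor :: "('v, 'k::comm_ring_1) free_cx \<Rightarrow> nat \<Rightarrow> nat \<Rightarrow> (nat \<Rightarrow>\<^sub>0 'k)" where
  "diff_tensor F i s = Poly_Mapping.map (\<lambda>p. Poly_Mapping.lookup p 0) (diff F i s)"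

definition tensor_piece ::
  "('v, 'k::comm_ring_1) free_cx \<Rightarrow> nat \<Rightarrow> nat \<Rightarrow> (nat \<Rightarrow>\<^sub>0 'k) set" where
  "tensor_piece F i j = free_on {s \<in> basis F i. bdeg F i s = j}"

definition tor_cycles ::
  "('v, 'k::comm_ring_1) free_cx \<Rightarrow> nat \<Rightarrow> nat \<Rightarrow> (nat \<Rightarrow>\<^sub>0 'k) set" where
  "tor_cycles F i j = {v \<in> tensor_piece F i j.
     case i of 0 \<Rightarrow> True | Suc i' \<Rightarrow> lin_ext (diff_tensor F i') v = 0}"

definition tor_boundaries ::
  "('v, 'k::comm_ring_1) free_cx \<Rightarrow> nat \<Rightarrow> nat \<Rightarrow> (nat \<Rightarrow>\<^sub>0 'k) set" where
  "tor_boundaries F i j = lin_ext (diff_tensor F i) ` tensor_piece F (Suc i) j"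

text \<open>The dimension of \<open>Tor\<^sub>i\<^sup>Q(Q/I, \<k>)\<^sub>j\<close>, for a homogeneous ideal \<open>I\<close>: the homology in homological
  degree \<open>i\<close> and internal degree \<open>j\<close> of \<open>F \<otimes>\<^sub>Q \<k>\<close>, for an arbitrarily chosen resolution \<open>F\<close>.
  Boundaries form a subspace of the cycles, and both are finite dimensional.\<close>

definition graded_betti :: "('v, 'k::field) mpoly set \<Rightarrow> nat \<Rightarrow> nat \<Rightarrow> nat" where
  "graded_betti I i j = (let F = (SOME F. graded_free_resolution I F) in
     vector_space.dim pm_scale (tor_cycles F i j) -
     vector_space.dim pm_scale (tor_boundaries F i j))"

section \<open>Projective space and its Zariski topology\<close>

text \<open>Homogeneous coordinates are indexed by a subset \<open>S\<close> of a type; coordinate vectors vanish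
  outside \<open>S\<close>.  A point is the set of all its coordinate vectors.\<close>

definition coord_vecs :: "'s set \<Rightarrow> ('s \<Rightarrow> 'k::field) set" where
  "coord_vecs S = {a. (\<forall>s. s \<notin> S \<longrightarrow> a s = 0) \<and> (\<exists>s\<in>S. a s \<noteq> 0)}"

definition proj_rel :: "'s set \<Rightarrow> (('s \<Rightarrow> 'k::field) \<times> ('s \<Rightarrow> 'k)) set" where
  "proj_rel S = {(a, b). a \<in> coord_vecs S \<and> b \<in> coord_vecs S \<and> (\<exists>c. c \<noteq> 0 \<and> b = (\<lambda>s. c * a s))}"

definition proj_space :: "'s set \<Rightarrow> ('s \<Rightarrow> 'k::field) set set" where
  "proj_space S = coord_vecs S // proj_rel S"

definition zariski_open :: "'s set \<Rightarrow> ('s \<Rightarrow> 'k::field) set set \<Rightarrow> bool" where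
  "zariski_open S U \<longleftrightarrow> (\<exists>G :: ('s, 'k) mpoly set.
     (\<forall>g\<in>G. vars g \<subseteq> S \<and> (\<exists>d. homogeneous d g)) \<and>
     U = {P \<in> proj_space S. \<exists>g\<in>G. \<forall>a\<in>P. poly_eval a g \<noteq> 0})"

section \<open>Quotients by quadrics\<close>

text \<open>The variables of \<open>Q\<close> are indexed by a finite linearly ordered type with \<open>n\<close> elements.\<close>

definition Upsilon :: "(nat \<times> 'n \<times> 'n::{finite,linorder}) set" where
  "Upsilon = {(k, i, j). 1 \<le> k \<and> k \<le> CARD('n) + 1 \<and> i \<le> j}"

definition quadric ::
  "(nat \<times> 'n \<times> 'n \<Rightarrow> 'k) \<Rightarrow> nat \<Rightarrow> ('n::{finite,linorder}, 'k::field) mpoly" where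
  "quadric a k = (\<Sum>(i, j)\<in>{(i, j). i \<le> j}. pm_scale (a (k, i, j)) (var i * var j))"

text \<open>\<open>R\<^sub>a = Q / ideal_R a\<close>, and its associated Gorenstein ring is \<open>Q / ideal_A a\<close>.\<close>

definition ideal_R ::
  "(nat \<times> 'n \<times> 'n \<Rightarrow> 'k) \<Rightarrow> ('n::{finite,linorder}, 'k::field) mpoly set" where
  "ideal_R a = ideal_gen (quadric a ` {1..CARD('n) + 1})"

definition ideal_A ::
  "(nat \<times> 'n \<times> 'n \<Rightarrow> 'k) \<Rightarrow> ('n::{finite,linorder}, 'k::field) mpoly set" where
  "ideal_A a = colon (ideal_gen (quadric a ` {1..CARD('n)})) (quadric a (CARD('n) + 1))"

definition ideal_R_tilde :: "('n::{finite,linorder}, 'k::field) mpoly set" where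
  "ideal_R_tilde = ideal_gen (insert ((\<Sum>i\<in>UNIV. var i)\<^sup>2) ((\<lambda>i. (var i)\<^sup>2) ` UNIV))"

definition ideal_A_tilde :: "('n::{finite,linorder}, 'k::field) mpoly set" where
  "ideal_A_tilde = colon (ideal_gen ((\<lambda>i. (var i)\<^sup>2) ` UNIV)) ((\<Sum>i\<in>UNIV. var i)\<^sup>2)"

text \<open>The standing convention on general quotients by \<open>n + 1\<close> quadrics.\<close>

definition general_position ::
  "(nat \<times> 'n \<times> 'n::{finite,linorder} \<Rightarrow> 'k::field) \<Rightarrow> bool" where
  "general_position a \<longleftrightarrow>
     regular_sequence (quadric a) (CARD('n)) \<and>
     maximal_rank_element (ideal_gen (quadric a ` {1..CARD('n)})) 2 (quadric a (CARD('n) + 1))"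

text \<open>A general quotient satisfies \<open>\<P>\<close>: some nonempty Zariski open set of coefficient points
  satisfies the convention and \<open>\<P>\<close>.  Everything is insensitive to rescaling the coordinates.\<close>

definition general_quotient ::
  "((nat \<times> 'n \<times> 'n::{finite,linorder} \<Rightarrow> 'k::field) \<Rightarrow> bool) \<Rightarrow> bool" where
  "general_quotient \<P> \<longleftrightarrow> (\<exists>U. zariski_open Upsilon U \<and> U \<noteq> {} \<and>
     (\<forall>p\<in>U. \<forall>a\<in>p. general_position a \<and> \<P> a))"

end

theory Submission
  imports Defs "HOL-Library.Function_Algebras" "HOL-Library.FuncSet" "HOL-Library.Nat_Bijection"
begin

text \<open>Graded Betti numbers can only drop under a small deformation that keeps the Hilbert functions.  The
  theorem is this fact near the special point, whose quadrics are the squares of the variables and the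
  square of their sum: on a neighbourhood of it finitely many ranks do not fall below their values
  there, and this already forces general position, constant Hilbert functions and the inequalities.

  By \<open>graded_betti_eq_kdim\<close>, the Betti numbers of \<open>Q / I\<close> are the dimensions of its Koszul homology,
  whatever resolution is chosen.  For graded submodules \<open>N \<subseteq> L\<close> of \<open>Q\<close> the dimension of the Koszul
  homology of \<open>L / N\<close> in homological degree \<open>q\<close> is \<open>dim K\<^sub>q(L) + dim K\<^sub>q\<^sub>-\<^sub>1(N) - dim B\<^sub>q - dim B\<^sub>q\<^sub>-\<^sub>1\<close>, where
  \<open>B\<^sub>q = d K\<^sub>q\<^sub>+\<^sub>1(L) + K\<^sub>q(N)\<close> (\<open>kdim_boundaries\<close>).  The first two terms depend on Hilbert functions only.
  The spaces \<open>B\<^sub>q\<close> are spanned by vectors whose coordinates are polynomials in the coefficients of the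
  quadrics, so their dimensions do not drop near a given point (\<open>near_kboundaries\<close>).  For \<open>R\<close>, take
  \<open>L = Q\<close> and \<open>N = (f\<^sub>1, \<dots>, f\<^sub>n\<^sub>+\<^sub>1)\<close>.  For \<open>A\<close>, multiplication by \<open>f\<^sub>n\<^sub>+\<^sub>1\<close> identifies \<open>A\<close>, up to a shift by
  two degrees, with \<open>L / N\<close> for \<open>L = (f\<^sub>1, \<dots>, f\<^sub>n\<^sub>+\<^sub>1)\<close> and \<open>N = (f\<^sub>1, \<dots>, f\<^sub>n)\<close> (\<open>kdim_A\<close>).

  The Hilbert functions are constant by a rigidity argument.  Near the special point the ideals of the
  first \<open>n\<close> and of all \<open>n + 1\<close> quadrics are at least as large in every degree as at the point itself.
  An ideal of \<open>n\<close> quadrics that is as large as a complete intersection is one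
  (\<open>hilbert_function_rigidity\<close>), and for \<open>n + 1\<close> quadrics maximal rank is the largest value possible
  (\<open>general_position_transfer\<close>).  Finitely many conditions are enough: near the special point \<open>f\<^sub>1, \<dots>, f\<^sub>n\<close>
  generate all forms of degree \<open>n + 1\<close>, so nothing happens in higher degrees.

  The special point is in general position because ideals generated by monomials are easy to divide in,
  and because of the representation theory of \<open>sl\<^sub>2\<close>.  Modulo the squares of the variables, polynomials
  are functions on the subsets of the variables and multiplication by the sum of the variables is the
  raising operator.  It is injective below the middle level and surjective above it, as long as the
  integers \<open>1, \<dots>, n\<close> are invertible in the field.  For odd \<open>n\<close> the two steps that make up multiplication
  by the square of the sum are on the same side of the middle (\<open>maximal_rank_squares\<close>).\<close>

section \<open>Finite-dimensional subspaces\<close>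

locale vspace = vs: vector_space scale
  for scale :: "'a::field \<Rightarrow> 'b::ab_group_add \<Rightarrow> 'b"
begin

text \<open>The modules in question are infinite-dimensional vector spaces with finite-dimensional
  graded pieces, so finiteness is a property of subspaces, not of the ambient space.\<close>

definition fd :: "'b set \<Rightarrow> bool" where
  "fd V \<longleftrightarrow> vs.subspace V \<and> (\<exists>G. finite G \<and> V \<subseteq> vs.span G)"

definition sumset :: "'b set \<Rightarrow> 'b set \<Rightarrow> 'b set" where
  "sumset A B = {x + y | x y. x \<in> A \<and> y \<in> B}"

lemma fd_subspace: "fd V \<Longrightarrow> vs.subspace V"
  by (simp add: fd_def)

lemma fd_subset: "fd V \<Longrightarrow> vs.subspace W \<Longrightarrow> W \<subseteq> V \<Longrightarrow> fd W"
  by (auto simp: fd_def)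

lemma fd_zero: "fd {0}"
  by (auto simp: fd_def intro!: exI[of _ "{}"])

lemma dim_zero_space: "vs.dim {0} = 0"
  using vs.dim_span[of "{}"] vs.dim_eq_card_independent[of "{}"] by (simp add: vs.independent_empty)

lemma fd_span: "finite G \<Longrightarrow> fd (vs.span G)"
  by (auto simp: fd_def)

lemma independent_finite: assumes "fd V" "B \<subseteq> V" "vs.independent B" shows "finite B"
  using assms by (meson fd_def vs.independent_span_bound subset_trans)

lemma fd_basis:
  assumes "fd V" obtains B where "finite B" "B \<subseteq> V" "vs.independent B" "vs.span B = V" "card B = vs.dim V"
proof -
  obtain B where B: "B \<subseteq> V" "vs.independent B" "V \<subseteq> vs.span B" "card B = vs.dim V"
    using vs.basis_exists by blast
  have "vs.span B = V" using B fd_subspace[OF assms] by (simp add: vs.span_minimal subset_antisym)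
  then show ?thesis using that B independent_finite[OF assms] by blast
qed

lemma card_independent_le_dim:
  assumes "fd V" "B \<subseteq> V" "vs.independent B" shows "card B \<le> vs.dim V"
proof -
  obtain C where C: "finite C" "C \<subseteq> V" "vs.independent C" "vs.span C = V" "card C = vs.dim V"
    using fd_basis[OF assms(1)] .
  show ?thesis using vs.independent_span_bound[OF C(1) assms(3)] C assms by auto
qed

lemma dim_mono_fd: assumes "fd V" "W \<subseteq> V" shows "vs.dim W \<le> vs.dim V"
proof -
  obtain B where "B \<subseteq> W" "vs.independent B" "W \<subseteq> vs.span B" "card B = vs.dim W"
    using vs.basis_exists by blast
  then show ?thesis using card_independent_le_dim[OF assms(1), of B] assms by auto
qed

text \<open>A basis of \<open>W\<close> extends to one of \<open>V\<close>; the vectors added span a complement and count the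
  dimension of \<open>V / W\<close>.\<close>

lemma fd_complement:
  assumes "fd V" "vs.subspace W" "W \<subseteq> V"
  obtains C where "finite C" "C \<subseteq> V" "vs.independent C" "vs.dim V = vs.dim W + card C"
    "vs.span C \<inter> W \<subseteq> {0}" "V = sumset W (vs.span C)"
proof -
  obtain B where B: "finite B" "B \<subseteq> W" "vs.independent B" "vs.span B = W" "card B = vs.dim W"
    using fd_basis[OF fd_subset[OF assms]] .
  obtain D where D: "B \<subseteq> D" "D \<subseteq> V" "vs.independent D" "V \<subseteq> vs.span D"
    using vs.maximal_independent_subset_extend[of B V] B assms by auto
  have fD: "finite D" by (rule independent_finite[OF assms(1) D(2,3)])
  have spD: "vs.span D = V" using D fd_subspace[OF assms(1)] by (simp add: vs.span_minimal subset_antisym)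
  let ?C = "D - B"
  have cD: "card D = vs.dim V" using D by (simp add: vs.basis_card_eq_dim)
  show ?thesis
  proof (rule that[of ?C])
    show "vs.dim V = vs.dim W + card ?C"
      using cD B D fD card_mono[OF fD D(1)] by (simp add: card_Diff_subset)
    show "vs.independent ?C" using D(3) vs.independent_mono by blast
    show "vs.span ?C \<inter> W \<subseteq> {0}"
    proof
      fix x assume "x \<in> vs.span ?C \<inter> W"
      then have x: "x \<in> vs.span ?C" "x \<in> vs.span B" using B by auto
      obtain r where r: "x = (\<Sum>b\<in>?C. scale (r b) b)"
        using x(1) vs.span_finite[of ?C] fD by auto
      obtain s where s: "x = (\<Sum>b\<in>B. scale (s b) b)"
        using x(2) vs.span_finite[of B] B by auto
      define t where "t b = (if b \<in> B then - s b else r b)" for b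
      have "(\<Sum>b\<in>D. scale (t b) b) = (\<Sum>b\<in>?C. scale (t b) b) + (\<Sum>b\<in>B. scale (t b) b)"
        using sum.subset_diff[OF D(1) fD] by blast
      also have "(\<Sum>b\<in>?C. scale (t b) b) = x" unfolding r by (rule sum.cong) (auto simp: t_def)
      also have "(\<Sum>b\<in>B. scale (t b) b) = - x" unfolding s sum_negf[symmetric]
        by (rule sum.cong) (auto simp: t_def)
      finally have "(\<Sum>b\<in>D. scale (t b) b) = 0" by simp
      then have "\<And>b. b \<in> D \<Longrightarrow> t b = 0"
        using D(3) fD vs.independent_explicit_finite_subsets[of D] by auto
      then have "\<And>b. b \<in> ?C \<Longrightarrow> r b = 0" unfolding t_def by (metis DiffE)
      then show "x \<in> {0}" unfolding r by (auto intro: sum.neutral)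
    qed
    show "V = sumset W (vs.span ?C)"
    proof -
      have "V = vs.span (B \<union> ?C)" using spD D(1) by (simp add: Un_absorb1)
      also have "\<dots> = sumset W (vs.span ?C)" unfolding vs.span_Un sumset_def B(4) by blast
      finally show ?thesis .
    qed
  qed (use fD D in auto)
qed

lemma sumset_subspace: "vs.subspace A \<Longrightarrow> vs.subspace B \<Longrightarrow> vs.subspace (sumset A B)"
  unfolding sumset_def by (rule vs.subspace_sums)

lemma sumset_fd: assumes "fd A" "fd B" shows "fd (sumset A B)"
proof -
  obtain G H where "finite G" "A \<subseteq> vs.span G" "finite H" "B \<subseteq> vs.span H" using assms by (auto simp: fd_def)
  then have "sumset A B \<subseteq> vs.span (G \<union> H)" "finite (G \<union> H)" unfolding vs.span_Un sumset_def by auto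
  then show ?thesis using sumset_subspace assms unfolding fd_def by blast
qed

lemma sumset_left: "vs.subspace B \<Longrightarrow> A \<subseteq> sumset A B"
  unfolding sumset_def using vs.subspace_0 by force

lemma sumset_right: "vs.subspace A \<Longrightarrow> B \<subseteq> sumset A B"
  unfolding sumset_def using vs.subspace_0 by force

lemma sumset_least: "vs.subspace V \<Longrightarrow> A \<subseteq> V \<Longrightarrow> B \<subseteq> V \<Longrightarrow> sumset A B \<subseteq> V"
  unfolding sumset_def using vs.subspace_add by blast

lemma sumset_span: "sumset (vs.span A) (vs.span B) = vs.span (A \<union> B)"
  unfolding vs.span_Un sumset_def by blast

lemma fd_eqI: assumes "fd V" "vs.subspace W" "W \<subseteq> V" "vs.dim V \<le> vs.dim W" shows "W = V"
proof -
  obtain C where C: "finite C" "C \<subseteq> V" "vs.independent C" "vs.dim V = vs.dim W + card C"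
    "vs.span C \<inter> W \<subseteq> {0}" "V = sumset W (vs.span C)"
    using fd_complement[OF assms(1-3)] .
  then have "C = {}" using assms(4) by simp
  then show ?thesis using C(6) by (auto simp: sumset_def)
qed

end

locale vspace_pair = v1: vspace s1 + v2: vspace s2
  for s1 :: "'a::field \<Rightarrow> 'b::ab_group_add \<Rightarrow> 'b" and s2 :: "'a \<Rightarrow> 'c::ab_group_add \<Rightarrow> 'c"
begin

sublocale vector_space_pair s1 s2 ..

lemma fd_image: assumes "Vector_Spaces.linear s1 s2 f" "v1.fd V" shows "v2.fd (f ` V)"
proof -
  obtain G where G: "finite G" "V \<subseteq> v1.vs.span G" using assms by (auto simp: v1.fd_def)
  then have "f ` V \<subseteq> v2.vs.span (f ` G)" using linear_span_image[OF assms(1)] by blast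
  then show ?thesis
    using G linear_subspace_image[OF assms(1)] assms(2) unfolding v1.fd_def v2.fd_def by blast
qed

text \<open>Rank-nullity for the composite of \<open>f\<close> with the projection modulo \<open>N\<close>, stated without the
  quotient space.\<close>

lemma rank_nullity_modulo:
  assumes f: "Vector_Spaces.linear s1 s2 f" and V: "v1.fd V" and N: "v2.fd N"
  shows "v1.vs.dim {v \<in> V. f v \<in> N} + v2.vs.dim (v2.sumset (f ` V) N) = v1.vs.dim V + v2.vs.dim N"
proof -
  interpret f: Vector_Spaces.linear s1 s2 f by fact
  define K where "K = {v \<in> V. f v \<in> N}"
  have sV: "v1.vs.subspace V" and sN: "v2.vs.subspace N" using V N by (auto simp: v1.fd_def v2.fd_def)
  have sK: "v1.vs.subspace K" using sV sN
    by (auto simp: K_def v1.vs.subspace_def v2.vs.subspace_def f.add f.scale f.zero)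
  have KV: "K \<subseteq> V" by (auto simp: K_def)
  obtain C where C: "finite C" "C \<subseteq> V" "v1.vs.independent C" "v1.vs.dim V = v1.vs.dim K + card C"
    "v1.vs.span C \<inter> K \<subseteq> {0}" "V = v1.sumset K (v1.vs.span C)"
    using v1.fd_complement[OF V sK KV] .
  have CV: "v1.vs.span C \<subseteq> V" using C(2) sV by (simp add: v1.vs.span_minimal)
  have inj: "inj_on f (v1.vs.span C)"
  proof (rule inj_onI)
    fix x y assume "x \<in> v1.vs.span C" "y \<in> v1.vs.span C" "f x = f y"
    then have "x - y \<in> v1.vs.span C" "f (x - y) = 0" by (auto simp: v1.vs.span_diff f.diff)
    then have "x - y \<in> v1.vs.span C \<inter> K" using CV sN by (auto simp: K_def v2.vs.subspace_0)
    then show "x = y" using C(5) by auto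
  qed
  have indep: "v2.vs.independent (f ` C)" using f.independent_injective_image[OF C(3) inj] .
  have cfC: "card (f ` C) = card C" using inj by (meson card_image inj_on_subset v1.vs.span_superset)
  obtain E where E: "finite E" "E \<subseteq> N" "v2.vs.independent E" "v2.vs.span E = N" "card E = v2.vs.dim N"
    using v2.fd_basis[OF N] .
  have dsj: "v2.vs.span (f ` C) \<inter> N \<subseteq> {0}"
  proof
    fix y assume "y \<in> v2.vs.span (f ` C) \<inter> N"
    then obtain x where "x \<in> v1.vs.span C" "y = f x" "y \<in> N" using f.span_image by blast
    then show "y \<in> {0}" using C(5) CV by (auto simp: K_def f.zero)
  qed
  have disj: "f ` C \<inter> E = {}"
  proof (rule ccontr)
    assume "f ` C \<inter> E \<noteq> {}"
    then obtain y where y: "y \<in> f ` C" "y \<in> E" by auto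
    then have "y = 0" using dsj E(2) v2.vs.span_base[OF y(1)] by auto
    then show False using y(1) indep v2.vs.dependent_zero by auto
  qed
  \<comment> \<open>So \<open>f ` C\<close> and \<open>E\<close> together are a basis of \<open>f V + N\<close>.\<close>
  have ind: "v2.vs.independent (f ` C \<union> E)"
  proof (rule v2.vs.independent_if_scalars_zero)
    show "finite (f ` C \<union> E)" using C E by simp
  next
    fix r x assume 0: "(\<Sum>x\<in>f ` C \<union> E. s2 (r x) x) = 0" and x: "x \<in> f ` C \<union> E"
    have "(\<Sum>x\<in>f ` C \<union> E. s2 (r x) x) = (\<Sum>x\<in>f ` C. s2 (r x) x) + (\<Sum>x\<in>E. s2 (r x) x)"
      using C(1) E(1) disj by (rule sum.union_disjoint[OF finite_imageI])
    then have eq: "(\<Sum>x\<in>f ` C. s2 (r x) x) = (\<Sum>x\<in>E. s2 (- r x) x)" 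
      using 0 by (simp add: eq_neg_iff_add_eq_0 sum_negf)
    have "(\<Sum>x\<in>f ` C. s2 (r x) x) \<in> v2.vs.span (f ` C)"
      by (intro v2.vs.span_sum v2.vs.span_scale v2.vs.span_base)
    moreover have "(\<Sum>x\<in>E. s2 (- r x) x) \<in> v2.vs.span E"
      by (intro v2.vs.span_sum v2.vs.span_scale v2.vs.span_base)
    ultimately have "(\<Sum>x\<in>f ` C. s2 (r x) x) = 0" "(\<Sum>x\<in>E. s2 (- r x) x) = 0"
      using dsj eq E by auto
    then have "(\<Sum>x\<in>f ` C. s2 (r x) x) = 0" "(\<Sum>x\<in>E. s2 (r x) x) = 0"
      by (auto simp: sum_negf)
    then show "r x = 0"
      using x v2.vs.independentD[OF indep finite_imageI[OF C(1)] subset_refl]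
        v2.vs.independentD[OF E(3) E(1) subset_refl] by blast
  qed
  have "v2.vs.dim (v2.sumset (f ` V) N) = card (f ` C \<union> E)"
  proof (rule v2.vs.dim_unique[OF _ _ ind])
    show "f ` C \<union> E \<subseteq> v2.sumset (f ` V) N"
      using v2.sumset_left[OF sN, of "f ` V"] v2.sumset_right[OF f.subspace_image[OF sV], of N] C E by blast
    show "v2.sumset (f ` V) N \<subseteq> v2.vs.span (f ` C \<union> E)"
    proof
      fix y assume "y \<in> v2.sumset (f ` V) N"
      then obtain v z where v: "v \<in> V" "z \<in> N" "y = f v + z" by (auto simp: v2.sumset_def)
      then obtain k c where "k \<in> K" "c \<in> v1.vs.span C" "v = k + c" using C(6) by (auto simp: v1.sumset_def)
      then have "y = f c + (f k + z)" "f k + z \<in> N" "f c \<in> v2.vs.span (f ` C)" 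
        using v sN by (auto simp: K_def f.add v2.vs.subspace_add f.span_image)
      then show "y \<in> v2.vs.span (f ` C \<union> E)" unfolding v2.vs.span_Un using E by blast
    qed
  qed simp
  also have "\<dots> = card (f ` C) + card E"
    using C(1) E(1) disj by (intro card_Un_disjoint) auto
  finally show ?thesis using C(4) E(5) cfC K_def by simp
qed

text \<open>The hypotheses make \<open>f\<close> induce an isomorphism \<open>Z / B \<cong> Z' / B'\<close>. The kernels of \<open>f\<close> modulo
  \<open>N\<close> on \<open>Z\<close> and on \<open>B\<close> coincide, so they cancel when rank-nullity for \<open>B\<close> is subtracted from
  rank-nullity for \<open>Z\<close>.\<close>

lemma dim_quotient_eq:
  assumes f: "Vector_Spaces.linear s1 s2 f" and Z: "v1.fd Z" and B: "v1.vs.subspace B" "B \<subseteq> Z"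
    and N: "v2.fd N" and Z': "v2.sumset (f ` Z) N = Z'" and B': "v2.sumset (f ` B) N = B'"
    and ker: "\<And>z. z \<in> Z \<Longrightarrow> f z \<in> N \<Longrightarrow> z \<in> B"
  shows "int (v1.vs.dim Z) - int (v1.vs.dim B) = int (v2.vs.dim Z') - int (v2.vs.dim B')"
proof -
  have eq: "{v \<in> Z. f v \<in> N} = {v \<in> B. f v \<in> N}" using ker B by auto
  show ?thesis
    using rank_nullity_modulo[OF f Z N] rank_nullity_modulo[OF f v1.fd_subset[OF Z B] N]
    unfolding Z' B' eq by linarith
qed

lemma dim_quotient_eq_surj:
  assumes f: "Vector_Spaces.linear s1 s2 f" and Z: "v1.fd Z" and B: "v1.vs.subspace B" "B \<subseteq> Z"
    and Z': "f ` Z = Z'" and B': "f ` B = B'"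
    and ker: "\<And>z. z \<in> Z \<Longrightarrow> f z = 0 \<Longrightarrow> z \<in> B"
  shows "int (v1.vs.dim Z) - int (v1.vs.dim B) = int (v2.vs.dim Z') - int (v2.vs.dim B')"
  by (rule dim_quotient_eq[OF f Z B v2.fd_zero]) (use Z' B' ker in \<open>auto simp: v2.sumset_def\<close>)

end

lemma sum_fun_apply: "(\<Sum>a\<in>A. f a) x = (\<Sum>a\<in>A. f a x)"
  by (induction A rule: infinite_finite_induct) auto

section \<open>Monomials and homogeneous polynomials\<close>

abbreviation lookup where "lookup \<equiv> Poly_Mapping.lookup"
abbreviation keys where "keys \<equiv> Poly_Mapping.keys"
abbreviation single where "single \<equiv> Poly_Mapping.single"

type_synonym ('v, 'k) fvec = "nat \<Rightarrow>\<^sub>0 ('v, 'k) mpoly"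
type_synonym ('n, 'k) coeffs = "nat \<times> 'n \<times> 'n \<Rightarrow> 'k"

text \<open>The exponent vector of a variable, and a monomial as a polynomial.\<close>

abbreviation X :: "'v \<Rightarrow> ('v \<Rightarrow>\<^sub>0 nat)" where "X v \<equiv> single v 1"

abbreviation xpow :: "('v \<Rightarrow>\<^sub>0 nat) \<Rightarrow> ('v, 'k::comm_ring_1) mpoly" where
  "xpow m \<equiv> single m 1"

lemma poly_mapping_sum_single: "p = (\<Sum>m\<in>keys p. single m (lookup p m))"
proof (rule poly_mapping_eqI)
  fix m
  have "lookup (\<Sum>m\<in>keys p. single m (lookup p m)) m
    = (\<Sum>m'\<in>keys p. if m' = m then lookup p m else 0)"
    unfolding lookup_sum by (rule sum.cong) (auto simp: lookup_single)
  then show "lookup p m = lookup (\<Sum>m\<in>keys p. single m (lookup p m)) m"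
    by (auto simp: sum.delta in_keys_iff)
qed

lemma lookup_single_times:
  fixes p :: "('v, 'k::comm_ring_1) mpoly"
  shows "lookup (single k c * p) (k + m) = c * lookup p m"
proof -
  have "lookup (single k c * p) (k + m)
     = (\<Sum>l. (c when k = l) * (\<Sum>q. lookup p q when k + m = l + q))"
    by (simp add: lookup_mult lookup_single)
  also have "\<dots> = (\<Sum>l. (c * (\<Sum>q. lookup p q when k + m = l + q)) when l = k)"
    by (rule Sum_any.cong) (auto simp: when_def)
  also have "\<dots> = c * lookup p m"
    by simp
  finally show ?thesis .
qed

lemma lookup_single_times_0:
  fixes p :: "('v, 'k::comm_ring_1) mpoly"
  assumes "\<And>m'. m \<noteq> k + m'"
  shows "lookup (single k c * p) m = 0"
proof -
  have "lookup (single k c * p) m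
     = (\<Sum>l. (c when k = l) * (\<Sum>q. lookup p q when m = l + q))"
    by (simp add: lookup_mult lookup_single)
  also have "\<dots> = (\<Sum>l. (c * (\<Sum>q. lookup p q when m = l + q)) when l = k)"
    by (rule Sum_any.cong) (auto simp: when_def)
  also have "\<dots> = 0" using assms by simp
  finally show ?thesis .
qed

lemma X_plus_minus: "v \<in> keys m \<Longrightarrow> X v + (m - X v) = m"
  by (rule poly_mapping_eqI) (auto simp: lookup_add lookup_minus lookup_single when_def in_keys_iff)

lemma lookup_var_times:
  "lookup (var v * p) m =
    (if v \<in> keys m then lookup p (m - X v) else 0)"
proof (cases "v \<in> keys m")
  case True
  then show ?thesis using lookup_single_times[of "X v" 1 p "m - X v"]
    unfolding X_plus_minus[OF True] by (simp add: var_def)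
next
  case False
  have "m \<noteq> X v + m'" for m'
    using False by (auto simp: in_keys_iff lookup_add)
  then show ?thesis using False by (simp add: var_def lookup_single_times_0)
qed

lemma lookup_const_times [simp]:
  fixes p :: "('v, 'k::comm_ring_1) mpoly"
  shows "lookup (single 0 c * p) m = c * lookup p m"
  using lookup_single_times[of 0 c p m] by simp

lemma lookup_sign_times:
  fixes p :: "('v, 'k::comm_ring_1) mpoly"
  shows "lookup ((-1) ^ n * p) m = (-1) ^ n * lookup p m"
  by (cases "even n") auto

lemma mon_deg_sum: "mon_deg (m :: 'v::finite \<Rightarrow>\<^sub>0 nat) = (\<Sum>v\<in>UNIV. lookup m v)"
  unfolding mon_deg_def by (rule sum.mono_neutral_left) (auto simp: in_keys_iff)

lemma mon_deg_superset:
  "finite A \<Longrightarrow> keys m \<subseteq> A \<Longrightarrow> mon_deg m = (\<Sum>v\<in>A. lookup m v)"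
  unfolding mon_deg_def by (rule sum.mono_neutral_left) (auto simp: in_keys_iff)

lemma mon_deg_add [simp]: "mon_deg (a + b) = mon_deg a + mon_deg b"
  using mon_deg_superset[of "keys a \<union> keys b"] keys_add[of a b]
  by (simp add: lookup_add sum.distrib)

lemma mon_deg_zero [simp]: "mon_deg 0 = 0" by (simp add: mon_deg_def)

lemma mon_deg_single [simp]: "mon_deg (single v n) = n"
  by (simp add: mon_deg_def)

lemma finite_mon_deg: "finite {m :: 'v::finite \<Rightarrow>\<^sub>0 nat. mon_deg m = e}"
proof -
  have "lookup ` {m :: 'v \<Rightarrow>\<^sub>0 nat. mon_deg m = e} \<subseteq> PiE UNIV (\<lambda>_. {..e})"
    by (auto simp: mon_deg_sum PiE_iff intro: member_le_sum)
  moreover have "finite (PiE (UNIV :: 'v set) (\<lambda>_. {..e}))" by (intro finite_PiE) auto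
  ultimately have "finite (lookup ` {m :: 'v \<Rightarrow>\<^sub>0 nat. mon_deg m = e})"
    by (rule finite_subset)
  then show ?thesis
    by (rule finite_imageD) (simp add: inj_on_def lookup_inject)
qed

lemma homogeneous_lookup: "homogeneous d p \<longleftrightarrow> (\<forall>m. lookup p m \<noteq> 0 \<longrightarrow> mon_deg m = d)"
  by (auto simp: homogeneous_def in_keys_iff)

lemma homogeneous_vec_lookup:
  "homogeneous_vec \<delta> d v \<longleftrightarrow>
     (\<forall>t m. lookup (lookup v t) m \<noteq> 0 \<longrightarrow> mon_deg m + \<delta> t = d)"
  by (auto simp: homogeneous_vec_def in_keys_iff)

lemma homogeneous_0 [simp]: "homogeneous d 0" by (simp add: homogeneous_def)

lemma homogeneous_add: "homogeneous d p \<Longrightarrow> homogeneous d q \<Longrightarrow> homogeneous d (p + q)"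
  unfolding homogeneous_lookup lookup_add by (metis add_0)

lemma homogeneous_sum: "(\<And>i. i \<in> A \<Longrightarrow> homogeneous d (f i)) \<Longrightarrow> homogeneous d (sum f A)"
  by (induction A rule: infinite_finite_induct) (auto intro: homogeneous_add)

lemma homogeneous_mult:
  fixes p q :: "('v, 'k::comm_ring_1) mpoly"
  assumes "homogeneous d p" "homogeneous e q" shows "homogeneous (d + e) (p * q)"
  unfolding homogeneous_def
proof
  fix m assume "m \<in> keys (p * q)"
  then obtain a b where "a \<in> keys p" "b \<in> keys q" "m = a + b"
    using keys_mult[of p q] by blast
  then show "mon_deg m = d + e" using assms by (simp add: homogeneous_def)
qed

lemma homogeneous_single [simp]: "homogeneous (mon_deg m) (single m c)"
  by (auto simp: homogeneous_def)

lemma homogeneous_var [simp]: "homogeneous 1 (var v)"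
  unfolding var_def using homogeneous_single[of "X v" 1] by simp

section \<open>The Koszul complex of a module\<close>

text \<open>The sign that arises when the basis vector of \<open>v\<close> is moved to its place in the wedge
  product of those in \<open>T\<close>.\<close>

definition ksgn :: "'v::linorder \<Rightarrow> 'v set \<Rightarrow> 'r::comm_ring_1" where
  "ksgn v T = (-1) ^ card {w \<in> T. w < v}"

lemma lookup_ksgn_times:
  fixes p :: "('v::linorder, 'k::comm_ring_1) mpoly"
  shows "lookup (ksgn v T * p) m = ksgn v T * lookup p m"
  by (simp add: ksgn_def lookup_sign_times)

lemma ksgn_min: "(\<And>w. w \<in> T \<Longrightarrow> v \<le> w) \<Longrightarrow> ksgn v T = 1"
proof -
  assume "\<And>w. w \<in> T \<Longrightarrow> v \<le> w"
  then have "{w \<in> T. w < v} = {}" by force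
  then show ?thesis by (simp only: ksgn_def card.empty power_0)
qed

lemma ksgn_insert_less:
  fixes T :: "'v::{finite,linorder} set"
  assumes "w < v" "w \<notin> T" shows "ksgn v (insert w T) = - ksgn v T"
proof -
  have "{u \<in> insert w T. u < v} = insert w {u \<in> T. u < v}" using assms by auto
  then show ?thesis using assms by (simp add: ksgn_def)
qed

lemma ksgn_insert_greater:
  assumes "v < w" shows "ksgn v (insert w T) = ksgn v T"
proof -
  have "{u \<in> insert w T. u < v} = {u \<in> T. u < v}" using assms by auto
  then show ?thesis by (simp add: ksgn_def)
qed

text \<open>Removing two basis vectors from a wedge product in the two possible orders gives opposite
  signs.\<close>

lemma ksgn_swap:
  fixes T :: "'v::{finite,linorder} set"
  assumes "v \<noteq> w" "v \<notin> T" "w \<notin> T"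
  shows "ksgn v T * ksgn w (insert v T) = - (ksgn w T * ksgn v (insert w T) :: 'r::comm_ring_1)"
proof (cases "v < w")
  case True then show ?thesis using assms by (simp add: ksgn_insert_less ksgn_insert_greater)
next
  case False then have "w < v" using assms by auto
  then show ?thesis using assms by (simp add: ksgn_insert_less ksgn_insert_greater)
qed

text \<open>A module over the polynomial ring \<open>Q\<close>. The constants make the module and the functions
  from sets of variables to it into vector spaces, with scalar multiplications \<open>sc\<close> and \<open>csc\<close>.\<close>

locale qmodule = module act
  for act :: "('v::{finite,linorder}, 'k::field) mpoly \<Rightarrow> 'm::ab_group_add \<Rightarrow> 'm"
begin

definition sc :: "'k \<Rightarrow> 'm \<Rightarrow> 'm" where
  "sc c x = act (single 0 c) x"

definition csc :: "'k \<Rightarrow> ('v set \<Rightarrow> 'm) \<Rightarrow> ('v set \<Rightarrow> 'm)" where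
  "csc c f = (\<lambda>S. sc c (f S))"

sublocale V: vspace sc
  by unfold_locales (auto simp: sc_def scale_right_distrib scale_left_distrib single_add mult_single)

sublocale C: vspace csc
  by unfold_locales (auto simp: csc_def V.vs.scale_right_distrib V.vs.scale_left_distrib fun_eq_iff)

text \<open>The family of the graded pieces of a graded submodule.\<close>

definition graded_family :: "(nat \<Rightarrow> 'm set) \<Rightarrow> bool" where
  "graded_family L \<longleftrightarrow> (\<forall>e. V.fd (L e)) \<and> (\<forall>e v. \<forall>x\<in>L e. act (var v) x \<in> L (Suc e))"

text \<open>The elements of homological degree \<open>q\<close> and internal degree \<open>j\<close> of the Koszul complex: \<open>c
  S\<close> is the coefficient of the wedge product of the basis vectors in \<open>S\<close>, which has degree \<open>q\<close>.
  If \<open>q\<close> exceeds \<open>j\<close>, the difference \<open>j - q\<close> is truncated and there must be no chains.\<close>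

definition chains :: "(nat \<Rightarrow> 'm set) \<Rightarrow> nat \<Rightarrow> nat \<Rightarrow> ('v set \<Rightarrow> 'm) set" where
  "chains L q j = {c. \<forall>S. c S \<in> (if card S = q \<and> q \<le> j then L (j - q) else {0})}"

text \<open>The Koszul differential, as an operation on coefficients.\<close>

definition kd :: "('v set \<Rightarrow> 'm) \<Rightarrow> ('v set \<Rightarrow> 'm)" where
  "kd c T = (\<Sum>v\<in>-T. act (ksgn v T * var v) (c (insert v T)))"

definition place :: "'v set \<Rightarrow> 'm \<Rightarrow> ('v set \<Rightarrow> 'm)" where
  "place S x = (\<lambda>S'. if S' = S then x else 0)"

lemma graded_family_subspace: "graded_family L \<Longrightarrow> V.vs.subspace (L e)"
  by (simp add: graded_family_def V.fd_def)

lemma graded_family_zero: "graded_family L \<Longrightarrow> 0 \<in> L e"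
  using graded_family_subspace V.vs.subspace_0 by blast

lemma graded_family_trivial: "graded_family (\<lambda>_. {0})"
  by (simp add: graded_family_def V.fd_zero)

lemma chainsI:
  assumes "\<And>S. card S = q \<Longrightarrow> q \<le> j \<Longrightarrow> c S \<in> L (j - q)"
    "\<And>S. \<not> (card S = q \<and> q \<le> j) \<Longrightarrow> c S = 0"
  shows "c \<in> chains L q j"
  using assms by (auto simp: chains_def)

lemma chainsD: "c \<in> chains L q j \<Longrightarrow> card S = q \<Longrightarrow> q \<le> j \<Longrightarrow> c S \<in> L (j - q)"
  "c \<in> chains L q j \<Longrightarrow> \<not> (card S = q \<and> q \<le> j) \<Longrightarrow> c S = 0"
  unfolding chains_def by (auto dest: spec[of _ S] split: if_splits)

lemma chains_mono: "(\<And>e. L e \<subseteq> L' e) \<Longrightarrow> chains L q j \<subseteq> chains L' q j"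
  by (auto simp: chains_def split: if_splits)

lemma zero_in_chains: "graded_family L \<Longrightarrow> 0 \<in> chains L q j"
  by (auto simp: chains_def graded_family_zero)

lemma chains_trivial: "chains (\<lambda>_. {0}) q j = {0}"
  by (auto simp: chains_def fun_eq_iff)

lemma chains_subspace: assumes "graded_family L" shows "C.vs.subspace (chains L q j)"
proof -
  have s: "V.vs.subspace (L e)" for e by (rule graded_family_subspace[OF assms])
  show ?thesis
    unfolding C.vs.subspace_def
  proof (intro conjI ballI allI)
    show "0 \<in> chains L q j" by (rule zero_in_chains[OF assms])
    show "x + y \<in> chains L q j" if "x \<in> chains L q j" "y \<in> chains L q j" for x y
      using chainsD[OF that(1)] chainsD[OF that(2)]
      by (intro chainsI) (simp_all add: V.vs.subspace_add[OF s])
    show "csc r x \<in> chains L q j" if "x \<in> chains L q j" for r x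
      using chainsD[OF that] by (intro chainsI) (simp_all add: csc_def V.vs.subspace_scale[OF s])
  qed
qed

lemma linear_place: "Vector_Spaces.linear sc csc (place S)"
  by unfold_locales (auto simp: place_def csc_def fun_eq_iff)

lemma sum_place: "c = (\<Sum>S\<in>UNIV. place S (c S))"
proof
  fix T
  have "(\<Sum>S\<in>UNIV. place S (c S)) T = (\<Sum>S\<in>UNIV. place S (c S) T)"
    by (simp add: sum_fun_apply)
  also have "\<dots> = c T" by (simp add: place_def)
  finally show "c T = (\<Sum>S\<in>UNIV. place S (c S)) T" by simp
qed

lemma chains_span:
  assumes "graded_family L" "q \<le> j" "L (j - q) = V.vs.span G"
  shows "chains L q j = C.vs.span {place S g | S g. card S = q \<and> g \<in> G}" (is "_ = C.vs.span ?P")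
proof
  have pl: "place S ` V.vs.span G = C.vs.span (place S ` G)" for S
    using module_hom.span_image[of sc csc "place S" G] linear_place[of S]
    by (auto simp: linear_iff_module_hom)
  show "chains L q j \<subseteq> C.vs.span ?P"
  proof
    fix c assume c: "c \<in> chains L q j"
    have "place S (c S) \<in> C.vs.span ?P" for S
    proof (cases "card S = q")
      case True
      then have "c S \<in> V.vs.span G" using chainsD(1)[OF c True assms(2)] assms(3) by simp
      then have "place S (c S) \<in> C.vs.span (place S ` G)" using pl by blast
      then show ?thesis using C.vs.span_mono[of "place S ` G" ?P] True by auto
    next
      case False
      then have "c S = 0" using chainsD(2)[OF c] by auto
      then have "place S (c S) = 0" by (auto simp: place_def)
      then show ?thesis by (simp add: C.vs.span_zero)
    qed
    then have "(\<Sum>S\<in>UNIV. place S (c S)) \<in> C.vs.span ?P" by (rule C.vs.span_sum)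
    then show "c \<in> C.vs.span ?P" by (simp only: sum_place[symmetric])
  qed
  show "C.vs.span ?P \<subseteq> chains L q j"
    using assms V.vs.span_base[of _ G]
    by (intro C.vs.span_minimal chains_subspace) (auto simp: chains_def place_def V.vs.span_zero)
qed

lemma chains_gt: assumes "j < q" shows "chains L q j = {0}"
  using assms by (auto simp: chains_def fun_eq_iff)

lemma chains_fd: assumes "graded_family L" shows "C.fd (chains L q j)"
proof (cases "q \<le> j")
  case True
  have "V.fd (L (j - q))" using assms by (simp add: graded_family_def)
  then obtain G where G: "finite G" "V.vs.span G = L (j - q)" using V.fd_basis by metis
  have "{place S g | S g. card S = q \<and> g \<in> G} \<subseteq> (\<lambda>(S, g). place S g) ` (UNIV \<times> G)" by auto
  then have "finite {place S g | S g. card S = q \<and> g \<in> G}"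
    using G(1) by (meson finite_SigmaI finite_imageI finite_subset finite_class.finite_UNIV)
  then show ?thesis using chains_span[OF assms True G(2)[symmetric]] C.fd_span by simp
qed (simp add: chains_gt C.fd_zero)

lemma linear_kd: "Vector_Spaces.linear csc csc kd"
proof unfold_locales
  show "kd (b1 + b2) = kd b1 + kd b2" for b1 b2
    by (auto simp: kd_def fun_eq_iff scale_right_distrib sum.distrib)
  show "kd (csc r b) = csc r (kd b)" for r b
    by (auto simp: kd_def csc_def sc_def fun_eq_iff scale_sum_right mult.commute intro!: sum.cong)
qed

lemma kd_plus: "kd (a + b) = kd a + kd b"
  using linear_kd by (simp add: Vector_Spaces.linear_iff)
lemma kd_csc: "kd (csc r b) = csc r (kd b)"
  using linear_kd by (simp add: Vector_Spaces.linear_iff)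
lemma kd_zero [simp]: "kd 0 = 0"
  by (auto simp: kd_def fun_eq_iff)

text \<open>The terms in which \<open>v\<close> and \<open>w\<close> are removed in the two possible orders cancel.\<close>

lemma kd_kd: "kd (kd c) = 0"
proof
  fix T
  define g where "g v w = act (ksgn v T * var v * (ksgn w (insert v T) * var w)) (c (insert w (insert v T)))" for v w
  define A where "A = {(v, w). v \<notin> T \<and> w \<notin> T \<and> v < w}"
  have "kd (kd c) T = (\<Sum>v\<in>-T. \<Sum>w\<in>-(insert v T). g v w)"
    by (simp add: kd_def scale_sum_right g_def)
  also have "\<dots> = (\<Sum>(v,w)\<in>(SIGMA v:-T. -(insert v T)). g v w)"
    by (rule sum.Sigma) auto
  also have "(SIGMA v:-T. -(insert v T)) = A \<union> prod.swap ` A" by (auto simp: A_def)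
  also have "(\<Sum>(v,w)\<in>A \<union> prod.swap ` A. g v w) = (\<Sum>(v,w)\<in>A. g v w) + (\<Sum>(v,w)\<in>prod.swap ` A. g v w)"
    by (rule sum.union_disjoint) (auto simp: A_def)
  also have "(\<Sum>(v,w)\<in>prod.swap ` A. g v w) = (\<Sum>(v,w)\<in>A. g w v)"
    by (subst sum.reindex) (auto simp: case_prod_beta)
  also have "(\<Sum>(v,w)\<in>A. g v w) + (\<Sum>(v,w)\<in>A. g w v) = (\<Sum>(v,w)\<in>A. g v w + g w v)"
    by (simp add: sum.distrib[symmetric] case_prod_beta)
  also have "\<dots> = 0"
  proof (rule sum.neutral, clarify)
    fix v w assume "(v, w) \<in> A"
    then have vw: "v \<noteq> w" "v \<notin> T" "w \<notin> T" by (auto simp: A_def)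
    have "ksgn v T * var v * (ksgn w (insert v T) * var w) = 
       (ksgn v T * ksgn w (insert v T)) * (var v * var w :: ('v,'k) mpoly)"
      by (simp add: ac_simps)
    also have "\<dots> = - (ksgn w T * var w * (ksgn v (insert w T) * var v))"
      unfolding ksgn_swap[OF vw] by (simp add: ac_simps)
    finally show "g v w + g w v = 0"
      unfolding g_def by (simp add: insert_commute scale_minus_left)
  qed
  finally show "kd (kd c) T = 0 T" by simp
qed

lemma ksgn_cases: "ksgn v T = (1 :: 'r::comm_ring_1) \<or> ksgn v T = (-1 :: 'r)"
  by (cases "even (card {w \<in> T. w < v})") (auto simp: ksgn_def)

lemma kd_chains: assumes L: "graded_family L" and c: "c \<in> chains L q j" shows "kd c \<in> chains L (q - 1) j"
proof (rule chainsI)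
  note s = graded_family_subspace[OF L]
  fix T :: "'v set"
  have z: "kd c T = 0" if "\<not> (Suc (card T) = q \<and> q \<le> j)"
    unfolding kd_def by (rule sum.neutral) (use that chainsD(2)[OF c] in auto)
  show "kd c T = 0" if "\<not> (card T = q - 1 \<and> q - 1 \<le> j)" using that z by fastforce
  show "kd c T \<in> L (j - (q - 1))" if "card T = q - 1" "q - 1 \<le> j"
  proof (cases "Suc (card T) = q \<and> q \<le> j")
    case False
    then show ?thesis using z V.vs.subspace_0[OF s] by simp
  next
    case True
    then have Suc: "j - (q - 1) = Suc (j - q)" by auto
    have "act (ksgn v T * var v) (c (insert v T)) \<in> L (Suc (j - q))" if "v \<in> - T" for v
    proof -
      have "c (insert v T) \<in> L (j - q)" using that True by (intro chainsD(1)[OF c]) auto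
      then have "act (var v) (c (insert v T)) \<in> L (Suc (j - q))" using L by (auto simp: graded_family_def)
      then show ?thesis using ksgn_cases[of v T, where 'r = "('v, 'k) mpoly"]
          V.vs.subspace_neg[OF s]
        by (elim disjE) (simp_all add: scale_minus_left)
    qed
    then show ?thesis unfolding kd_def Suc by (intro V.vs.subspace_sum[OF s])
  qed
qed

lemma kd_chains_0: assumes c: "c \<in> chains L 0 j" shows "kd c = 0"
  unfolding kd_def fun_eq_iff using chainsD(2)[OF c] by (auto intro!: sum.neutral)

lemma kd_chains_Suc: "graded_family L \<Longrightarrow> c \<in> chains L (Suc q) j \<Longrightarrow> kd c \<in> chains L q j"
  using kd_chains by fastforce

text \<open>Cycles and boundaries of the Koszul complex of \<open>L / N\<close> are represented by their preimages
  in that of \<open>L\<close>. In homological degree \<open>0\<close> the truncated \<open>q - 1\<close> does no harm, as \<open>kd\<close> is zero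
  there.\<close>

definition kcycles where
  "kcycles L N q j = {c \<in> chains L q j. kd c \<in> chains N (q - 1) j}"

definition kboundaries where
  "kboundaries L N q j = C.sumset (kd ` chains L (Suc q) j) (chains N q j)"

text \<open>The dimension of the Koszul homology of \<open>L / N\<close>.\<close>

definition kdim where
  "kdim L N q j = int (C.vs.dim (kcycles L N q j)) - int (C.vs.dim (kboundaries L N q j))"

lemma kcycles_fd:
  assumes "graded_family L" "graded_family N" shows "C.fd (kcycles L N q j)"
proof (rule C.fd_subset[OF chains_fd[OF assms(1)]])
  note s = chains_subspace[OF assms(1), of q j] chains_subspace[OF assms(2), of "q - 1" j]
  show "C.vs.subspace (kcycles L N q j)"
    unfolding kcycles_def C.vs.subspace_def
    using C.vs.subspace_0[OF s(1)] C.vs.subspace_0[OF s(2)] C.vs.subspace_add[OF s(1)]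
      C.vs.subspace_add[OF s(2)] C.vs.subspace_scale[OF s(1)] C.vs.subspace_scale[OF s(2)]
    by (simp add: kd_plus kd_csc)
qed (auto simp: kcycles_def)

lemma kd_image_fd: "graded_family L \<Longrightarrow> C.fd (kd ` chains L q j)"
  using vspace_pair.fd_image[of csc csc kd] linear_kd chains_fd C.vspace_axioms by (simp add: vspace_pair_def)

lemma kboundaries_subspace:
  assumes "graded_family L" "graded_family N" shows "C.vs.subspace (kboundaries L N q j)"
  unfolding kboundaries_def
  by (intro C.sumset_subspace C.fd_subspace kd_image_fd chains_fd assms)

lemma kboundaries_subset:
  assumes "graded_family L" "graded_family N" "\<And>e. N e \<subseteq> L e"
  shows "kboundaries L N q j \<subseteq> kcycles L N q j"
  unfolding kboundaries_def
proof (rule C.sumset_least)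
  show "C.vs.subspace (kcycles L N q j)" using kcycles_fd[OF assms(1,2)] C.fd_subspace by blast
  show "kd ` chains L (Suc q) j \<subseteq> kcycles L N q j"
    using kd_chains_Suc[OF assms(1)] by (auto simp: kcycles_def kd_kd zero_in_chains[OF assms(2)])
  show "chains N q j \<subseteq> kcycles L N q j"
    using kd_chains[OF assms(2)] chains_mono[of N L, OF assms(3), of q j] by (auto simp: kcycles_def)
qed

lemma vspace_pair_self: "vspace_pair csc csc" "vspace_pair csc sc"
  by (simp_all add: vspace_pair_def C.vspace_axioms V.vspace_axioms)

text \<open>Induction on the support: evaluation at one more index maps the larger space onto \<open>M T\<close>
  with the smaller space as kernel.\<close>

lemma dim_supported:
  assumes "finite A" and M: "\<And>S. V.fd (M S)"
  shows "C.vs.dim {c. \<forall>S. c S \<in> (if S \<in> A then M S else {0})} = (\<Sum>S\<in>A. V.vs.dim (M S))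
    \<and> C.fd {c. \<forall>S. c S \<in> (if S \<in> A then M S else {0})}"
  using assms(1)
proof (induction A)
  case empty
  have "{c. \<forall>S. c S \<in> (if S \<in> {} then M S else {0})} = {0}" by (auto simp: fun_eq_iff)
  then show ?case using C.fd_zero C.dim_zero_space by simp
next
  case (insert T A)
  define W where "W B = {c. \<forall>S. c S \<in> (if S \<in> B then M S else {0})}" for B
  note s = V.fd_subspace[OF M]
  have lin: "Vector_Spaces.linear csc sc (\<lambda>c. c T)"
    by unfold_locales (auto simp: csc_def)
  have pW: "x S \<in> M S" if "x \<in> W B" "S \<in> B" for x S B
    using that by (auto simp: W_def dest: spec[of _ S])
  have nW: "x S = 0" if "x \<in> W B" "S \<notin> B" for x S B
    using that by (auto simp: W_def dest: spec[of _ S])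
  have Wsub: "C.vs.subspace (W B)" for B
    unfolding C.vs.subspace_def W_def
    by (auto simp: csc_def V.vs.subspace_0[OF s] V.vs.subspace_add[OF s] V.vs.subspace_scale[OF s]
        dest!: spec)
  have im: "(\<lambda>c. c T) ` W (insert T A) = M T"
  proof
    show "M T \<subseteq> (\<lambda>c. c T) ` W (insert T A)"
    proof
      fix x assume "x \<in> M T"
      then have "place T x \<in> W (insert T A)"
        by (auto simp: W_def place_def V.vs.subspace_0[OF s])
      then show "x \<in> (\<lambda>c. c T) ` W (insert T A)"
        by (intro image_eqI[where x = "place T x"]) (auto simp: place_def)
    qed
  qed (use pW in auto)
  have kern: "{v \<in> W (insert T A). v T \<in> {0}} = W A"
  proof (intro equalityI subsetI)
    fix v assume v: "v \<in> {v \<in> W (insert T A). v T \<in> {0}}"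
    show "v \<in> W A" unfolding W_def
    proof (intro CollectI allI)
      fix S show "v S \<in> (if S \<in> A then M S else {0})"
        using v pW[of v "insert T A" S] nW[of v "insert T A" S] by (cases "S = T") (auto simp: V.vs.subspace_0[OF s])
    qed
  next
    fix v assume v: "v \<in> W A"
    have "v \<in> W (insert T A)" unfolding W_def
    proof (intro CollectI allI)
      fix S show "v S \<in> (if S \<in> insert T A then M S else {0})"
        using v pW[of v A S] nW[of v A S] by (cases "S \<in> A") (auto simp: V.vs.subspace_0[OF s])
    qed
    then show "v \<in> {v \<in> W (insert T A). v T \<in> {0}}" using nW[OF v insert(2)] by simp
  qed
  have "W (insert T A) \<subseteq> C.sumset (W A) (place T ` M T)"
  proof
    fix c assume c: "c \<in> W (insert T A)"
    have "c(T := 0) \<in> W A" unfolding W_def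
    proof (intro CollectI allI)
      fix S show "(c(T := 0)) S \<in> (if S \<in> A then M S else {0})"
        using pW[OF c, of S] nW[OF c, of S] by (auto simp: V.vs.subspace_0[OF s])
    qed
    moreover have "c = c(T := 0) + place T (c T)" by (auto simp: place_def fun_eq_iff)
    ultimately show "c \<in> C.sumset (W A) (place T ` M T)"
      using pW[OF c, of T] unfolding C.sumset_def by blast
  qed
  moreover have "C.fd (place T ` M T)"
    using vspace_pair.fd_image[of sc csc "place T" "M T"] linear_place M
    by (simp add: vspace_pair_def C.vspace_axioms V.vspace_axioms)
  ultimately have fdW: "C.fd (W (insert T A))"
    using C.fd_subset[OF C.sumset_fd Wsub] insert.IH unfolding W_def by blast
  have "V.sumset ((\<lambda>c. c T) ` W (insert T A)) {0} = M T"
    unfolding im by (auto simp: V.sumset_def)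
  then have "C.vs.dim (W A) + V.vs.dim (M T) = C.vs.dim (W (insert T A))"
    using vspace_pair.rank_nullity_modulo[OF vspace_pair_self(2) lin fdW V.fd_zero] kern V.dim_zero_space by simp
  then show ?case using insert fdW by (simp add: W_def)
qed

lemma dim_chains:
  assumes "graded_family L"
  shows "C.vs.dim (chains L q j) = (if q \<le> j then card {S :: 'v set. card S = q} * V.vs.dim (L (j - q)) else 0)"
proof (cases "q \<le> j")
  case True
  then have "chains L q j = {c. \<forall>S. c S \<in> (if S \<in> {S. card S = q} then L (j - q) else {0})}"
    by (simp add: chains_def)
  then show ?thesis using True dim_supported[of "{S. card S = q}" "\<lambda>_. L (j - q)"] assms
    by (simp add: graded_family_def)
next
  case False
  then show ?thesis by (simp add: chains_gt C.dim_zero_space)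
qed

text \<open>The cycles are the kernel of the differential modulo the chains of \<open>N\<close>, and its image
  together with these chains is the space of boundaries one homological degree lower. So
  rank-nullity expresses the homology through boundaries and through the dimensions of the
  modules.\<close>

lemma kdim_boundaries:
  assumes "graded_family L" "graded_family N" "\<And>e. N e \<subseteq> L e"
  shows "kdim L N (Suc q) j + C.vs.dim (kboundaries L N (Suc q) j) + C.vs.dim (kboundaries L N q j)
     = C.vs.dim (chains L (Suc q) j) + C.vs.dim (chains N q j)"
  using vspace_pair.rank_nullity_modulo[OF vspace_pair_self(1) linear_kd 
      chains_fd[OF assms(1), of "Suc q" j] chains_fd[OF assms(2), of q j]]
  by (simp add: kdim_def kcycles_def kboundaries_def)

lemma kcycles_0: assumes "graded_family N" shows "kcycles L N 0 j = chains L 0 j"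
  by (auto simp: kcycles_def kd_chains_0 zero_in_chains[OF assms])

lemma kdim_boundaries_0:
  assumes "graded_family N"
  shows "kdim L N 0 j + C.vs.dim (kboundaries L N 0 j) = C.vs.dim (chains L 0 j)"
  by (simp add: kdim_def kcycles_0[OF assms])

lemma kdim_eq_0:
  assumes "graded_family L" "graded_family N" "\<And>e. N e \<subseteq> L e" "chains L q j \<subseteq> chains N q j"
  shows "kdim L N q j = 0"
proof -
  have "chains N q j \<subseteq> kboundaries L N q j" unfolding kboundaries_def
    by (intro C.sumset_right C.fd_subspace kd_image_fd assms)
  then have "kcycles L N q j = kboundaries L N q j"
    using kboundaries_subset[OF assms(1-3), of q j] assms(4) by (auto simp: kcycles_def)
  then show ?thesis by (simp add: kdim_def)
qed

lemma kdim_nonneg: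
  assumes "graded_family L" "graded_family N" "\<And>e. N e \<subseteq> L e"
  shows "0 \<le> kdim L N q j"
  using C.dim_mono_fd[OF kcycles_fd[OF assms(1,2)] kboundaries_subset[OF assms], of q j]
  by (simp add: kdim_def)

text \<open>For equal Hilbert functions, larger spaces of boundaries mean smaller homology, since both
  spaces of boundaries in the formula above have a negative sign.\<close>

lemma kdim_le:
  assumes "graded_family L" "graded_family N" "\<And>e. N e \<subseteq> L e"
    and "graded_family L'" "graded_family N'" "\<And>e. N' e \<subseteq> L' e"
    and "\<And>e. V.vs.dim (L e) = V.vs.dim (L' e)" "\<And>e. V.vs.dim (N e) = V.vs.dim (N' e)"
    and "C.vs.dim (kboundaries L' N' q j) \<le> C.vs.dim (kboundaries L N q j)"
    and "C.vs.dim (kboundaries L' N' (q - 1) j) \<le> C.vs.dim (kboundaries L N (q - 1) j)"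
  shows "kdim L N q j \<le> kdim L' N' q j"
proof (cases q)
  case 0
  have "C.vs.dim (chains L q j) = C.vs.dim (chains L' q j)" by (simp add: dim_chains assms)
  then show ?thesis
    using kdim_boundaries_0[OF assms(2), of L j] kdim_boundaries_0[OF assms(5), of L' j] assms(9) 0 by simp
next
  case (Suc p)
  have "C.vs.dim (chains L q j) = C.vs.dim (chains L' q j)" "C.vs.dim (chains N p j) = C.vs.dim (chains N' p j)"
    by (simp_all add: dim_chains assms)
  then show ?thesis
    using kdim_boundaries[OF assms(1-3), of p j] kdim_boundaries[OF assms(4-6), of p j] assms(9,10) Suc by simp
qed

definition acyclic :: "(nat \<Rightarrow> 'm set) \<Rightarrow> bool" where
  "acyclic L \<longleftrightarrow> (\<forall>q j. \<forall>c\<in>chains L (Suc q) j. kd c = 0 \<longrightarrow> c \<in> kd ` chains L (Suc (Suc q)) j)"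

text \<open>Dimension shifting: if the Koszul complex of \<open>L\<close> is exact in positive degrees, the
  connecting map of \<open>0 \<rightarrow> N \<rightarrow> L \<rightarrow> L / N \<rightarrow> 0\<close> identifies the homologies of \<open>L / N\<close> and of \<open>N\<close>.\<close>

lemma kdim_shift:
  assumes L: "graded_family L" and N: "graded_family N" and NL: "\<And>e. N e \<subseteq> L e" and ac: "acyclic L"
  shows "kdim L N (Suc (Suc q)) j = kdim N (\<lambda>_. {0}) (Suc q) j"
  unfolding kdim_def
proof (rule vspace_pair.dim_quotient_eq_surj[OF vspace_pair_self(1) linear_kd kcycles_fd[OF L N] 
      kboundaries_subspace[OF L N] kboundaries_subset[OF L N NL]])
  show "kd ` kcycles L N (Suc (Suc q)) j = kcycles N (\<lambda>_. {0}) (Suc q) j"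
  proof (intro equalityI subsetI)
    fix c assume "c \<in> kcycles N (\<lambda>_. {0}) (Suc q) j"
    then have c: "c \<in> chains N (Suc q) j" "kd c = 0" by (auto simp: kcycles_def chains_trivial)
    then have "c \<in> kd ` chains L (Suc (Suc q)) j"
      using ac chains_mono[of N L, OF NL, of "Suc q" j] by (auto simp: acyclic_def)
    then show "c \<in> kd ` kcycles L N (Suc (Suc q)) j" using c by (auto simp: kcycles_def)
  qed (auto simp: kcycles_def chains_trivial kd_kd)
  show "kd ` kboundaries L N (Suc (Suc q)) j = kboundaries N (\<lambda>_. {0}) (Suc q) j"
    using zero_in_chains[OF L, of "Suc (Suc (Suc q))" j]
    by (auto simp: kboundaries_def C.sumset_def chains_trivial kd_plus kd_kd image_iff) 
      (metis add_0 kd_zero)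
  fix z assume "z \<in> kcycles L N (Suc (Suc q)) j" "kd z = 0"
  then have "z \<in> kd ` chains L (Suc (Suc (Suc q))) j" using ac by (auto simp: acyclic_def kcycles_def)
  then show "z \<in> kboundaries L N (Suc (Suc q)) j"
    unfolding kboundaries_def using C.sumset_left[OF chains_subspace[OF N]] by blast
qed

text \<open>The end of the same long exact sequence. With \<open>m\<close> for the ideal of the variables, the
  images of \<open>kd\<close> are \<open>m L\<close> and \<open>m N\<close>, so the right-hand side is the dimension of the kernel of
  \<open>N / m N \<rightarrow> L / m L\<close>.\<close>

lemma kdim_shift_0:
  assumes L: "graded_family L" and N: "graded_family N" and NL: "\<And>e. N e \<subseteq> L e" and ac: "acyclic L"
  shows "kdim L N (Suc 0) j = int (C.vs.dim (chains N 0 j \<inter> kd ` chains L (Suc 0) j))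
     - int (C.vs.dim (kd ` chains N (Suc 0) j))"
  unfolding kdim_def
proof (rule vspace_pair.dim_quotient_eq_surj[OF vspace_pair_self(1) linear_kd kcycles_fd[OF L N] 
      kboundaries_subspace[OF L N] kboundaries_subset[OF L N NL]])
  show "kd ` kcycles L N (Suc 0) j = chains N 0 j \<inter> kd ` chains L (Suc 0) j"
    by (auto simp: kcycles_def)
  show "kd ` kboundaries L N (Suc 0) j = kd ` chains N (Suc 0) j"
    using zero_in_chains[OF L, of "Suc (Suc 0)" j]
    by (auto simp: kboundaries_def C.sumset_def chains_trivial kd_plus kd_kd image_iff) 
      (metis add_0 kd_zero)
  fix z assume "z \<in> kcycles L N (Suc 0) j" "kd z = 0"
  then have "z \<in> kd ` chains L (Suc (Suc 0)) j" using ac by (auto simp: acyclic_def kcycles_def)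
  then show "z \<in> kboundaries L N (Suc 0) j"
    unfolding kboundaries_def using C.sumset_left[OF chains_subspace[OF N]] by blast
qed

end

section \<open>Maps of modules\<close>

locale qmodule_pair = M1: qmodule a1 + M2: qmodule a2
  for a1 :: "('v::{finite,linorder}, 'k::field) mpoly \<Rightarrow> 'm::ab_group_add \<Rightarrow> 'm"
  and a2 :: "('v, 'k) mpoly \<Rightarrow> 'n::ab_group_add \<Rightarrow> 'n"
begin

lemma vspace_pair: "vspace_pair M1.csc M2.csc"
  by (simp add: vspace_pair_def M1.C.vspace_axioms M2.C.vspace_axioms)

context
  fixes \<phi> assumes hom: "module_hom a1 a2 \<phi>"
begin

interpretation \<phi>: module_hom a1 a2 \<phi> by (fact hom)

lemma linear_comp: "Vector_Spaces.linear M1.csc M2.csc (\<lambda>c. \<phi> \<circ> c)"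
  by unfold_locales (auto simp: M1.csc_def M2.csc_def M1.sc_def M2.sc_def fun_eq_iff \<phi>.add \<phi>.scale)

lemma kd_comp: "M2.kd (\<phi> \<circ> c) = \<phi> \<circ> M1.kd c"
  by (auto simp: M1.kd_def M2.kd_def \<phi>.sum \<phi>.scale)

context
  fixes L N L' N' s
  assumes L: "M1.graded_family L" and N: "M1.graded_family N"
    and L': "M2.graded_family L'" and N': "M2.graded_family N'" and NL': "\<And>e. N' e \<subseteq> L' e"
    and sur: "\<And>e. M2.V.sumset (\<phi> ` L e) (N' (e + s)) = L' (e + s)"
    and low: "\<And>e. e < s \<Longrightarrow> L' e = N' e"
    and ker: "\<And>e x. x \<in> L e \<Longrightarrow> \<phi> x \<in> N' (e + s) \<longleftrightarrow> x \<in> N e"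
begin

lemma comp_in: "c \<in> M1.chains L q j \<Longrightarrow> \<phi> \<circ> c \<in> M2.chains L' q (j + s)"
proof (rule M2.chainsI)
  assume c: "c \<in> M1.chains L q j"
  have \<phi>L: "\<phi> x \<in> L' (e + s)" if "x \<in> L e" for x e
    using sur[of e] that M2.V.sumset_left[OF M2.graded_family_subspace[OF N']] by blast
  fix S :: "'v set"
  show "(\<phi> \<circ> c) S \<in> L' (j + s - q)" if "card S = q" "q \<le> j + s"
  proof (cases "q \<le> j")
    case True
    then have "j - q + s = j + s - q" by simp
    then show ?thesis using \<phi>L[OF M1.chainsD(1)[OF c that(1) True]] by simp
  next
    case False
    then show ?thesis using M1.chainsD(2)[OF c, of S] M2.graded_family_zero[OF L'] \<phi>.zero by simp
  qed
  show "(\<phi> \<circ> c) S = 0" if "\<not> (card S = q \<and> q \<le> j + s)"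
    using M1.chainsD(2)[OF c, of S] that \<phi>.zero by auto
qed

lemma comp_in_iff: assumes c: "c \<in> M1.chains L q j"
  shows "\<phi> \<circ> c \<in> M2.chains N' q (j + s) \<longleftrightarrow> c \<in> M1.chains N q j"
proof
  assume d: "\<phi> \<circ> c \<in> M2.chains N' q (j + s)"
  show "c \<in> M1.chains N q j"
  proof (rule M1.chainsI)
    fix S :: "'v set" assume S: "card S = q" "q \<le> j"
    then have "j - q + s = j + s - q" by simp
    then show "c S \<in> N (j - q)" using ker[OF M1.chainsD(1)[OF c S]] M2.chainsD(1)[OF d S(1)] S by simp
  qed (use M1.chainsD(2)[OF c] in auto)
next
  assume d: "c \<in> M1.chains N q j"
  show "\<phi> \<circ> c \<in> M2.chains N' q (j + s)"
  proof (rule M2.chainsI)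
    fix S :: "'v set" assume S: "card S = q" "q \<le> j + s"
    show "(\<phi> \<circ> c) S \<in> N' (j + s - q)"
    proof (cases "q \<le> j")
      case True
      then have "j - q + s = j + s - q" by simp
      then show ?thesis using ker[OF M1.chainsD(1)[OF c S(1) True]] M1.chainsD(1)[OF d S(1) True] by simp
    next
      case False
      then show ?thesis using M1.chainsD(2)[OF c, of S] M2.graded_family_zero[OF N'] \<phi>.zero by simp
    qed
  next
    fix S :: "'v set" assume "\<not> (card S = q \<and> q \<le> j + s)"
    then show "(\<phi> \<circ> c) S = 0" using M1.chainsD(2)[OF c, of S] \<phi>.zero by auto
  qed
qed

lemma comp_onto: assumes c: "c \<in> M2.chains L' q (j + s)"
  obtains b n where "b \<in> M1.chains L q j" "n \<in> M2.chains N' q (j + s)" "c = (\<phi> \<circ> b) + n"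
proof -
  have ex: "\<exists>x y. c S = \<phi> x + y \<and> (if card S = q \<and> q \<le> j then x \<in> L (j - q) else x = 0) \<and>
     (if card S = q \<and> q \<le> j + s then y \<in> N' (j + s - q) else y = 0)" for S
  proof (cases "card S = q \<and> q \<le> j")
    case True
    then have e: "j - q + s = j + s - q" by simp
    have "c S \<in> L' (j + s - q)" using True by (intro M2.chainsD(1)[OF c]) auto
    then have "c S \<in> M2.V.sumset (\<phi> ` L (j - q)) (N' (j + s - q))" using sur[of "j - q"] e by simp
    then show ?thesis using True by (auto simp: M2.V.sumset_def)
  next
    case False
    show ?thesis
    proof (cases "card S = q \<and> q \<le> j + s")
      case True
      then have "c S \<in> L' (j + s - q)" by (intro M2.chainsD(1)[OF c]) auto
      moreover have "j + s - q < s" using True False by auto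
      ultimately have "c S \<in> N' (j + s - q)" using low by blast
      then show ?thesis using False True by (intro exI[of _ 0] exI[of _ "c S"]) (simp add: \<phi>.zero)
    next
      case nc: False
      show ?thesis using False nc M2.chainsD(2)[OF c nc]
        by (intro exI[of _ 0] exI[of _ 0]) (auto simp: \<phi>.zero)
    qed
  qed
  then obtain b n where bn: "\<And>S. c S = \<phi> (b S) + n S"
    "\<And>S. if card S = q \<and> q \<le> j then b S \<in> L (j - q) else b S = 0"
    "\<And>S. if card S = q \<and> q \<le> j + s then n S \<in> N' (j + s - q) else n S = 0" by metis
  show ?thesis
  proof (rule that)
    show "b \<in> M1.chains L q j" using bn(2) by (auto simp: M1.chains_def)
    show "n \<in> M2.chains N' q (j + s)" using bn(3) by (auto simp: M2.chains_def)
    show "c = (\<phi> \<circ> b) + n" using bn(1) by (simp add: fun_eq_iff)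
  qed
qed

text \<open>The hypotheses on \<open>\<phi>\<close> say that it induces an isomorphism from \<open>L / N\<close> to \<open>L' / N'\<close> that
  raises degrees by \<open>s\<close>. Koszul homology only depends on the quotient module: coefficient by
  coefficient, a chain of \<open>L'\<close> is the sum of the image of a chain of \<open>L\<close> and a chain of \<open>N'\<close>.\<close>

lemma kdim_iso:
  assumes NL: "\<And>e. N e \<subseteq> L e"
  shows "M1.kdim L N q j = M2.kdim L' N' q (j + s)"
  unfolding M1.kdim_def M2.kdim_def
proof (rule vspace_pair.dim_quotient_eq[OF vspace_pair linear_comp M1.kcycles_fd[OF L N] 
      M1.kboundaries_subspace[OF L N] M1.kboundaries_subset[OF L N NL] M2.chains_fd[OF N']])
  note sN' = M2.chains_subspace[OF N']
  show "M2.C.sumset ((\<lambda>c. \<phi> \<circ> c) ` M1.kcycles L N q j) (M2.chains N' q (j + s)) = M2.kcycles L' N' q (j + s)"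
  proof (rule subset_antisym[OF M2.C.sumset_least])
    show "M2.C.vs.subspace (M2.kcycles L' N' q (j + s))"
      using M2.kcycles_fd[OF L' N'] M2.C.fd_subspace by blast
    show "M2.chains N' q (j + s) \<subseteq> M2.kcycles L' N' q (j + s)"
      using M2.chains_mono[of N' L', OF NL', of q "j + s"] M2.kd_chains[OF N'] by (auto simp: M2.kcycles_def)
    show "(\<lambda>c. \<phi> \<circ> c) ` M1.kcycles L N q j \<subseteq> M2.kcycles L' N' q (j + s)"
    proof clarify
      fix c assume "c \<in> M1.kcycles L N q j"
      then have c: "c \<in> M1.chains L q j" "M1.kd c \<in> M1.chains N (q - 1) j" by (auto simp: M1.kcycles_def)
      then show "\<phi> \<circ> c \<in> M2.kcycles L' N' q (j + s)"
        using comp_in[OF c(1)] comp_in_iff[OF M1.kd_chains[OF L c(1)]] by (simp add: M2.kcycles_def kd_comp)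
    qed
    show "M2.kcycles L' N' q (j + s) \<subseteq> M2.C.sumset ((\<lambda>c. \<phi> \<circ> c) ` M1.kcycles L N q j) (M2.chains N' q (j + s))"
    proof
      fix c assume "c \<in> M2.kcycles L' N' q (j + s)"
      then have c: "c \<in> M2.chains L' q (j + s)" "M2.kd c \<in> M2.chains N' (q - 1) (j + s)"
        by (auto simp: M2.kcycles_def)
      obtain b n where bn: "b \<in> M1.chains L q j" "n \<in> M2.chains N' q (j + s)" "c = (\<phi> \<circ> b) + n"
        using comp_onto[OF c(1)] .
      have "\<phi> \<circ> M1.kd b = M2.kd c - M2.kd n" using bn(3) by (simp add: M2.kd_plus kd_comp)
      then have "\<phi> \<circ> M1.kd b \<in> M2.chains N' (q - 1) (j + s)"
        using M2.C.vs.subspace_diff[OF sN' c(2) M2.kd_chains[OF N' bn(2)]] by simp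
      then have "b \<in> M1.kcycles L N q j"
        using comp_in_iff[OF M1.kd_chains[OF L bn(1)]] bn(1) by (simp add: M1.kcycles_def)
      then show "c \<in> M2.C.sumset ((\<lambda>c. \<phi> \<circ> c) ` M1.kcycles L N q j) (M2.chains N' q (j + s))"
        using bn by (auto simp: M2.C.sumset_def)
    qed
  qed
  show "M2.C.sumset ((\<lambda>c. \<phi> \<circ> c) ` M1.kboundaries L N q j) (M2.chains N' q (j + s)) = M2.kboundaries L' N' q (j + s)"
  proof (rule subset_antisym[OF M2.C.sumset_least])
    show sB: "M2.C.vs.subspace (M2.kboundaries L' N' q (j + s))" by (rule M2.kboundaries_subspace[OF L' N'])
    show NB: "M2.chains N' q (j + s) \<subseteq> M2.kboundaries L' N' q (j + s)"
      unfolding M2.kboundaries_def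
      by (rule M2.C.sumset_right[OF M2.C.fd_subspace[OF M2.kd_image_fd[OF L']]])
    have dB: "M2.kd ` M2.chains L' (Suc q) (j + s) \<subseteq> M2.kboundaries L' N' q (j + s)"
      unfolding M2.kboundaries_def by (rule M2.C.sumset_left[OF sN'])
    show "(\<lambda>c. \<phi> \<circ> c) ` M1.kboundaries L N q j \<subseteq> M2.kboundaries L' N' q (j + s)"
    proof clarify
      fix c assume "c \<in> M1.kboundaries L N q j"
      then obtain b n where bn: "b \<in> M1.chains L (Suc q) j" "n \<in> M1.chains N q j" "c = M1.kd b + n"
        by (auto simp: M1.kboundaries_def M1.C.sumset_def)
      have "\<phi> \<circ> c = M2.kd (\<phi> \<circ> b) + (\<phi> \<circ> n)" unfolding kd_comp bn(3) by (auto simp: fun_eq_iff \<phi>.add)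
      moreover have "M2.kd (\<phi> \<circ> b) \<in> M2.kboundaries L' N' q (j + s)" using dB comp_in[OF bn(1)] by blast
      moreover have "n \<in> M1.chains L q j" using bn(2) M1.chains_mono[of N L, OF NL] by blast
      then have "\<phi> \<circ> n \<in> M2.kboundaries L' N' q (j + s)" using NB comp_in_iff bn(2) by blast
      ultimately show "\<phi> \<circ> c \<in> M2.kboundaries L' N' q (j + s)" using M2.C.vs.subspace_add[OF sB] by simp
    qed
    show "M2.kboundaries L' N' q (j + s) \<subseteq> M2.C.sumset ((\<lambda>c. \<phi> \<circ> c) ` M1.kboundaries L N q j) (M2.chains N' q (j + s))"
    proof
      fix c assume "c \<in> M2.kboundaries L' N' q (j + s)"
      then obtain b n where bn: "b \<in> M2.chains L' (Suc q) (j + s)" "n \<in> M2.chains N' q (j + s)" "c = M2.kd b + n"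
        by (auto simp: M2.kboundaries_def M2.C.sumset_def)
      obtain b' m where b': "b' \<in> M1.chains L (Suc q) j" "m \<in> M2.chains N' (Suc q) (j + s)" "b = (\<phi> \<circ> b') + m"
        using comp_onto[OF bn(1)] .
      have "c = (\<phi> \<circ> M1.kd b') + (M2.kd m + n)" using bn b' by (simp add: M2.kd_plus kd_comp add.assoc)
      moreover have "M2.kd m + n \<in> M2.chains N' q (j + s)"
        using M2.C.vs.subspace_add[OF sN' M2.kd_chains_Suc[OF N' b'(2)] bn(2)] .
      moreover have "M1.kd b' \<in> M1.kboundaries L N q j"
        unfolding M1.kboundaries_def using M1.C.sumset_left[OF M1.chains_subspace[OF N]] b' by blast
      ultimately show "c \<in> M2.C.sumset ((\<lambda>c. \<phi> \<circ> c) ` M1.kboundaries L N q j) (M2.chains N' q (j + s))"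
        by (auto simp: M2.C.sumset_def)
    qed
  qed
  fix z assume "z \<in> M1.kcycles L N q j" "\<phi> \<circ> z \<in> M2.chains N' q (j + s)"
  then have "z \<in> M1.chains N q j" using comp_in_iff by (auto simp: M1.kcycles_def)
  then show "z \<in> M1.kboundaries L N q j"
    unfolding M1.kboundaries_def
    using M1.C.sumset_right[OF M1.C.fd_subspace[OF M1.kd_image_fd[OF L]]] by blast
qed

end

end

end

section \<open>Exactness of the Koszul complex of a free module\<close>

global_interpretation Q: qmodule "(*) :: ('v::{finite,linorder}, 'k::field) mpoly \<Rightarrow> _ \<Rightarrow> _"
  unfolding qmodule_def by (rule module_ring_mult)

(* As a rewrite rule \<open>a * (b * x) = (a * b) * x\<close> would loop with associativity. *)
declare Q.scale_scale [simp del]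

global_interpretation F: qmodule
  "pm_scale :: ('v::{finite,linorder}, 'k::field) mpoly \<Rightarrow> ('v, 'k) fvec \<Rightarrow> _"
  unfolding qmodule_def by (rule module_pm_scale)

text \<open>The part of \<open>p\<close> whose monomials contain \<open>v\<close> but no smaller variable, divided by \<open>v\<close>.\<close>

definition divmin :: "'v::linorder \<Rightarrow> ('v, 'k::comm_ring_1) mpoly \<Rightarrow> ('v, 'k) mpoly" where
  "divmin v p = Abs_poly_mapping (\<lambda>m. if \<forall>w\<in>keys m. v \<le> w then lookup p (m + X v) else 0)"

lemma lookup_divmin: "lookup (divmin v p) m =
  (if \<forall>w\<in>keys m. v \<le> w then lookup p (m + X v) else 0)"
proof -
  have "finite ((\<lambda>m. m + X v) -` keys p)"
    by (rule finite_vimageI) (auto simp: inj_on_def)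
  then have "finite {m. (if \<forall>w\<in>keys m. v \<le> w then lookup p (m + X v) else 0) \<noteq> 0}"
    by (rule finite_subset[rotated]) (auto simp: in_keys_iff split: if_splits)
  then show ?thesis unfolding divmin_def by (subst lookup_Abs_poly_mapping) auto
qed

text \<open>The Koszul complex of \<open>Q\<close> splits by multidegree. In a multidegree other than \<open>0\<close> it is the
  chain complex of the full simplex on the variables involved, and coning off the smallest of
  them is a contracting homotopy. In contrast to the homotopy given by differentiation, it works
  in every characteristic.\<close>

definition cone :: "('v::linorder set \<Rightarrow> ('v, 'k::comm_ring_1) mpoly) \<Rightarrow> 'v set \<Rightarrow> ('v, 'k) mpoly" where
  "cone c S = (if S = {} then 0 else divmin (Min S) (c (S - {Min S})))"

lemma lookup_cone: "lookup (cone c S) m =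
   (if S \<noteq> {} \<and> (\<forall>w\<in>keys m. Min S \<le> w)
    then lookup (c (S - {Min S})) (m + X (Min S)) else 0)"
  by (simp add: cone_def lookup_divmin)

lemma cone_zero: "cone (\<lambda>_. 0) S = 0"
  by (rule poly_mapping_eqI) (simp add: lookup_cone)

lemma lookup_kd: "lookup (Q.kd c T) m =
  (\<Sum>v\<in>-T. ksgn v T * (if v \<in> keys m then lookup (c (insert v T)) (m - X v) else 0))"
  unfolding Q.kd_def lookup_sum
  by (rule sum.cong[OF refl]) (simp only: mult.assoc lookup_ksgn_times lookup_var_times)

lemma keys_minus_X: "keys (m - X v) \<subseteq> keys (m :: 'v \<Rightarrow>\<^sub>0 nat)"
  by (auto simp: in_keys_iff lookup_minus)

text \<open>Let \<open>u\<close> be the smallest variable in \<open>T\<close> or in \<open>m\<close>. If \<open>u\<close> is in \<open>T\<close>, the two composites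
  cancel except for the term for \<open>u\<close> in \<open>cone (kd c)\<close>. Otherwise \<open>cone (kd c)\<close> has no
  coefficient there, and in \<open>kd (cone c)\<close> only the term for \<open>u\<close> is left.\<close>

lemma cone_homotopy:
  fixes c :: "'v::{finite,linorder} set \<Rightarrow> ('v, 'k::field) mpoly"
  assumes "T \<noteq> {} \<or> m \<noteq> 0"
  shows "lookup (Q.kd (cone c) T) m + lookup (cone (Q.kd c) T) m
       = lookup (c T) m"
proof -
  define u where "u = Min (T \<union> keys m)"
  have ne: "T \<union> keys m \<noteq> {}" using assms by auto
  have uin: "u \<in> T \<union> keys m" unfolding u_def by (rule Min_in) (use ne in auto)
  have ule: "u \<le> w" if "w \<in> T \<union> keys m" for w unfolding u_def by (rule Min_le) (use that in auto)
  show ?thesis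
  proof (cases "u \<in> T")
    case True
    define T' where "T' = T - {u}"
    have T: "T = insert u T'" "u \<notin> T'" using True by (auto simp: T'_def)
    have MinT: "Min T = u" using True ule by (intro Min_eqI) auto
    have 1: "lookup (Q.kd (cone c) T) m = (\<Sum>v\<in>-T. ksgn v T * 
      (if v \<in> keys m then lookup (c (insert v T')) (m - X v + X u) else 0))"
      unfolding lookup_kd
    proof (rule sum.cong[OF refl], rule arg_cong2[where f = "(*)"], rule refl, rule if_cong[OF refl _ refl])
      fix v assume v: "v \<in> - T" "v \<in> keys m"
      have "Min (insert v T) = u" using True ule v by (intro Min_eqI) auto
      moreover have "insert v T - {u} = insert v T'" using v True by (auto simp: T'_def)
      ultimately show "lookup (cone c (insert v T)) (m - X v) = lookup (c (insert v T')) (m - X v + X u)"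
        using ule keys_minus_X[of m v] by (auto simp: lookup_cone)
    qed
    have "lookup (cone (Q.kd c) T) m = lookup (Q.kd c T') (m + X u)"
      using True ule by (auto simp: lookup_cone MinT T'_def)
    also have "\<dots> = (\<Sum>v\<in>insert u (-T). ksgn v T' * (if v \<in> keys (m + X u) 
         then lookup (c (insert v T')) (m + X u - X v) else 0))"
      unfolding lookup_kd by (rule sum.cong) (use True in \<open>auto simp: T'_def\<close>)
    also have "\<dots> = lookup (c T) m + (\<Sum>v\<in>-T. ksgn v T' * (if v \<in> keys (m + X u) 
         then lookup (c (insert v T')) (m + X u - X v) else 0))"
    proof -
      have "ksgn u T' = (1::'k)" by (rule ksgn_min) (use ule in \<open>auto simp: T'_def\<close>)
      moreover have "u \<in> keys (m + X u)" by (simp add: in_keys_iff lookup_add)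
      ultimately show ?thesis using True T by (subst sum.insert) auto
    qed
    also have "(\<Sum>v\<in>-T. ksgn v T' * (if v \<in> keys (m + X u) 
         then lookup (c (insert v T')) (m + X u - X v) else 0))
      = (\<Sum>v\<in>-T. - (ksgn v T * (if v \<in> keys m then lookup (c (insert v T')) (m - X v + X u) else 0)))"
    proof (rule sum.cong[OF refl])
      fix v assume v: "v \<in> - T"
      then have vu: "v \<noteq> u" using True by auto
      have k: "v \<in> keys (m + X u) \<longleftrightarrow> v \<in> keys m"
        using vu by (simp add: in_keys_iff lookup_add lookup_single)
      show "ksgn v T' * (if v \<in> keys (m + X u) 
         then lookup (c (insert v T')) (m + X u - X v) else 0) =
        - (ksgn v T * (if v \<in> keys m then lookup (c (insert v T')) (m - X v + X u) else 0))"
      proof (cases "v \<in> keys m")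
        case v': True
        then have "u < v" using ule[of v] vu by auto
        then have s: "ksgn v T = - (ksgn v T' :: 'k)" using T ksgn_insert_less[of u v T'] by simp
        have "m + X u - X v = m - X v + X u"
          by (rule poly_mapping_eqI) (use v' vu in \<open>auto simp: lookup_add lookup_minus lookup_single when_def\<close>)
        then show ?thesis using k v' s by simp
      next
        case False
        then show ?thesis by (simp only: k if_False mult_zero_right neg_0_equal_iff_equal minus_zero)
      qed
    qed
    finally show ?thesis unfolding 1 by (simp add: sum_negf)
  next
    case False
    then have um: "u \<in> keys m" using uin by auto
    have T0: "lookup (cone (Q.kd c) T) m = 0"
    proof (cases "T = {}")
      case ne: False
      then have "Min T \<in> T" by simp
      then have "u < Min T" using False ule[of "Min T"] by (auto simp: less_le)
      then show ?thesis using um by (auto simp: lookup_cone)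
    qed (simp add: lookup_cone)
    have "lookup (Q.kd (cone c) T) m = (\<Sum>v\<in>-T. if v = u then lookup (c T) m else 0)"
      unfolding lookup_kd
    proof (rule sum.cong[OF refl])
      fix v assume v: "v \<in> - T"
      show "ksgn v T * (if v \<in> keys m then lookup (cone c (insert v T)) (m - X v) else 0)
        = (if v = u then lookup (c T) m else 0)"
      proof (cases "v = u")
        case True
        have "Min (insert v T) = u" unfolding True using ule by (intro Min_eqI) auto
        moreover have "m - X v + X u = m" using X_plus_minus[OF um] True by (simp add: add.commute)
        moreover have "ksgn v T = (1::'k)" unfolding True by (rule ksgn_min) (use ule in auto)
        moreover have "insert v T - {u} = T" using True v by auto
        ultimately show ?thesis using True um ule keys_minus_X[of m u] by (auto simp: lookup_cone)
      next
        case vu: False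
        have "u \<in> keys (m - X v)" 
          using um vu by (simp add: in_keys_iff lookup_minus lookup_single)
        moreover have "u < Min (insert v T)" if "v \<in> keys m"
        proof -
          have "Min (insert v T) \<in> insert v T" by (rule Min_in) auto
          then show ?thesis using that ule[of "Min (insert v T)"] False vu by (auto simp: less_le)
        qed
        ultimately have "\<not> (\<forall>w\<in>keys (m - X v). Min (insert v T) \<le> w)"
          if "v \<in> keys m" using that leD by blast
        then have "v \<in> keys m \<Longrightarrow> lookup (cone c (insert v T)) (m - X v) = 0"
          unfolding lookup_cone by (simp only: simp_thms if_False)
        then show ?thesis using vu by auto
      qed
    qed
    also have "\<dots> = lookup (c T) m" using False by (simp add: sum.delta)
    finally show ?thesis using T0 by simp
  qed
qed

definition fpiece :: "nat set \<Rightarrow> (nat \<Rightarrow> nat) \<Rightarrow> nat \<Rightarrow> (nat \<Rightarrow>\<^sub>0 ('v, 'k::zero) mpoly) set" where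
  "fpiece B \<delta> e = {v \<in> free_on B. homogeneous_vec \<delta> e v}"

lemma fpieceI: "(\<And>t m. lookup (lookup v t) m \<noteq> 0 \<Longrightarrow> t \<in> B \<and> mon_deg m + \<delta> t = e) \<Longrightarrow> v \<in> fpiece B \<delta> e"
proof -
  assume a: "\<And>t m. lookup (lookup v t) m \<noteq> 0 \<Longrightarrow> t \<in> B \<and> mon_deg m + \<delta> t = e"
  have "t \<in> B" if "t \<in> keys v" for t
  proof -
    from that have "keys (lookup v t) \<noteq> {}" by (simp add: in_keys_iff)
    then obtain m where "m \<in> keys (lookup v t)" by blast
    then show ?thesis using a[of t m] by (simp add: in_keys_iff)
  qed
  then show ?thesis using a unfolding fpiece_def homogeneous_vec_lookup free_on_def by blast
qed

lemma fpieceD: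
  assumes "v \<in> fpiece B \<delta> e" "lookup (lookup v t) m \<noteq> 0"
  shows "t \<in> B \<and> mon_deg m + \<delta> t = e"
proof -
  have "t \<in> keys v" using assms(2) by (auto simp: in_keys_iff)
  then show ?thesis using assms unfolding fpiece_def homogeneous_vec_lookup free_on_def by auto
qed

lemma fpiece_free: "v \<in> fpiece B \<delta> e \<Longrightarrow> v \<in> free_on B"
  by (simp add: fpiece_def)

definition locally_finite :: "nat set \<Rightarrow> (nat \<Rightarrow> nat) \<Rightarrow> bool" where
  "locally_finite B \<delta> \<longleftrightarrow> (\<forall>d. finite {s \<in> B. \<delta> s = d})"

lemma lookup_sc_F [simp]: "lookup (lookup (F.sc c v) t) m = c * lookup (lookup v t) m"
  by (simp add: F.sc_def)

lemma fpiece_subspace: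
  "F.V.vs.subspace (fpiece B \<delta> e :: (nat \<Rightarrow>\<^sub>0 ('v::{finite,linorder}, 'k::field) mpoly) set)"
  unfolding F.V.vs.subspace_def
proof (intro conjI ballI allI)
  fix x y :: "('v, 'k) fvec" and c
  assume x: "x \<in> fpiece B \<delta> e"
  show "F.sc c x \<in> fpiece B \<delta> e"
    by (rule fpieceI) (use fpieceD[OF x] in auto)
  assume y: "y \<in> fpiece B \<delta> e"
  show "x + y \<in> fpiece B \<delta> e"
    by (rule fpieceI) (use fpieceD[OF x] fpieceD[OF y] in \<open>metis lookup_add add_0\<close>)
qed (auto intro: fpieceI)

lemma fpiece_fd:
  assumes "locally_finite B \<delta>" shows "F.V.fd (fpiece B \<delta> e :: (nat \<Rightarrow>\<^sub>0 ('v::{finite,linorder}, 'k::field) mpoly) set)"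
proof -
  define G :: "('v, 'k) fvec set" where "G = (\<lambda>(t, m). single t (xpow m)) ` 
    ((\<Union>d\<in>{..e}. {s \<in> B. \<delta> s = d}) \<times> (\<Union>d\<in>{..e}. {m :: 'v \<Rightarrow>\<^sub>0 nat. mon_deg m = d}))"
  have "finite G" unfolding G_def using assms finite_mon_deg
    by (intro finite_imageI finite_cartesian_product finite_UN_I) (auto simp: locally_finite_def)
  moreover have "fpiece B \<delta> e \<subseteq> F.V.vs.span G"
  proof
    fix v :: "('v, 'k) fvec" assume v: "v \<in> fpiece B \<delta> e"
    have single_sc: "single t (single m c) = F.sc c (single t (xpow m))"
      for t c and m :: "'v \<Rightarrow>\<^sub>0 nat"
      by (intro poly_mapping_eqI) (auto simp: lookup_single when_def)
    have single_sum: "single t (\<Sum>m\<in>A. f m) = (\<Sum>m\<in>A. single t (f m))"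
      for t and f :: "('v \<Rightarrow>\<^sub>0 nat) \<Rightarrow> ('v, 'k) mpoly" and A
      by (induction A rule: infinite_finite_induct) (auto simp: single_add)
    have "v = (\<Sum>t\<in>keys v. \<Sum>m\<in>keys (lookup v t).
      F.sc (lookup (lookup v t) m) (single t (xpow m)))" (is "v = ?r")
      unfolding single_sc[symmetric] single_sum[symmetric] by (simp add: poly_mapping_sum_single[symmetric])
    also have "?r \<in> F.V.vs.span G"
    proof (intro F.V.vs.span_sum F.V.vs.span_scale F.V.vs.span_base)
      fix t m assume "m \<in> keys (lookup v t)"
      then have "t \<in> B" "mon_deg m + \<delta> t = e" using fpieceD[OF v] by (auto simp: in_keys_iff)
      then show "single t (xpow m) \<in> G" unfolding G_def by (auto intro!: image_eqI[of _ _ "(t, m)"])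
    qed
    finally show "v \<in> F.V.vs.span G" .
  qed
  ultimately show ?thesis unfolding F.V.fd_def using fpiece_subspace by blast
qed

lemma fpiece_graded:
  assumes "locally_finite B \<delta>"
  shows "F.graded_family (fpiece B \<delta> :: nat \<Rightarrow> (nat \<Rightarrow>\<^sub>0 ('v::{finite,linorder}, 'k::field) mpoly) set)"
  unfolding F.graded_family_def
proof (intro conjI allI ballI fpiece_fd assms)
  fix e and x :: 'v and v :: "('v, 'k) fvec" assume v: "v \<in> fpiece B \<delta> e"
  show "pm_scale (var x) v \<in> fpiece B \<delta> (Suc e)"
  proof (rule fpieceI)
    fix t m assume "lookup (lookup (pm_scale (var x) v) t) m \<noteq> 0"
    then have m: "x \<in> keys m" "lookup (lookup v t) (m - X x) \<noteq> 0"
      by (auto simp: lookup_var_times split: if_splits)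
    have "mon_deg m = Suc (mon_deg (m - X x))" using arg_cong[OF X_plus_minus[OF m(1)], of mon_deg] by simp
    then show "t \<in> B \<and> mon_deg m + \<delta> t = Suc e" using fpieceD[OF v m(2)] by simp
  qed
qed

text \<open>The homotopy in every coordinate of a free module.\<close>

definition fcone :: "('v::linorder set \<Rightarrow> (nat \<Rightarrow>\<^sub>0 ('v, 'k::comm_ring_1) mpoly)) \<Rightarrow> 'v set \<Rightarrow> ('v, 'k) fvec" where
  "fcone c S = (\<Sum>t\<in>(\<Union>S. keys (c S)). single t (cone (\<lambda>S. lookup (c S) t) S))"

lemma lookup_fcone: 
  fixes c :: "'v::{finite,linorder} set \<Rightarrow> (nat \<Rightarrow>\<^sub>0 ('v, 'k::comm_ring_1) mpoly)"
  shows "lookup (fcone c S) t = cone (\<lambda>S. lookup (c S) t) S"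
proof -
  let ?A = "\<Union>S. keys (c S)"
  have "lookup (fcone c S) t = (\<Sum>t'\<in>?A. if t' = t then cone (\<lambda>S. lookup (c S) t) S else 0)"
    unfolding fcone_def lookup_sum by (intro sum.cong refl) (auto simp: lookup_single)
  also have "\<dots> = (if t \<in> ?A then cone (\<lambda>S. lookup (c S) t) S else 0)" by (subst sum.delta) auto
  also have "\<dots> = cone (\<lambda>S. lookup (c S) t) S"
  proof (cases "t \<in> ?A")
    case False
    then have "(\<lambda>S. lookup (c S) t) = (\<lambda>_. 0)" by (auto simp: in_keys_iff)
    then show ?thesis using False by (simp add: cone_zero)
  qed simp
  finally show ?thesis .
qed

lemma lookup_F_kd: "lookup (F.kd c T) t = Q.kd (\<lambda>S. lookup (c S) t) T"
  by (simp add: F.kd_def Q.kd_def lookup_sum)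

text \<open>In homological degree \<open>0\<close> the homotopy inverts the differential on the elements without
  constant terms. The constant terms are the part of multidegree \<open>0\<close>, where no variable can be
  coned off.\<close>

lemma fcone_contracts:
  assumes c: "c \<in> F.chains (fpiece B \<delta>) q j" and dc: "F.kd c = 0"
    and q: "0 < q \<or> (\<forall>t. lookup (lookup (c {}) t) 0 = 0)"
  shows "F.kd (fcone c) = c" "fcone c \<in> F.chains (fpiece B \<delta>) (Suc q) j"
proof -
  show "F.kd (fcone c) = c"
  proof (rule ext, intro poly_mapping_eqI)
    fix T t m
    let ?c = "\<lambda>S. lookup (c S) t"
    have "Q.kd ?c = (\<lambda>_. 0)" using lookup_F_kd[of c _ t] dc by auto
    moreover have "lookup (lookup (F.kd (fcone c) T) t) m = lookup (Q.kd (cone ?c) T) m"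
      unfolding lookup_F_kd lookup_fcone ..
    ultimately show "lookup (lookup (F.kd (fcone c) T) t) m = lookup (lookup (c T) t) m"
      using cone_homotopy[of T m ?c] q F.chainsD(2)[OF c, of "{}"]
      by (cases "T \<noteq> {} \<or> m \<noteq> 0") (auto simp: cone_zero lookup_kd)
  qed
  have nz: "card S = Suc q \<and> Suc q \<le> j \<and> t \<in> B \<and> mon_deg m + \<delta> t = j - Suc q"
    if "lookup (lookup (fcone c S) t) m \<noteq> 0" for S t m
  proof -
    let ?S = "S - {Min S}"
    have S: "S \<noteq> {}" "lookup (lookup (c ?S) t) (m + X (Min S)) \<noteq> 0"
      using that by (auto simp: lookup_fcone lookup_cone split: if_splits)
    then have "c ?S \<noteq> 0" by auto
    then have 1: "card ?S = q" "q \<le> j" using F.chainsD(2)[OF c, of ?S] by auto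
    have "t \<in> B \<and> mon_deg (m + X (Min S)) + \<delta> t = j - q"
      using fpieceD[OF F.chainsD(1)[OF c 1] S(2)] .
    moreover have "card S = Suc (card ?S)" using S(1) by (intro card.remove) auto
    ultimately show ?thesis using 1 by auto
  qed
  show "fcone c \<in> F.chains (fpiece B \<delta>) (Suc q) j"
  proof (rule F.chainsI)
    fix S :: "'a set" 
    show "fcone c S \<in> fpiece B \<delta> (j - Suc q)" using nz by (intro fpieceI) blast
    show "fcone c S = 0" if "\<not> (card S = Suc q \<and> Suc q \<le> j)"
      using nz[of S] that by (intro poly_mapping_eqI) (simp only: lookup_zero, blast)
  qed
qed

lemma acyclic_fpiece: "F.acyclic (fpiece B \<delta>)"
  unfolding F.acyclic_def
proof (intro allI ballI impI)
  fix q j and c :: "'a set \<Rightarrow> (('a, 'b) fvec)"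
  assume "c \<in> F.chains (fpiece B \<delta>) (Suc q) j" "F.kd c = 0"
  from fcone_contracts[OF this] show "c \<in> F.kd ` F.chains (fpiece B \<delta>) (Suc (Suc q)) j"
    by (metis image_eqI zero_less_Suc)
qed

text \<open>The left-hand side describes the elements of \<open>m F\<close> for a free module \<open>F\<close> and the ideal \<open>m\<close>
  of the variables, so that reduction modulo \<open>m\<close> amounts to taking constant terms.\<close>

lemma kd_chains_1_iff:
  assumes x: "x \<in> fpiece B \<delta> j"
  shows "F.place {} x \<in> F.kd ` F.chains (fpiece B \<delta>) (Suc 0) j \<longleftrightarrow>
    (\<forall>t. lookup (lookup x t) 0 = 0)"
proof
  assume "F.place {} x \<in> F.kd ` F.chains (fpiece B \<delta>) (Suc 0) j"
  then obtain b where "F.place {} x = F.kd b" by auto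
  then have "x = F.kd b {}" by (metis F.place_def)
  then show "\<forall>t. lookup (lookup x t) 0 = 0"
    by (simp add: lookup_F_kd lookup_kd)
next
  assume a: "\<forall>t. lookup (lookup x t) 0 = 0"
  have c: "F.place {} x \<in> F.chains (fpiece B \<delta>) 0 j"
    using x by (intro F.chainsI) (auto simp: F.place_def)
  have "F.kd (fcone (F.place {} x)) = F.place {} x" "fcone (F.place {} x) \<in> F.chains (fpiece B \<delta>) (Suc 0) j"
    using fcone_contracts[OF c F.kd_chains_0[OF c]] a by (auto simp: F.place_def)
  then show "F.place {} x \<in> F.kd ` F.chains (fpiece B \<delta>) (Suc 0) j" by (metis image_eqI)
qed

section \<open>Homogeneous components\<close>

text \<open>Projections \<open>c e\<close> to graded pieces \<open>H e\<close>. The set \<open>U\<close> is the graded submodule in which the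
  components are known to lie in the pieces; for a free module given by a set of basis indices
  it is smaller than the whole type.\<close>

definition grading :: "'a set \<Rightarrow> (nat \<Rightarrow> 'a set) \<Rightarrow> (nat \<Rightarrow> 'a::ab_group_add \<Rightarrow> 'a) \<Rightarrow> bool" where
  "grading U H c \<longleftrightarrow> (\<forall>e. \<forall>x\<in>U. c e x \<in> H e) \<and> (\<forall>e x y. c e (x + y) = c e x + c e y) \<and>
     (\<forall>d e x. x \<in> H d \<longrightarrow> c e x = (if d = e then x else 0)) \<and>
     (\<forall>x. \<exists>E. finite E \<and> x = (\<Sum>e\<in>E. c e x) \<and> (\<forall>e. e \<notin> E \<longrightarrow> c e x = 0))"

lemma additive_sum:
  fixes f :: "'a::ab_group_add \<Rightarrow> 'b::ab_group_add"
  assumes "\<And>x y. f (x + y) = f x + f y"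
  shows "f (\<Sum>i\<in>A. g i) = (\<Sum>i\<in>A. f (g i))"
proof -
  have "f 0 = 0" using assms[of 0 0] by simp
  then show ?thesis by (induction A rule: infinite_finite_induct) (auto simp: assms)
qed

text \<open>A map of degree \<open>s\<close> commutes with taking components: apply it to the decomposition of \<open>x\<close>.\<close>

lemma grading_map:
  fixes \<phi> :: "'a::ab_group_add \<Rightarrow> 'b::ab_group_add"
  assumes g: "grading U H c" and g': "grading U' H' c'"
    and add: "\<And>x y. \<phi> (x + y) = \<phi> x + \<phi> y" and deg: "\<And>d y. y \<in> H d \<Longrightarrow> \<phi> y \<in> H' (d + s)"
    and x: "x \<in> U"
  shows "c' (e + s) (\<phi> x) = \<phi> (c e x)" "e < s \<Longrightarrow> c' e (\<phi> x) = 0"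
proof -
  obtain E where E: "finite E" "x = (\<Sum>e\<in>E. c e x)" "\<And>e. e \<notin> E \<Longrightarrow> c e x = 0"
    using g unfolding grading_def by meson
  have add': "c' e (y + z) = c' e y + c' e z" for e y z using g' unfolding grading_def by blast
  have h: "c' e' (\<phi> (c d x)) = (if d + s = e' then \<phi> (c d x) else 0)" for d e'
  proof -
    have "\<phi> (c d x) \<in> H' (d + s)" using g x unfolding grading_def by (intro deg) blast
    then show ?thesis using g' unfolding grading_def by blast
  qed
  have fx: "\<phi> x = (\<Sum>d\<in>E. \<phi> (c d x))" by (subst E(2)) (rule additive_sum[of \<phi>, OF add])
  then have eq: "c' e' (\<phi> x) = (\<Sum>d\<in>E. if d + s = e' then \<phi> (c d x) else 0)" for e'
    unfolding fx additive_sum[of "c' e'", OF add'] by (simp only: h)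
  have z: "\<phi> 0 = 0" using add[of 0 0] by simp
  show "c' (e + s) (\<phi> x) = \<phi> (c e x)" unfolding eq using E z by (auto simp: sum.delta)
  show "c' e (\<phi> x) = 0" if "e < s" unfolding eq using that by (auto intro: sum.neutral)
qed

lemma grading_sum: assumes "grading U H c" obtains E where "finite E" "x = (\<Sum>e\<in>E. c e x)"
  using assms unfolding grading_def by meson

lemma grading_in: "grading U H c \<Longrightarrow> x \<in> U \<Longrightarrow> c e x \<in> H e"
  unfolding grading_def by blast

lemma grading_id: "grading U H c \<Longrightarrow> x \<in> H e \<Longrightarrow> c e x = x"
  unfolding grading_def by metis

lemma grading_add: "grading U H c \<Longrightarrow> c e (x + y) = c e x + c e y"
  unfolding grading_def by blast

definition hcomp :: "nat \<Rightarrow> ('v, 'k::comm_ring_1) mpoly \<Rightarrow> ('v, 'k) mpoly" where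
  "hcomp e p = (\<Sum>m\<in>{m \<in> keys p. mon_deg m = e}. single m (lookup p m))"

lemma lookup_hcomp: "lookup (hcomp e p) m = (if mon_deg m = e then lookup p m else 0)"
proof -
  have "lookup (hcomp e p) m = (\<Sum>m'\<in>{m \<in> keys p. mon_deg m = e}. if m' = m then lookup p m else 0)"
    unfolding hcomp_def lookup_sum by (rule sum.cong) (auto simp: lookup_single)
  also have "\<dots> = (if mon_deg m = e then lookup p m else 0)"
    by (subst sum.delta) (auto simp: in_keys_iff)
  finally show ?thesis .
qed

lemma homogeneous_hcomp: "homogeneous e (hcomp e p)"
  by (simp add: homogeneous_lookup lookup_hcomp)

abbreviation hpiece :: "nat \<Rightarrow> ('v, 'k::zero) mpoly set" where "hpiece e \<equiv> {p. homogeneous e p}"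

lemma grading_hcomp: "grading UNIV hpiece (hcomp :: nat \<Rightarrow> ('v, 'k::comm_ring_1) mpoly \<Rightarrow> _)"
  unfolding grading_def
proof (intro conjI allI impI ballI)
  fix p q :: "('v, 'k) mpoly" and d e
  show "hcomp e p \<in> hpiece e" by (simp add: homogeneous_hcomp)
  show "hcomp e (p + q) = hcomp e p + hcomp e q" by (rule poly_mapping_eqI) (simp add: lookup_hcomp lookup_add)
  show "hcomp e p = (if d = e then p else 0)" if "p \<in> hpiece d"
    using that by (intro poly_mapping_eqI) (auto simp: lookup_hcomp homogeneous_lookup)
  let ?E = "mon_deg ` keys p"
  show "\<exists>E. finite E \<and> p = (\<Sum>e\<in>E. hcomp e p) \<and> (\<forall>e. e \<notin> E \<longrightarrow> hcomp e p = 0)"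
  proof (intro exI[of _ ?E] conjI allI impI poly_mapping_eqI)
    fix m show "lookup p m = lookup (\<Sum>e\<in>?E. hcomp e p) m"
      by (auto simp: lookup_sum lookup_hcomp sum.delta' image_iff in_keys_iff)
    fix e assume "e \<notin> ?E" then show "lookup (hcomp e p) m = lookup 0 m"
      by (auto simp: lookup_hcomp in_keys_iff)
  qed simp
qed

definition vcomp :: "(nat \<Rightarrow> nat) \<Rightarrow> nat \<Rightarrow> (nat \<Rightarrow>\<^sub>0 ('v, 'k::comm_ring_1) mpoly) \<Rightarrow> ('v, 'k) fvec" where
  "vcomp \<delta> e v = (\<Sum>t\<in>keys v. single t (if \<delta> t \<le> e then hcomp (e - \<delta> t) (lookup v t) else 0))"

lemma lookup_vcomp: "lookup (lookup (vcomp \<delta> e v) t) m =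
  (if mon_deg m + \<delta> t = e then lookup (lookup v t) m else 0)"
proof -
  let ?f = "\<lambda>t. if \<delta> t \<le> e then hcomp (e - \<delta> t) (lookup v t) else 0"
  have "lookup (vcomp \<delta> e v) t = (\<Sum>t'\<in>keys v. if t' = t then ?f t else 0)"
    unfolding vcomp_def lookup_sum by (rule sum.cong) (auto simp: lookup_single)
  also have "\<dots> = (if t \<in> keys v then ?f t else 0)" by (subst sum.delta) auto
  finally show ?thesis by (auto simp: lookup_hcomp in_keys_iff)
qed

lemma grading_vcomp: "grading (free_on B) (fpiece B \<delta>) (vcomp \<delta> :: nat \<Rightarrow> (nat \<Rightarrow>\<^sub>0 ('v, 'k::comm_ring_1) mpoly) \<Rightarrow> _)"
  unfolding grading_def
proof (intro conjI allI impI ballI)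
  fix p q :: "('v, 'k) fvec" and d e
  show "vcomp \<delta> e p \<in> fpiece B \<delta> e" if "p \<in> free_on B"
  proof (rule fpieceI)
    fix t m assume a: "lookup (lookup (vcomp \<delta> e p) t) m \<noteq> 0"
    then have "t \<in> keys p" by (auto simp: lookup_vcomp in_keys_iff split: if_splits)
    then show "t \<in> B \<and> mon_deg m + \<delta> t = e" using that a
      by (auto simp: lookup_vcomp free_on_def split: if_splits)
  qed
  show "vcomp \<delta> e (p + q) = vcomp \<delta> e p + vcomp \<delta> e q" by (intro poly_mapping_eqI) (simp add: lookup_vcomp lookup_add)
  show "vcomp \<delta> e p = (if d = e then p else 0)" if p: "p \<in> fpiece B \<delta> d"
  proof (intro poly_mapping_eqI)
    fix t m
    show "lookup (lookup (vcomp \<delta> e p) t) m = 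
      lookup (lookup (if d = e then p else 0) t) m"
      using fpieceD[OF p, of t m] by (auto simp: lookup_vcomp)
  qed
  let ?E = "\<Union>t\<in>keys p. (\<lambda>m. mon_deg m + \<delta> t) ` keys (lookup p t)"
  show "\<exists>E. finite E \<and> p = (\<Sum>e\<in>E. vcomp \<delta> e p) \<and> (\<forall>e. e \<notin> E \<longrightarrow> vcomp \<delta> e p = 0)"
  proof (intro exI[of _ ?E] conjI allI impI poly_mapping_eqI)
    fix t m 
    have fE: "finite ?E" by auto
    have "lookup (lookup (\<Sum>e\<in>?E. vcomp \<delta> e p) t) m
      = (if mon_deg m + \<delta> t \<in> ?E then lookup (lookup p t) m else 0)"
      unfolding lookup_sum lookup_vcomp using fE by (subst sum.delta') auto
    also have "\<dots> = lookup (lookup p t) m"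
    proof (cases "m \<in> keys (lookup p t)")
      case True
      then have "t \<in> keys p" by (auto simp: in_keys_iff)
      then have "mon_deg m + \<delta> t \<in> ?E" using True by blast
      then show ?thesis by simp
    qed (simp add: in_keys_iff)
    finally show "lookup (lookup p t) m = lookup (lookup (\<Sum>e\<in>?E. vcomp \<delta> e p) t) m" ..
    fix e assume e: "e \<notin> ?E" 
    show "lookup (lookup (vcomp \<delta> e p) t) m = lookup (lookup 0 t) m"
    proof (rule ccontr)
      assume "\<not> ?thesis"
      then have "mon_deg m + \<delta> t = e" "m \<in> keys (lookup p t)"
        by (auto simp: lookup_vcomp in_keys_iff split: if_splits)
      moreover have "t \<in> keys p" using calculation by (auto simp: in_keys_iff)
      ultimately show False using e by blast
    qed
  qed simp
qed

section \<open>Linear maps between free modules\<close>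

lemma lin_ext_superset:
  assumes "finite A" "keys v \<subseteq> A"
  shows "lin_ext D v = (\<Sum>s\<in>A. pm_scale (lookup v s) (D s))"
  unfolding lin_ext_def using assms
  by (intro sum.mono_neutral_left) (auto simp: in_keys_iff intro!: poly_mapping_eqI)

lemma aug_map_superset:
  assumes "finite A" "keys v \<subseteq> A"
  shows "aug_map \<epsilon> v = (\<Sum>s\<in>A. lookup v s * \<epsilon> s)"
  unfolding aug_map_def using assms by (intro sum.mono_neutral_left) (auto simp: in_keys_iff)

lemma pm_scale_add_left: "pm_scale (a + b) v = pm_scale a v + pm_scale b v"
  by (rule poly_mapping_eqI) (simp add: lookup_add distrib_right)

lemma keys_pm_scale: "keys (pm_scale c v) \<subseteq> keys v"
  by (auto simp: in_keys_iff)

lemma pm_scale_scale: "pm_scale a (pm_scale b v) = pm_scale (a * b) v"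
  by (rule poly_mapping_eqI) (simp add: mult.assoc)

lemma pm_scale_sum: "pm_scale a (\<Sum>i\<in>A. f i) = (\<Sum>i\<in>A. pm_scale a (f i))"
  by (rule poly_mapping_eqI) (simp add: lookup_sum sum_distrib_left)

lemma lin_ext_hom: "module_hom pm_scale pm_scale (lin_ext D :: ('b \<Rightarrow>\<^sub>0 'a::comm_ring_1) \<Rightarrow> ('c \<Rightarrow>\<^sub>0 'a))"
  unfolding module_hom_def module_hom_axioms_def
proof (intro conjI allI module_pm_scale)
  fix x y :: "'b \<Rightarrow>\<^sub>0 'a" and r
  let ?A = "keys x \<union> keys y"
  have "lin_ext D (x + y) = (\<Sum>s\<in>?A. pm_scale (lookup (x + y) s) (D s))"
    using keys_add[of x y] by (intro lin_ext_superset) auto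
  also have "\<dots> = lin_ext D x + lin_ext D y"
    by (simp add: lin_ext_superset[of ?A] lookup_add pm_scale_add_left sum.distrib)
  finally show "lin_ext D (x + y) = lin_ext D x + lin_ext D y" .
  have "lin_ext D (pm_scale r x) = (\<Sum>s\<in>keys x. pm_scale (lookup (pm_scale r x) s) (D s))"
    by (intro lin_ext_superset keys_pm_scale) auto
  then show "lin_ext D (pm_scale r x) = pm_scale r (lin_ext D x)"
    by (simp add: lin_ext_def pm_scale_sum pm_scale_scale)
qed

lemma aug_map_hom: "module_hom pm_scale (*) (aug_map \<epsilon> :: ('b \<Rightarrow>\<^sub>0 'a::comm_ring_1) \<Rightarrow> 'a)"
  unfolding module_hom_def module_hom_axioms_def
proof (intro conjI allI module_pm_scale module_ring_mult)
  fix x y :: "'b \<Rightarrow>\<^sub>0 'a" and r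
  let ?A = "keys x \<union> keys y"
  have "aug_map \<epsilon> (x + y) = (\<Sum>s\<in>?A. lookup (x + y) s * \<epsilon> s)"
    using keys_add[of x y] by (intro aug_map_superset) auto
  also have "\<dots> = aug_map \<epsilon> x + aug_map \<epsilon> y"
    by (simp add: aug_map_superset[of ?A] lookup_add distrib_right sum.distrib)
  finally show "aug_map \<epsilon> (x + y) = aug_map \<epsilon> x + aug_map \<epsilon> y" .
  have "aug_map \<epsilon> (pm_scale r x) = (\<Sum>s\<in>keys x. lookup (pm_scale r x) s * \<epsilon> s)"
    by (intro aug_map_superset keys_pm_scale) auto
  then show "aug_map \<epsilon> (pm_scale r x) = r * aug_map \<epsilon> x"
    by (simp add: aug_map_def sum_distrib_left mult.assoc)
qed

lemma lin_ext_add: "lin_ext D (x + y) = lin_ext D x + lin_ext D y"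
  using lin_ext_hom[of D] by (rule module_hom.add)

lemma lin_ext_zero [simp]: "lin_ext D 0 = 0" by (simp add: lin_ext_def)

lemma lin_ext_scale: "lin_ext D (pm_scale r x) = pm_scale r (lin_ext D x)"
  using lin_ext_hom[of D] by (rule module_hom.scale)

lemma aug_map_add: "aug_map D (x + y) = aug_map D x + aug_map D y"
  using aug_map_hom[of D] by (rule module_hom.add)

lemma aug_map_zero [simp]: "aug_map D 0 = 0" by (simp add: aug_map_def)

lemma aug_map_scale: "aug_map D (pm_scale r x) = r * aug_map D x"
  using aug_map_hom[of D] by (rule module_hom.scale)

lemma lin_ext_fpiece:
  fixes D :: "nat \<Rightarrow> (nat \<Rightarrow>\<^sub>0 ('v::finite, 'k::comm_ring_1) mpoly)"
  assumes D: "\<And>s. s \<in> B' \<Longrightarrow> D s \<in> fpiece B \<delta> (\<delta>' s)" and v: "v \<in> fpiece B' \<delta>' e"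
  shows "lin_ext D v \<in> fpiece B \<delta> e"
proof (rule fpieceI)
  fix t m assume "lookup (lookup (lin_ext D v) t) m \<noteq> 0"
  then have "(\<Sum>s\<in>keys v. lookup (lookup v s * lookup (D s) t) m) \<noteq> 0"
    by (simp add: lin_ext_def lookup_sum)
  then obtain s where "lookup (lookup v s * lookup (D s) t) m \<noteq> 0"
    by (meson sum.not_neutral_contains_not_neutral)
  then have "m \<in> keys (lookup v s * lookup (D s) t)" by (simp add: in_keys_iff)
  then obtain a b where ab: "a \<in> keys (lookup v s)" "b \<in> keys (lookup (D s) t)" "m = a + b"
    using keys_mult by blast
  then have "s \<in> B' \<and> mon_deg a + \<delta>' s = e" using fpieceD[OF v, of s a] by (simp add: in_keys_iff)
  moreover have "t \<in> B \<and> mon_deg b + \<delta> t = \<delta>' s"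
    using fpieceD[OF D, of s t b] calculation ab by (simp add: in_keys_iff)
  ultimately show "t \<in> B \<and> mon_deg m + \<delta> t = e" using ab by simp
qed

lemma aug_map_hpiece:
  fixes \<epsilon> :: "nat \<Rightarrow> ('v::finite, 'k::comm_ring_1) mpoly"
  assumes D: "\<And>s. s \<in> B \<Longrightarrow> homogeneous (\<delta> s) (\<epsilon> s)" and v: "v \<in> fpiece B \<delta> e"
  shows "homogeneous e (aug_map \<epsilon> v)"
  unfolding aug_map_def
proof (rule homogeneous_sum)
  fix s assume s: "s \<in> keys v"
  then have sB: "s \<in> B" using fpiece_free[OF v] by (auto simp: free_on_def)
  show "homogeneous e (lookup v s * \<epsilon> s)"
  proof (cases "\<delta> s \<le> e")
    case True
    have "homogeneous (e - \<delta> s) (lookup v s)"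
      unfolding homogeneous_lookup using fpieceD[OF v, of s] by fastforce
    from homogeneous_mult[OF this D[OF sB]] show ?thesis using True by simp
  next
    case False
    have "lookup (lookup v s) m = 0" for m
      using False fpieceD[OF v, of s m] by fastforce
    then have "lookup v s = 0" by (intro poly_mapping_eqI) simp
    then show ?thesis by simp
  qed
qed

section \<open>Homogeneous ideals\<close>

definition homogeneous_ideal :: "('v::{finite,linorder}, 'k::field) mpoly set \<Rightarrow> bool" where
  "homogeneous_ideal I \<longleftrightarrow> Q.subspace I \<and> (\<forall>p\<in>I. \<forall>e. hcomp e p \<in> I)"

definition ipiece :: "('v::{finite,linorder}, 'k::field) mpoly set \<Rightarrow> nat \<Rightarrow> ('v, 'k) mpoly set" where
  "ipiece I e = I \<inter> hpiece e"

lemma hpiece_fd: "Q.V.fd (hpiece e :: ('v::{finite,linorder}, 'k::field) mpoly set)"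
proof -
  have "Q.V.vs.subspace (hpiece e :: ('v, 'k) mpoly set)"
    unfolding Q.V.vs.subspace_def
  proof (intro conjI ballI allI)
    fix p and c :: 'k assume "p \<in> (hpiece e :: ('v, 'k) mpoly set)"
    then show "Q.sc c p \<in> hpiece e" by (auto simp: Q.sc_def homogeneous_lookup)
  qed (auto intro: homogeneous_add)
  moreover have "hpiece e \<subseteq> Q.V.vs.span (xpow ` {m :: 'v \<Rightarrow>\<^sub>0 nat. mon_deg m = e} :: ('v, 'k) mpoly set)"
  proof clarify
    fix p :: "('v, 'k) mpoly" assume p: "homogeneous e p"
    have "p = (\<Sum>m\<in>keys p. Q.sc (lookup p m) (xpow m))"
      unfolding Q.sc_def mult_single by (simp add: poly_mapping_sum_single[symmetric])
    also have "\<dots> \<in> Q.V.vs.span (xpow ` {m. mon_deg m = e})"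
      using p by (intro Q.V.vs.span_sum Q.V.vs.span_scale Q.V.vs.span_base) (auto simp: homogeneous_def)
    finally show "p \<in> Q.V.vs.span (xpow ` {m. mon_deg m = e})" .
  qed
  moreover have "finite (xpow ` {m :: 'v \<Rightarrow>\<^sub>0 nat. mon_deg m = e} :: ('v, 'k) mpoly set)"
    by (intro finite_imageI finite_mon_deg)
  ultimately show ?thesis unfolding Q.V.fd_def by blast
qed

lemma ideal_mult: "Q.subspace I \<Longrightarrow> p \<in> I \<Longrightarrow> q * p \<in> I"
  by (simp add: Q.subspace_def)

lemma ideal_sc: "Q.subspace I \<Longrightarrow> Q.V.vs.subspace I"
  unfolding Q.V.vs.subspace_def Q.subspace_def by (simp add: Q.sc_def)

lemma ipiece_subspace: "Q.subspace I \<Longrightarrow> Q.V.vs.subspace (ipiece I e)"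
  unfolding ipiece_def by (intro Q.V.vs.subspace_inter ideal_sc Q.V.fd_subspace hpiece_fd)

lemma hpiece_var: "homogeneous e p \<Longrightarrow> homogeneous (Suc e) (var v * p)"
  for p :: "('v::finite, 'k::comm_ring_1) mpoly"
  using homogeneous_mult[OF homogeneous_var, of e p v] by simp

lemma hpiece_graded: "Q.graded_family hpiece"
  by (simp add: Q.graded_family_def hpiece_fd hpiece_var)

lemma ipiece_graded: "Q.subspace I \<Longrightarrow> Q.graded_family (ipiece I)"
  unfolding Q.graded_family_def
  using Q.V.fd_subset[OF hpiece_fd ipiece_subspace] hpiece_var ideal_mult
  by (auto simp: ipiece_def)

text \<open>If \<open>a\<close> is a homogeneous generator, the components of \<open>r * a\<close> are the components of \<open>r\<close>
  times \<open>a\<close>.\<close>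

lemma homogeneous_ideal_gen:
  fixes G :: "('v::{finite,linorder}, 'k::field) mpoly set"
  assumes "\<And>g. g \<in> G \<Longrightarrow> \<exists>d. homogeneous d g"
  shows "homogeneous_ideal (ideal_gen G)"
  unfolding homogeneous_ideal_def ideal_gen_def
proof (intro conjI ballI allI Q.subspace_span)
  fix p e assume "p \<in> Q.span G"
  then obtain t r where t: "finite t" "t \<subseteq> G" "p = (\<Sum>a\<in>t. r a * a)"
    unfolding Q.span_explicit by auto
  show "hcomp e p \<in> Q.span G"
  proof -
    have "hcomp e (r a * a) \<in> Q.span G" if a: "a \<in> t" for a
    proof -
      obtain d where d: "homogeneous d a" using assms a t by blast
      note m = grading_map[OF grading_hcomp grading_hcomp, of "\<lambda>x. x * a" d, OF distrib_right]
      have dd: "\<And>d' y. y \<in> hpiece d' \<Longrightarrow> y * a \<in> hpiece (d' + d)"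
        using d by (auto intro: homogeneous_mult)
      show ?thesis
      proof (cases "d \<le> e")
        case True
        have "hcomp e (r a * a) = hcomp (e - d) (r a) * a" using m(1)[OF dd, of "r a" "e - d"] True by simp
        then show ?thesis using a t by (auto intro: Q.span_scale Q.span_base)
      next
        case False
        have "hcomp e (r a * a) = 0" using m(2)[OF dd, of "r a" e] False by simp
        then show ?thesis by (simp add: Q.span_zero)
      qed
    qed
    then show ?thesis unfolding t(3)
      by (subst additive_sum[of "hcomp e", OF grading_add[OF grading_hcomp]]) (rule Q.span_sum)
  qed
qed

lemma homogeneous_ideal_colon:
  assumes J: "homogeneous_ideal J" and f: "homogeneous d f"
  shows "homogeneous_ideal (colon J f)"
  unfolding homogeneous_ideal_def
proof (intro conjI ballI allI)
  have sJ: "Q.subspace J" using J by (simp add: homogeneous_ideal_def)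
  show "Q.subspace (colon J f)"
    using sJ unfolding Q.subspace_def colon_def by (auto simp: distrib_right mult.assoc)
  fix p e assume "p \<in> colon J f"
  then have "hcomp (e + d) (p * f) \<in> J" using J by (auto simp: colon_def homogeneous_ideal_def)
  moreover have "hcomp (e + d) (p * f) = hcomp e p * f"
    using f by (intro grading_map(1)[OF grading_hcomp grading_hcomp, of "\<lambda>x. x * f" d, OF distrib_right])
      (auto intro: homogeneous_mult)
  ultimately show "hcomp e p \<in> colon J f" by (simp add: colon_def)
qed

section \<open>Graded Betti numbers and Koszul homology\<close>

global_interpretation T: vspace "pm_scale :: 'k::field \<Rightarrow> (nat \<Rightarrow>\<^sub>0 'k) \<Rightarrow> _"
  unfolding vspace_def by (rule vector_space_pm_scale)

text \<open>The reduction of a vector modulo the ideal of the variables.\<close>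

definition const_part :: "(nat \<Rightarrow>\<^sub>0 ('v, 'k::comm_ring_1) mpoly) \<Rightarrow> (nat \<Rightarrow>\<^sub>0 'k)" where
  "const_part = Poly_Mapping.map (\<lambda>p. lookup p 0)"

lemma lookup_const_part [simp]:
  "lookup (const_part v) t = lookup (lookup v t) 0"
  by (auto simp: const_part_def Poly_Mapping.map.rep_eq when_def)

lemma lookup_mult_zero:
  fixes p q :: "('v, 'k::comm_ring_1) mpoly"
  shows "lookup (p * q) 0 = lookup p 0 * lookup q 0"
proof -
  have z: "0 = l + q' \<longleftrightarrow> l = 0 \<and> q' = 0" for l q' :: "'v \<Rightarrow>\<^sub>0 nat"
    by (auto simp: poly_mapping_eq_iff fun_eq_iff lookup_add)
  have "(\<Sum>q'. lookup q q' when 0 = l + q') = (lookup q 0 when l = 0)" for l :: "'v \<Rightarrow>\<^sub>0 nat"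
  proof -
    have "(\<Sum>q'. lookup q q' when 0 = l + q') = (\<Sum>q'. (lookup q q' when l = 0) when q' = 0)"
      unfolding z by (rule Sum_any.cong) (auto simp: when_def)
    then show ?thesis by simp
  qed
  then have "lookup (p * q) 0 = (\<Sum>l. (lookup p l * lookup q 0) when l = 0)"
    by (simp add: lookup_mult mult_when)
  then show ?thesis by simp
qed

lemma const_part_lin_ext: "const_part (lin_ext D v) = lin_ext (\<lambda>s. const_part (D s)) (const_part v)"
proof -
  have "lin_ext (\<lambda>s. const_part (D s)) (const_part v)
     = (\<Sum>s\<in>keys v. pm_scale (lookup (const_part v) s) (const_part (D s)))"
    by (rule lin_ext_superset) (auto simp: in_keys_iff)
  then show ?thesis
    by (intro poly_mapping_eqI) (simp add: lin_ext_def lookup_sum lookup_mult_zero)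
qed

lemma diff_tensor_eq: "diff_tensor R i = (\<lambda>s. const_part (diff R i s))"
  by (auto simp: diff_tensor_def const_part_def)

lemma const_part_add: "const_part (v + w) = const_part v + const_part w"
  by (rule poly_mapping_eqI) (simp add: lookup_add)

lemma const_part_piece: "v \<in> fpiece B \<delta> j \<Longrightarrow> const_part v \<in> free_on {s \<in> B. \<delta> s = j}"
  unfolding free_on_def by (auto simp: in_keys_iff dest!: fpieceD)

lemma const_part_onto:
  assumes "w \<in> free_on {s \<in> B. \<delta> s = j}"
  obtains v :: "nat \<Rightarrow>\<^sub>0 ('v, 'k::comm_ring_1) mpoly" where "v \<in> fpiece B \<delta> j" "const_part v = w"
proof -
  define v :: "('v, 'k) fvec" where "v = Poly_Mapping.map (single 0) w"
  have l: "lookup v t = single 0 (lookup w t)" for t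
    by (auto simp: v_def Poly_Mapping.map.rep_eq when_def)
  show ?thesis
  proof (rule that)
    show "v \<in> fpiece B \<delta> j"
    proof (rule fpieceI)
      fix t m assume "lookup (lookup v t) m \<noteq> 0"
      then have "m = 0" "t \<in> keys w" by (auto simp: l lookup_single in_keys_iff when_def split: if_splits)
      then show "t \<in> B \<and> mon_deg m + \<delta> t = j" using assms by (auto simp: free_on_def)
    qed
    show "const_part v = w" by (rule poly_mapping_eqI) (simp add: l)
  qed
qed

context
  fixes I :: "('v::{finite,linorder}, 'k::field) mpoly set" and R :: "('v, 'k) free_cx"
  assumes R: "graded_free_resolution I R" and I: "homogeneous_ideal I"
begin

abbreviation (input) rmod where "rmod i \<equiv> fpiece (basis R i) (bdeg R i) :: nat \<Rightarrow> ('v, 'k) fvec set"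

text \<open>Membership in the kernel of the map out of the \<open>i\<close>-th module of the resolution; for \<open>i =
  0\<close> this map goes to \<open>Q / I\<close>.\<close>

definition cyc :: "nat \<Rightarrow> ('v, 'k) fvec \<Rightarrow> bool" where
  "cyc i v \<longleftrightarrow> (case i of 0 \<Rightarrow> aug_map (aug R) v \<in> I | Suc i' \<Rightarrow> lin_ext (diff R i') v = 0)"

definition syz :: "nat \<Rightarrow> nat \<Rightarrow> ('v, 'k) fvec set" where
  "syz i e = {v \<in> rmod i e. cyc i v}"

abbreviation (input) rdiff where "rdiff i \<equiv> lin_ext (diff R i)"

lemma sI: "Q.subspace I" using I by (simp add: homogeneous_ideal_def)

lemma L_graded: "F.graded_family (rmod i)"
  using R by (intro fpiece_graded) (simp add: graded_free_resolution_def locally_finite_def)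

lemma exact: "{v \<in> free_on (basis R i). cyc i v} = rdiff i ` free_on (basis R (Suc i))"
  using R unfolding graded_free_resolution_def cyc_def by (cases i) simp_all

lemma bd_piece: "v \<in> rmod (Suc i) e \<Longrightarrow> rdiff i v \<in> rmod i e"
  by (erule lin_ext_fpiece[rotated]) (use R in \<open>simp add: graded_free_resolution_def fpiece_def\<close>)

lemma aug_piece: "v \<in> rmod 0 e \<Longrightarrow> aug_map (aug R) v \<in> hpiece e"
  unfolding mem_Collect_eq
  by (erule aug_map_hpiece[rotated]) (use R in \<open>simp add: graded_free_resolution_def\<close>)

lemma bd_syz: assumes "v \<in> rmod (Suc i) e" shows "rdiff i v \<in> syz i e"
  using exact[of i] bd_piece[OF assms] fpiece_free[OF assms] by (auto simp: syz_def)

lemma syz_L: "syz i e \<subseteq> rmod i e" by (auto simp: syz_def)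

lemma bd_zero: "v \<in> syz (Suc i) e \<Longrightarrow> rdiff i v = 0" by (simp add: syz_def cyc_def)

text \<open>A resolution is exact in each degree: take a component of a preimage.\<close>

lemma syz_bd: "rdiff i ` rmod (Suc i) e = syz i e"
proof (intro equalityI subsetI)
  fix x assume x: "x \<in> syz i e"
  then have xL: "x \<in> rmod i e" "cyc i x" by (auto simp: syz_def)
  then obtain w where w: "w \<in> free_on (basis R (Suc i))" "x = rdiff i w" using exact[of i] fpiece_free by blast
  have "vcomp (bdeg R i) (e + 0) (rdiff i w) = rdiff i (vcomp (bdeg R (Suc i)) e w)"
    by (rule grading_map(1)[where \<phi> = "rdiff i" and s = 0, OF grading_vcomp[of "basis R (Suc i)"] grading_vcomp[of "basis R i"] lin_ext_add _ w(1)])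
      (use bd_piece in simp)
  then have "x = rdiff i (vcomp (bdeg R (Suc i)) e w)" using w grading_id[OF grading_vcomp xL(1)] by simp
  moreover have "vcomp (bdeg R (Suc i)) e w \<in> rmod (Suc i) e" by (rule grading_in[OF grading_vcomp w(1)])
  ultimately show "x \<in> rdiff i ` rmod (Suc i) e" by blast
qed (auto intro: bd_syz)

lemma cyc_closed: "cyc i 0" "cyc i v \<Longrightarrow> cyc i w \<Longrightarrow> cyc i (v + w)" "cyc i v \<Longrightarrow> cyc i (pm_scale p v)"
  using sI by (auto simp: cyc_def lin_ext_add aug_map_add lin_ext_scale aug_map_scale Q.subspace_def split: nat.splits)

lemma syz_graded: "F.graded_family (syz i)"
  unfolding F.graded_family_def
proof (intro conjI allI ballI)
  fix e
  have "F.V.vs.subspace (syz i e)"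
    using F.V.fd_subspace[of "rmod i e"] L_graded[of i] cyc_closed
    unfolding F.V.vs.subspace_def syz_def F.graded_family_def by (auto simp: F.sc_def)
  then show "F.V.fd (syz i e)" using F.V.fd_subset[of "rmod i e"] syz_L L_graded[of i]
    by (simp add: F.graded_family_def)
  show "pm_scale (var v) x \<in> syz i (Suc e)" if "x \<in> syz i e" for v x
    using that L_graded[of i] cyc_closed by (auto simp: F.graded_family_def syz_def)
qed

lemma aug_onto: "Q.V.sumset (aug_map (aug R) ` rmod 0 e) (ipiece I (e + 0)) = hpiece (e + 0)"
proof (intro equalityI subsetI)
  fix q :: "('v, 'k) mpoly" assume q: "q \<in> hpiece (e + 0)"
  have "\<forall>q. \<exists>v\<in>free_on (basis R 0). q - aug_map (aug R) v \<in> I"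
    using R[unfolded graded_free_resolution_def] by (elim conjE) assumption
  then obtain v where v: "v \<in> free_on (basis R 0)" "q - aug_map (aug R) v \<in> I" by blast
  let ?v = "vcomp (bdeg R 0) e v"
  have vL: "?v \<in> rmod 0 e" by (rule grading_in[OF grading_vcomp v(1)])
  have "hcomp (e + 0) (aug_map (aug R) v) = aug_map (aug R) ?v"
    by (rule grading_map(1)[where \<phi> = "aug_map (aug R)" and s = 0, OF grading_vcomp[of "basis R 0"] grading_hcomp aug_map_add _ v(1)])
      (use aug_piece in simp)
  moreover have "hcomp e (q - aug_map (aug R) v) \<in> I" using v I by (simp add: homogeneous_ideal_def)
  moreover have "hcomp e (q - aug_map (aug R) v) = q - hcomp e (aug_map (aug R) v)"
    using grading_add[OF grading_hcomp, of e "q - aug_map (aug R) v" "aug_map (aug R) v"] 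
      grading_id[OF grading_hcomp, of q e] q by (simp add: algebra_simps)
  ultimately have "q - aug_map (aug R) ?v \<in> ipiece I e"
    using homogeneous_hcomp[of e "q - aug_map (aug R) v"] by (simp add: ipiece_def)
  then show "q \<in> Q.V.sumset (aug_map (aug R) ` rmod 0 e) (ipiece I (e + 0))"
    unfolding Q.V.sumset_def using vL by force
next
  fix q :: "('v, 'k) mpoly" assume "q \<in> Q.V.sumset (aug_map (aug R) ` rmod 0 e) (ipiece I (e + 0))"
  then show "q \<in> hpiece (e + 0)"
    using aug_piece by (auto simp: Q.V.sumset_def ipiece_def intro: homogeneous_add)
qed

text \<open>The augmentation induces an isomorphism from \<open>F\<^sub>0\<close> modulo the first syzygies to \<open>Q / I\<close>.\<close>

lemma kdim_aug: "F.kdim (rmod 0) (syz 0) q j = Q.kdim hpiece (ipiece I) q (j + 0)"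
proof (rule qmodule_pair.kdim_iso[OF _ aug_map_hom L_graded syz_graded hpiece_graded ipiece_graded[OF sI] _ aug_onto])
  show "qmodule_pair (pm_scale :: ('v, 'k) mpoly \<Rightarrow> ('v, 'k) fvec \<Rightarrow> _) (*)"
    unfolding qmodule_pair_def qmodule_def using module_pm_scale module_ring_mult by blast
  show "(aug_map (aug R) x \<in> ipiece I (e + 0)) = (x \<in> syz 0 e)" if "x \<in> rmod 0 e" for e x
    using that aug_piece[OF that] by (simp add: syz_def ipiece_def cyc_def)
qed (auto simp: ipiece_def syz_def)

lemma qmodule_pair_F: "qmodule_pair (pm_scale :: ('v, 'k) mpoly \<Rightarrow> ('v, 'k) fvec \<Rightarrow> _)
  (pm_scale :: ('v, 'k) mpoly \<Rightarrow> ('v, 'k) fvec \<Rightarrow> _)"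
  unfolding qmodule_pair_def qmodule_def using module_pm_scale by blast

lemma sumset_zero: "F.V.sumset A {0} = A" by (auto simp: F.V.sumset_def)

text \<open>The differential induces an isomorphism from \<open>F\<^sub>i\<^sub>+\<^sub>1\<close> modulo its cycles to the cycles in
  \<open>F\<^sub>i\<close>.\<close>

lemma kdim_bd: "F.kdim (rmod (Suc i)) (syz (Suc i)) q j = F.kdim (syz i) (\<lambda>_. {0}) q (j + 0)"
proof (rule qmodule_pair.kdim_iso[OF qmodule_pair_F lin_ext_hom[of "diff R i"] L_graded syz_graded syz_graded F.graded_family_trivial])
  show "F.V.sumset (rdiff i ` rmod (Suc i) e) {0} = syz i (e + 0)" for e
    using syz_bd by (simp add: sumset_zero)
  show "{0} \<subseteq> syz i e" for e using F.graded_family_zero[OF syz_graded] by simp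
qed (auto simp: syz_def cyc_def)

text \<open>Repeated dimension shifting moves along the resolution until the homological degree of the
  Koszul complex is \<open>1\<close>.\<close>

lemma kdim_resolution_shift: "F.kdim (rmod 0) (syz 0) (Suc i) j = F.kdim (rmod i) (syz i) (Suc 0) j"
proof -
  have "F.kdim (rmod i) (syz i) (Suc (Suc q)) j = F.kdim (rmod (Suc i)) (syz (Suc i)) (Suc q) j" for i q
    using F.kdim_shift[OF L_graded syz_graded syz_L acyclic_fpiece, of i q j] kdim_bd[of i "Suc q" j] by simp
  then have "F.kdim (rmod 0) (syz 0) (Suc (i + q)) j = F.kdim (rmod i) (syz i) (Suc q) j" for q
    by (induction i arbitrary: q) (metis add_0, metis add_Suc add_Suc_right)
  then show ?thesis using add_0_right by metis
qed

lemma linear_const_part: "Vector_Spaces.linear F.csc pm_scale (\<lambda>c. const_part (c {}))"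
  by unfold_locales (auto simp: const_part_add F.csc_def intro!: poly_mapping_eqI)

lemma vspace_pair_T: "vspace_pair F.csc (pm_scale :: 'k \<Rightarrow> (nat \<Rightarrow>\<^sub>0 'k) \<Rightarrow> _)"
  by (simp add: vspace_pair_def F.C.vspace_axioms T.vspace_axioms)

lemma place_chain: "x \<in> A j \<Longrightarrow> F.place {} x \<in> F.chains A 0 j"
  by (intro F.chainsI) (auto simp: F.place_def)

lemma chain_0_place: "c \<in> F.chains A 0 j \<Longrightarrow> F.place {} (c {}) = c"
proof
  fix S assume "c \<in> F.chains A 0 j"
  then show "F.place {} (c {}) S = c S"
    using F.chainsD(2)[of c A 0 j S] by (cases "S = {}") (simp_all add: F.place_def)
qed

lemma chain_0_in: "c \<in> F.chains A 0 j \<Longrightarrow> c {} \<in> A j"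
  using F.chainsD(1)[of c A 0 j "{}"] by simp

lemma const_part_kd: "const_part (F.kd b {}) = 0"
  by (rule poly_mapping_eqI) (simp add: lookup_F_kd lookup_kd)

text \<open>Taking constant terms maps \<open>F\<^sub>i\<close> onto \<open>F\<^sub>i \<otimes> \<k>\<close>. Its kernel \<open>m F\<^sub>i\<close> is contained in the
  Koszul boundaries \<open>m F\<^sub>i + syz i\<close>, whose image is that of \<open>F\<^sub>i\<^sub>+\<^sub>1 \<otimes> \<k>\<close>. The predicate \<open>P\<close>
  stands for being a cycle.\<close>

lemma tor_dim:
  assumes Z: "Z = {c \<in> F.chains (rmod i) 0 j. P (const_part (c {}))}" "F.C.vs.subspace Z"
    "F.kboundaries (rmod i) (syz i) 0 j \<subseteq> Z"
  shows "int (F.C.vs.dim Z) - int (F.C.vs.dim (F.kboundaries (rmod i) (syz i) 0 j)) =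
    int (T.vs.dim {w \<in> tensor_piece R i j. P w}) - int (T.vs.dim (tor_boundaries R i j))"
proof (rule vspace_pair.dim_quotient_eq_surj[OF vspace_pair_T linear_const_part _ 
      F.kboundaries_subspace[OF L_graded syz_graded] Z(3)])
  show "F.C.fd Z" using F.C.fd_subset[OF F.chains_fd[OF L_graded] Z(2)] Z(1) by blast
  show "(\<lambda>c. const_part (c {})) ` Z = {w \<in> tensor_piece R i j. P w}"
  proof (intro equalityI subsetI)
    fix w assume w: "w \<in> {w \<in> tensor_piece R i j. P w}"
    then obtain v :: "('v, 'k) fvec" where v: "v \<in> rmod i j" "const_part v = w"
      unfolding tensor_piece_def using const_part_onto by blast
    then show "w \<in> (\<lambda>c. const_part (c {})) ` Z"
      using w place_chain[of v "rmod i" j] Z(1) by (intro image_eqI[of _ _ "F.place {} v"]) (auto simp: F.place_def)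
  next
    fix w assume "w \<in> (\<lambda>c. const_part (c {})) ` Z"
    then show "w \<in> {w \<in> tensor_piece R i j. P w}"
      using const_part_piece[OF chain_0_in] by (auto simp: Z(1) tensor_piece_def)
  qed
  show "(\<lambda>c. const_part (c {})) ` F.kboundaries (rmod i) (syz i) 0 j = tor_boundaries R i j"
  proof (intro equalityI subsetI)
    fix w assume "w \<in> (\<lambda>c. const_part (c {})) ` F.kboundaries (rmod i) (syz i) 0 j"
    then obtain b n where bn: "n \<in> F.chains (syz i) 0 j" "w = const_part ((F.kd b + n) {})"
      by (auto simp: F.kboundaries_def F.C.sumset_def)
    then have w: "w = const_part (n {})" by (simp add: const_part_add const_part_kd)
    have "n {} \<in> syz i j" by (rule chain_0_in[OF bn(1)])
    then obtain u where u: "u \<in> rmod (Suc i) j" "n {} = rdiff i u" using syz_bd by blast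
    then have "w = lin_ext (diff_tensor R i) (const_part u)" by (simp add: w const_part_lin_ext diff_tensor_eq)
    moreover have "const_part u \<in> tensor_piece R (Suc i) j"
      unfolding tensor_piece_def by (rule const_part_piece[OF u(1)])
    ultimately show "w \<in> tor_boundaries R i j" by (simp add: tor_boundaries_def)
  next
    fix w assume "w \<in> tor_boundaries R i j"
    then obtain y where y: "y \<in> tensor_piece R (Suc i) j" "w = lin_ext (diff_tensor R i) y"
      by (auto simp: tor_boundaries_def)
    then obtain u :: "('v, 'k) fvec" where u: "u \<in> rmod (Suc i) j" "const_part u = y"
      unfolding tensor_piece_def using const_part_onto by blast
    have "F.place {} (rdiff i u) \<in> F.chains (syz i) 0 j" by (rule place_chain[of _ "syz i", OF bd_syz[OF u(1)]])
    then have "F.place {} (rdiff i u) \<in> F.kboundaries (rmod i) (syz i) 0 j"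
      using F.C.sumset_right[OF F.C.fd_subspace[OF F.kd_image_fd[OF L_graded]]]
      unfolding F.kboundaries_def by blast
    moreover have "w = const_part (F.place {} (rdiff i u) {})"
      using y u by (simp add: F.place_def const_part_lin_ext diff_tensor_eq)
    ultimately show "w \<in> (\<lambda>c. const_part (c {})) ` F.kboundaries (rmod i) (syz i) 0 j" by blast
  qed
  fix z assume z: "z \<in> Z" "const_part (z {}) = 0"
  then have zc: "z \<in> F.chains (rmod i) 0 j" by (simp add: Z(1))
  have "\<forall>t. lookup (lookup (z {}) t) 0 = 0"
    using z(2) by (metis lookup_const_part lookup_zero)
  then have "F.place {} (z {}) \<in> F.kd ` F.chains (rmod i) (Suc 0) j"
    using kd_chains_1_iff[OF chain_0_in[OF zc]] by blast
  then have "z \<in> F.kd ` F.chains (rmod i) (Suc 0) j" using chain_0_place[OF zc] by simp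
  then show "z \<in> F.kboundaries (rmod i) (syz i) 0 j"
    unfolding F.kboundaries_def using F.C.sumset_left[OF F.chains_subspace[OF syz_graded]] by blast
qed

lemma kdim_0: "F.kdim (rmod 0) (syz 0) 0 j = int (T.vs.dim (tor_cycles R 0 j)) - int (T.vs.dim (tor_boundaries R 0 j))"
proof -
  have Z: "F.kcycles (rmod 0) (syz 0) 0 j = {c \<in> F.chains (rmod 0) 0 j. True}"
    using F.kcycles_0[OF syz_graded] by simp
  have "tor_cycles R 0 j = {w \<in> tensor_piece R 0 j. True}" by (simp add: tor_cycles_def)
  then show ?thesis unfolding F.kdim_def
    using tor_dim[of _ 0 j "\<lambda>_. True", OF Z F.C.fd_subspace[OF F.kcycles_fd[OF L_graded syz_graded]] 
      F.kboundaries_subset[OF L_graded syz_graded syz_L]] by simp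
qed

text \<open>Both sides are the dimension of \<open>(syz i \<inter> m F\<^sub>i) / m syz i\<close>. For the left-hand side this
  is \<open>kdim_shift_0\<close>; for the right-hand side, an element of \<open>F\<^sub>i\<^sub>+\<^sub>1\<close> represents a cycle of \<open>F \<otimes>
  \<k>\<close> if and only if the differential maps it to \<open>m F\<^sub>i\<close>.\<close>

lemma kdim_Suc: "F.kdim (rmod i) (syz i) (Suc 0) j =
   int (T.vs.dim (tor_cycles R (Suc i) j)) - int (T.vs.dim (tor_boundaries R (Suc i) j))"
proof -
  let ?A = "F.chains (syz i) 0 j \<inter> F.kd ` F.chains (rmod i) (Suc 0) j"
  let ?B = "F.kboundaries (rmod (Suc i)) (syz (Suc i)) 0 j"
  define Z where "Z = {c \<in> F.chains (rmod (Suc i)) 0 j. lin_ext (diff_tensor R i) (const_part (c {})) = 0}"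
  interpret P: qmodule_pair "pm_scale :: ('v, 'k) mpoly \<Rightarrow> ('v, 'k) fvec \<Rightarrow> _"
    "pm_scale :: ('v, 'k) mpoly \<Rightarrow> ('v, 'k) fvec \<Rightarrow> _" by (rule qmodule_pair_F)
  have comp: "(rdiff i \<circ> c) = F.place {} (rdiff i (c {}))" if "c \<in> F.chains A 0 j" for c A
  proof
    fix S show "(rdiff i \<circ> c) S = F.place {} (rdiff i (c {})) S"
      using F.chainsD(2)[OF that, of S] by (cases "S = {}") (simp_all add: F.place_def)
  qed
  have Z_iff: "c \<in> Z \<longleftrightarrow> rdiff i \<circ> c \<in> ?A" if c: "c \<in> F.chains (rmod (Suc i)) 0 j" for c
  proof -
    have s: "rdiff i (c {}) \<in> syz i j" by (rule bd_syz[OF chain_0_in[OF c]])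
    then have "rdiff i (c {}) \<in> rmod i j" using syz_L by blast
    from kd_chains_1_iff[OF this]
    have "rdiff i \<circ> c \<in> F.kd ` F.chains (rmod i) (Suc 0) j \<longleftrightarrow> const_part (rdiff i (c {})) = 0"
      unfolding comp[OF c] by (simp add: poly_mapping_eq_iff fun_eq_iff)
    moreover have "rdiff i \<circ> c \<in> F.chains (syz i) 0 j" unfolding comp[OF c] using s by (rule place_chain)
    ultimately show ?thesis using c by (simp add: Z_def const_part_lin_ext diff_tensor_eq)
  qed
  have sA: "F.C.vs.subspace ?A"
    by (intro F.C.vs.subspace_inter F.C.fd_subspace F.kd_image_fd F.chains_fd syz_graded L_graded)
  have lin: "Vector_Spaces.linear F.csc F.csc (\<lambda>c. rdiff i \<circ> c)" by (rule P.linear_comp[OF lin_ext_hom])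
  interpret l: Vector_Spaces.linear F.csc F.csc "\<lambda>c. rdiff i \<circ> c" by (rule lin)
  have Z': "Z = {c \<in> F.chains (rmod (Suc i)) 0 j. rdiff i \<circ> c \<in> ?A}" using Z_iff by (auto simp: Z_def)
  have sZ: "F.C.vs.subspace Z"
    unfolding Z' using F.chains_subspace[OF L_graded[of "Suc i"], of 0 j] sA
    unfolding F.C.vs.subspace_def by (simp add: l.add l.scale l.zero del: Int_iff)
  have fZ: "F.C.fd Z" using F.C.fd_subset[OF F.chains_fd[OF L_graded] sZ] by (auto simp: Z_def)
  have img: "(\<lambda>c. rdiff i \<circ> c) ` F.chains (rmod (Suc i)) q j = F.chains (syz i) q j" for q
  proof (intro equalityI subsetI)
    fix c assume c: "c \<in> F.chains (syz i) q j"
    have "\<exists>y. c S = rdiff i y \<and> (if card S = q \<and> q \<le> j then y \<in> rmod (Suc i) (j - q) else y = 0)" for S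
    proof (cases "card S = q \<and> q \<le> j")
      case True
      then have "c S \<in> rdiff i ` rmod (Suc i) (j - q)" using F.chainsD(1)[OF c, of S] syz_bd by simp
      then show ?thesis using True by auto
    next
      case False
      then show ?thesis using F.chainsD(2)[OF c, of S] by (intro exI[of _ 0]) auto
    qed
    then obtain b where b: "\<And>S. c S = rdiff i (b S)" "\<And>S. if card S = q \<and> q \<le> j then b S \<in> rmod (Suc i) (j - q) else b S = 0"
      by metis
    then have "b \<in> F.chains (rmod (Suc i)) q j" "c = rdiff i \<circ> b" by (auto simp: F.chains_def)
    then show "c \<in> (\<lambda>c. rdiff i \<circ> c) ` F.chains (rmod (Suc i)) q j" by blast
  next
    fix c assume "c \<in> (\<lambda>c. rdiff i \<circ> c) ` F.chains (rmod (Suc i)) q j"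
    then obtain b where b: "b \<in> F.chains (rmod (Suc i)) q j" "c = rdiff i \<circ> b" by blast
    show "c \<in> F.chains (syz i) q j" unfolding b(2)
      using F.chainsD[OF b(1)] bd_syz by (intro F.chainsI) auto
  qed
  have bdn: "rdiff i \<circ> n = 0" if "n \<in> F.chains (syz (Suc i)) q j" for n q
  proof
    fix S show "(rdiff i \<circ> n) S = 0 S"
      using F.chainsD[OF that, of S] bd_zero by (cases "card S = q \<and> q \<le> j") auto
  qed
  have BI: "(\<lambda>c. rdiff i \<circ> c) ` ?B = F.kd ` F.chains (syz i) (Suc 0) j"
  proof (intro equalityI subsetI)
    fix c assume "c \<in> (\<lambda>c. rdiff i \<circ> c) ` ?B"
    then obtain b n where bn: "b \<in> F.chains (rmod (Suc i)) (Suc 0) j" "n \<in> F.chains (syz (Suc i)) 0 j" "c = rdiff i \<circ> (F.kd b + n)"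
      by (auto simp: F.kboundaries_def F.C.sumset_def)
    then have "c = F.kd (rdiff i \<circ> b)" by (simp add: l.add bdn P.kd_comp[OF lin_ext_hom])
    then show "c \<in> F.kd ` F.chains (syz i) (Suc 0) j" using img bn(1) by blast
  next
    fix c assume "c \<in> F.kd ` F.chains (syz i) (Suc 0) j"
    then obtain b where b: "b \<in> F.chains (rmod (Suc i)) (Suc 0) j" "c = F.kd (rdiff i \<circ> b)" unfolding img[symmetric] by blast
    then have "c = rdiff i \<circ> F.kd b" by (simp add: P.kd_comp[OF lin_ext_hom])
    moreover have "F.kd b \<in> ?B" unfolding F.kboundaries_def
      using F.C.sumset_left[OF F.chains_subspace[OF syz_graded]] b(1) by blast
    ultimately show "c \<in> (\<lambda>c. rdiff i \<circ> c) ` ?B" by blast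
  qed
  have BL: "?B \<subseteq> F.chains (rmod (Suc i)) 0 j"
    using F.kboundaries_subset[OF L_graded syz_graded syz_L, of "Suc i" 0 j] by (auto simp: F.kcycles_def)
  have BZ: "?B \<subseteq> Z"
  proof
    fix c assume c: "c \<in> ?B"
    then obtain b where b: "rdiff i \<circ> c = F.kd b" "b \<in> F.chains (syz i) (Suc 0) j" using BI by blast
    have "b \<in> F.chains (rmod i) (Suc 0) j" using F.chains_mono[of "syz i" "rmod i", OF syz_L] b(2) by blast
    then have "rdiff i \<circ> c \<in> ?A" unfolding b(1) using F.kd_chains_Suc[OF syz_graded b(2)] by blast
    then show "c \<in> Z" using Z_iff BL c by blast
  qed
  have "int (F.C.vs.dim Z) - int (F.C.vs.dim ?B) = int (F.C.vs.dim ?A) - int (F.C.vs.dim (F.kd ` F.chains (syz i) (Suc 0) j))"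
  proof (rule vspace_pair.dim_quotient_eq_surj[OF P.vspace_pair lin fZ F.kboundaries_subspace[OF L_graded syz_graded] BZ _ BI])
    show "(\<lambda>c. rdiff i \<circ> c) ` Z = ?A"
    proof (intro equalityI subsetI)
      fix a assume a: "a \<in> ?A"
      then obtain c where "c \<in> F.chains (rmod (Suc i)) 0 j" "a = rdiff i \<circ> c" using img by blast
      then show "a \<in> (\<lambda>c. rdiff i \<circ> c) ` Z" using Z_iff a by blast
    qed (use Z' in blast)
    fix z assume z: "z \<in> Z" "rdiff i \<circ> z = 0"
    have zc: "z \<in> F.chains (rmod (Suc i)) 0 j" using z by (simp add: Z_def)
    have "rdiff i (z {}) = 0" using z(2) by (metis comp_apply zero_fun_apply)
    then have "z {} \<in> syz (Suc i) j" using chain_0_in[OF zc] by (simp add: syz_def cyc_def)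
    then have "z \<in> F.chains (syz (Suc i)) 0 j" 
      using place_chain[of "z {}" "syz (Suc i)" j] chain_0_place[OF zc] by simp
    then show "z \<in> ?B"
      using F.C.sumset_right[OF F.C.fd_subspace[OF F.kd_image_fd[OF L_graded]]]
      unfolding F.kboundaries_def by blast
  qed
  moreover have "int (F.C.vs.dim Z) - int (F.C.vs.dim ?B) =
    int (T.vs.dim {w \<in> tensor_piece R (Suc i) j. lin_ext (diff_tensor R i) w = 0}) - int (T.vs.dim (tor_boundaries R (Suc i) j))"
    by (rule tor_dim[OF Z_def sZ BZ])
  moreover have "tor_cycles R (Suc i) j = {w \<in> tensor_piece R (Suc i) j. lin_ext (diff_tensor R i) w = 0}"
    by (simp add: tor_cycles_def)
  ultimately show ?thesis using F.kdim_shift_0[OF L_graded syz_graded syz_L acyclic_fpiece, of i j] by simp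
qed

text \<open>The balancing of \<open>Tor\<close>: the homology of \<open>R \<otimes> \<k>\<close> is the Koszul homology of \<open>Q / I\<close>.\<close>

lemma tor_eq_koszul:
  "int (T.vs.dim (tor_cycles R i j)) - int (T.vs.dim (tor_boundaries R i j)) = Q.kdim hpiece (ipiece I) i j"
proof (cases i)
  case 0 then show ?thesis using kdim_0[of j] kdim_aug[of 0 j] by simp
next
  case (Suc i')
  then show ?thesis using kdim_Suc[of i' j] kdim_resolution_shift[of i' j] kdim_aug[of "Suc i'" j] by simp
qed

end

section \<open>Existence of graded free resolutions\<close>

definition graded_submodule :: "nat set \<Rightarrow> (nat \<Rightarrow> nat) \<Rightarrow> (nat \<Rightarrow>\<^sub>0 ('v::{finite,linorder}, 'k::field) mpoly) set \<Rightarrow> bool" where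
  "graded_submodule B \<delta> N \<longleftrightarrow> N \<subseteq> free_on B \<and> F.subspace N \<and> (\<forall>v\<in>N. \<forall>e. vcomp \<delta> e v \<in> N)"

lemma free_on_subspace: "F.subspace (free_on B)"
proof (rule F.subspaceI)
  fix x y :: "('a, 'b) fvec" and c
  show "0 \<in> (free_on B :: (('a, 'b) fvec) set)" by (simp add: free_on_def)
  show "x + y \<in> free_on B" if "x \<in> free_on B" "y \<in> free_on B"
    using that keys_add[of x y] by (auto simp: free_on_def)
  show "pm_scale c x \<in> free_on B" if "x \<in> free_on B"
    using that keys_pm_scale[of c x] by (auto simp: free_on_def)
qed

lemma sc_subspace: "F.subspace N \<Longrightarrow> F.V.vs.subspace N"
  unfolding F.V.vs.subspace_def F.subspace_def by (simp add: F.sc_def)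

lemma lin_ext_single: "lin_ext D (single s 1) = D s"
  by (rule poly_mapping_eqI) (simp add: lin_ext_def)

text \<open>In each degree, map basis elements to a finite spanning set of the vector space in that
  degree.\<close>

lemma graded_submodule_cover:
  fixes N :: "(nat \<Rightarrow>\<^sub>0 ('v::{finite,linorder}, 'k::field) mpoly) set"
  assumes lf: "locally_finite B \<delta>" and N: "graded_submodule B \<delta> N"
  obtains B' \<delta>' and D :: "nat \<Rightarrow> ('v, 'k) fvec" where "locally_finite B' \<delta>'"
    "\<And>s. s \<in> B' \<Longrightarrow> D s \<in> N \<inter> fpiece B \<delta> (\<delta>' s)" "lin_ext D ` free_on B' = N"
proof -
  have sN: "F.subspace N" and NB: "N \<subseteq> free_on B" using N by (auto simp: graded_submodule_def)
  have "\<exists>G. finite G \<and> F.V.vs.span G = N \<inter> fpiece B \<delta> e" for e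
  proof -
    have "F.V.vs.subspace (N \<inter> fpiece B \<delta> e)"
      by (intro F.V.vs.subspace_inter sc_subspace sN fpiece_subspace)
    from F.V.fd_subset[OF fpiece_fd[OF lf] this] show ?thesis by (metis F.V.fd_basis inf_le2)
  qed
  then obtain G where G: "\<And>e. finite (G e)" "\<And>e. F.V.vs.span (G e) = N \<inter> fpiece B \<delta> e" by metis
  have "\<exists>f. bij_betw f {..<card (G e)} (G e)" for e
    using G(1)[of e] ex_bij_betw_nat_finite by (metis atLeast0LessThan)
  then obtain f where f: "\<And>e. bij_betw (f e) {..<card (G e)} (G e)" by metis
  \<comment> \<open>A basis element encodes a degree and the number of a vector in the spanning set of that degree.\<close>
  define B' :: "nat set" where "B' = {s. snd (prod_decode s) < card (G (fst (prod_decode s)))}"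
  define \<delta>' :: "nat \<Rightarrow> nat" where "\<delta>' s = fst (prod_decode s)" for s
  define D :: "nat \<Rightarrow> ('v, 'k) fvec" where "D s = f (fst (prod_decode s)) (snd (prod_decode s))" for s
  show ?thesis
  proof (rule that[of B' \<delta>' D])
    show "locally_finite B' \<delta>'"
      unfolding locally_finite_def
    proof
      fix d
      have "{s \<in> B'. \<delta>' s = d} \<subseteq> (\<lambda>k. prod_encode (d, k)) ` {..<card (G d)}"
      proof
        fix s assume "s \<in> {s \<in> B'. \<delta>' s = d}"
        then have "s = prod_encode (d, snd (prod_decode s))" "snd (prod_decode s) < card (G d)"
          by (auto simp: B'_def \<delta>'_def)
        then show "s \<in> (\<lambda>k. prod_encode (d, k)) ` {..<card (G d)}" by blast
      qed
      then show "finite {s \<in> B'. \<delta>' s = d}" by (rule finite_subset) simp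
    qed
    show DN: "D s \<in> N \<inter> fpiece B \<delta> (\<delta>' s)" if "s \<in> B'" for s
    proof -
      have "D s \<in> G (\<delta>' s)" using that f[of "\<delta>' s"] by (auto simp: B'_def \<delta>'_def D_def bij_betw_def)
      then show ?thesis using G(2) F.V.vs.span_base by blast
    qed
    show "lin_ext D ` free_on B' = N"
    proof (intro equalityI subsetI)
      fix x assume "x \<in> lin_ext D ` free_on B'"
      then obtain v where v: "v \<in> free_on B'" "x = lin_ext D v" by blast
      show "x \<in> N" unfolding v(2) lin_ext_def
        using v(1) DN by (intro F.subspace_sum[OF sN] F.subspace_scale[OF sN]) (auto simp: free_on_def)
    next
      fix x assume x: "x \<in> N"
      have sub: "F.subspace (lin_ext D ` free_on B')"
        by (rule module_hom.subspace_image[OF lin_ext_hom free_on_subspace])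
      have "N \<inter> fpiece B \<delta> e \<subseteq> lin_ext D ` free_on B'" for e
        unfolding G(2)[symmetric]
      proof (rule F.V.vs.span_minimal[OF _ sc_subspace[OF sub]])
        show "G e \<subseteq> lin_ext D ` free_on B'"
        proof
          fix g assume "g \<in> G e"
          then obtain k where k: "k < card (G e)" "g = f e k" using f[of e] by (auto simp: bij_betw_def)
          have "g = lin_ext D (single (prod_encode (e, k)) 1)"
            using k(2) by (simp add: lin_ext_single D_def)
          moreover have "single (prod_encode (e, k)) 1 \<in> free_on B'"
            using k(1) by (auto simp: free_on_def B'_def)
          ultimately show "g \<in> lin_ext D ` free_on B'" by blast
        qed
      qed
      moreover have "vcomp \<delta> e x \<in> N \<inter> fpiece B \<delta> e" for e
        using x N grading_in[OF grading_vcomp, of x B \<delta> e] NB by (auto simp: graded_submodule_def)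
      ultimately have "vcomp \<delta> e x \<in> lin_ext D ` free_on B'" for e by blast
      moreover obtain E where "finite E" "x = (\<Sum>e\<in>E. vcomp \<delta> e x)" using grading_sum[OF grading_vcomp[of B \<delta>]] .
      ultimately show "x \<in> lin_ext D ` free_on B'" using F.subspace_sum[OF sub, of E] by metis
    qed
  qed
qed

lemma kernel_graded_submodule:
  assumes D: "\<And>s. s \<in> B' \<Longrightarrow> D s \<in> fpiece B \<delta> (\<delta>' s)"
  shows "graded_submodule B' \<delta>' {v \<in> free_on B'. lin_ext D v = 0}"
  unfolding graded_submodule_def
proof (intro conjI ballI allI)
  show "F.subspace {v \<in> free_on B'. lin_ext D v = 0}"
    by (rule F.subspaceI) (auto simp: lin_ext_add lin_ext_scale intro: F.subspace_0[OF free_on_subspace]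
      F.subspace_add[OF free_on_subspace] F.subspace_scale[OF free_on_subspace])
  fix v e assume "v \<in> {v \<in> free_on B'. lin_ext D v = 0}"
  then have v: "v \<in> free_on B'" "lin_ext D v = 0" by auto
  have "vcomp \<delta> (e + 0) (lin_ext D v) = lin_ext D (vcomp \<delta>' e v)"
    by (rule grading_map(1)[where \<phi> = "lin_ext D" and s = 0, OF grading_vcomp[of B'] grading_vcomp[of B \<delta>] lin_ext_add _ v(1)])
      (use lin_ext_fpiece[of B' D B \<delta> \<delta>', OF D] in simp)
  then have "lin_ext D (vcomp \<delta>' e v) = 0" using v(2) by (auto simp: vcomp_def)
  moreover have "vcomp \<delta>' e v \<in> free_on B'" using grading_in[OF grading_vcomp v(1)] fpiece_free by blast
  ultimately show "vcomp \<delta>' e v \<in> {v \<in> free_on B'. lin_ext D v = 0}" by simp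
qed auto

text \<open>Starting from \<open>Q \<rightarrow> Q / I\<close>, cover one kernel after the other. A state of the recursion
  consists of a free module, the images of its basis elements in the previous one, and the
  kernel to be covered next.\<close>

lemma resolution_exists:
  fixes I :: "('v::{finite,linorder}, 'k::field) mpoly set"
  assumes I: "homogeneous_ideal I"
  obtains R where "graded_free_resolution I R"
proof -
  have sI: "Q.subspace I" using I by (simp add: homogeneous_ideal_def)
  let ?one = "\<lambda>_::nat. 1 :: ('v, 'k) mpoly"
  define N0 where "N0 = {v \<in> free_on {0}. aug_map ?one v \<in> I}"
  have aug: "homogeneous e (aug_map ?one v)" if "v \<in> fpiece {0} (\<lambda>_. 0) e" for e v
    by (rule aug_map_hpiece[OF _ that]) (simp add: homogeneous_def)
  have N0: "graded_submodule {0} (\<lambda>_. 0) N0"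
    unfolding graded_submodule_def
  proof (intro conjI ballI allI)
    show "F.subspace N0"
      unfolding N0_def
      by (rule F.subspaceI) (auto simp: aug_map_add aug_map_scale intro: F.subspace_0[OF free_on_subspace]
        F.subspace_add[OF free_on_subspace] F.subspace_scale[OF free_on_subspace]
        Q.subspace_0[OF sI] Q.subspace_add[OF sI] Q.subspace_scale[OF sI])
    fix v e assume "v \<in> N0"
    then have v: "v \<in> free_on {0}" "aug_map ?one v \<in> I" by (auto simp: N0_def)
    have "hcomp (e + 0) (aug_map ?one v) = aug_map ?one (vcomp (\<lambda>_. 0) e v)"
      by (rule grading_map(1)[where \<phi> = "aug_map ?one" and s = 0, OF grading_vcomp[of "{0}"] grading_hcomp aug_map_add _ v(1)])
        (use aug in simp)
    moreover have "hcomp (e + 0) (aug_map ?one v) \<in> I" using I v by (simp add: homogeneous_ideal_def)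
    ultimately have "aug_map ?one (vcomp (\<lambda>_. 0) e v) \<in> I" by simp
    moreover have "vcomp (\<lambda>_. 0) e v \<in> free_on {0}" using grading_in[OF grading_vcomp v(1)] fpiece_free by blast
    ultimately show "vcomp (\<lambda>_. 0) e v \<in> N0" by (simp add: N0_def)
  qed (auto simp: N0_def)
  define P :: "nat \<Rightarrow> nat set \<times> (nat \<Rightarrow> nat) \<times> (nat \<Rightarrow> ('v, 'k) fvec) \<times> ('v, 'k) fvec set \<Rightarrow> bool"
    where "P n x = (case x of (B, \<delta>, D, N) \<Rightarrow> locally_finite B \<delta> \<and> graded_submodule B \<delta> N \<and>
       (n = 0 \<longrightarrow> B = {0} \<and> \<delta> = (\<lambda>_. 0) \<and> N = N0))" for n x
  define S :: "nat \<Rightarrow> nat set \<times> (nat \<Rightarrow> nat) \<times> (nat \<Rightarrow> ('v, 'k) fvec) \<times> ('v, 'k) fvec set \<Rightarrow>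
     nat set \<times> (nat \<Rightarrow> nat) \<times> (nat \<Rightarrow> ('v, 'k) fvec) \<times> ('v, 'k) fvec set \<Rightarrow> bool"
    where "S n x y = (case x of (B, \<delta>, D, N) \<Rightarrow> case y of (B', \<delta>', D', N') \<Rightarrow>
       (\<forall>s\<in>B'. D' s \<in> fpiece B \<delta> (\<delta>' s)) \<and> lin_ext D' ` free_on B' = N \<and> N' = {v \<in> free_on B'. lin_ext D' v = 0})" for n x y
  have "\<exists>f. \<forall>n. P n (f n) \<and> S n (f n) (f (Suc n))"
  proof (rule dependent_nat_choice)
    have "locally_finite {0} (\<lambda>_. 0)" by (simp add: locally_finite_def)
    then have "P 0 ({0}, (\<lambda>_. 0), (\<lambda>_. 0), N0)" using N0 by (simp add: P_def)
    then show "\<exists>x. P 0 x" by blast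
  next
    fix x n assume "P n x"
    then obtain B \<delta> D N where x: "x = (B, \<delta>, D, N)" "locally_finite B \<delta>" "graded_submodule B \<delta> N"
      by (auto simp: P_def split: prod.splits)
    obtain B' \<delta>' and D' :: "nat \<Rightarrow> ('v, 'k) fvec" where D': "locally_finite B' \<delta>'"
      "\<And>s. s \<in> B' \<Longrightarrow> D' s \<in> N \<inter> fpiece B \<delta> (\<delta>' s)" "lin_ext D' ` free_on B' = N"
      using graded_submodule_cover[OF x(2,3)] by metis
    define N' where "N' = {v \<in> free_on B'. lin_ext D' v = 0}"
    have "P (Suc n) (B', \<delta>', D', N')" 
      using D' kernel_graded_submodule[of B' D' B \<delta> \<delta>'] by (simp add: P_def N'_def)
    moreover have "S n x (B', \<delta>', D', N')" using D' by (simp add: S_def x N'_def)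
    ultimately show "\<exists>y. P (Suc n) y \<and> S n x y" by blast
  qed
  then obtain f where f: "\<And>n. P n (f n)" "\<And>n. S n (f n) (f (Suc n))" by blast
  define b where "b n = fst (f n)" for n
  define d where "d n = fst (snd (f n))" for n
  define D where "D n = fst (snd (snd (f n)))" for n
  define N where "N n = snd (snd (snd (f n)))" for n
  have fn: "f n = (b n, d n, D n, N n)" for n by (simp add: b_def d_def D_def N_def)
  have P: "locally_finite (b n) (d n)" "b 0 = {0}" "d 0 = (\<lambda>_. 0)" "N 0 = N0" for n
    using f(1)[of n] f(1)[of 0] by (simp_all add: fn P_def)
  have S: "\<And>s. s \<in> b (Suc n) \<Longrightarrow> D (Suc n) s \<in> fpiece (b n) (d n) (d (Suc n) s)"
    "lin_ext (D (Suc n)) ` free_on (b (Suc n)) = N n" 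
    "N (Suc n) = {v \<in> free_on (b (Suc n)). lin_ext (D (Suc n)) v = 0}" for n
    using f(2)[of n] by (auto simp: fn S_def)
  define R :: "('v, 'k) free_cx" where "R = \<lparr>basis = b, bdeg = d, diff = (\<lambda>i. D (Suc i)), aug = ?one\<rparr>"
  have onto: "\<exists>v\<in>free_on {0}. q - aug_map ?one v \<in> I" for q :: "('v, 'k) mpoly"
  proof (rule bexI)
    have "aug_map ?one (single 0 q) = q" by (simp add: aug_map_def)
    then show "q - aug_map ?one (single 0 q) \<in> I" using sI by (simp add: Q.subspace_def)
  qed (auto simp: free_on_def)
  have "graded_free_resolution I R"
    unfolding graded_free_resolution_def R_def free_cx.simps
  proof (intro conjI allI ballI)
    show "finite {s \<in> b i. d i s = e}" for i e using P(1)[of i] by (simp add: locally_finite_def)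
    show "homogeneous (d 0 s) (1 :: ('v, 'k) mpoly)" for s by (simp add: P homogeneous_def)
    show "D (Suc i) s \<in> free_on (b i)" "homogeneous_vec (d i) (d (Suc i) s) (D (Suc i) s)"
      if "s \<in> b (Suc i)" for i s using S(1)[OF that] by (auto simp: fpiece_def)
    show "\<exists>v\<in>free_on (b 0). q - aug_map ?one v \<in> I" for q using onto by (simp add: P)
    show "{v \<in> free_on (b 0). aug_map ?one v \<in> I} = lin_ext (D (Suc 0)) ` free_on (b (Suc 0))"
      unfolding S(2) P(2,4) N0_def ..
    show "{v \<in> free_on (b (Suc i)). lin_ext (D (Suc i)) v = 0} = lin_ext (D (Suc (Suc i))) ` free_on (b (Suc (Suc i)))" for i
      unfolding S(2) S(3) ..
  qed
  then show ?thesis using that by blast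
qed

text \<open>The balancing of \<open>Tor\<close> holds for every resolution, in particular for the chosen one.\<close>

theorem graded_betti_eq_kdim:
  assumes "homogeneous_ideal I"
  shows "int (graded_betti I i j) = Q.kdim hpiece (ipiece I) i j"
proof -
  define R where "R = (SOME R. graded_free_resolution I R)"
  have R: "graded_free_resolution I R" unfolding R_def
    by (rule someI_ex) (use resolution_exists[OF assms] in blast)
  have sI: "Q.subspace I" using assms by (simp add: homogeneous_ideal_def)
  have "0 \<le> Q.kdim hpiece (ipiece I) i j"
    by (rule Q.kdim_nonneg[OF hpiece_graded ipiece_graded[OF sI]]) (auto simp: ipiece_def)
  then show ?thesis
    using tor_eq_koszul[OF R assms, of i j] by (simp add: graded_betti_def R_def[symmetric] Let_def)
qed

section \<open>Semicontinuity of dimensions\<close>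

subsection \<open>Evaluation of polynomials\<close>

definition mon_eval :: "('v \<Rightarrow> 'k) \<Rightarrow> ('v \<Rightarrow>\<^sub>0 nat) \<Rightarrow> 'k::comm_ring_1" where
  "mon_eval a m = (\<Prod>v\<in>keys m. a v ^ lookup m v)"

lemma mon_eval_superset:
  "finite A \<Longrightarrow> keys m \<subseteq> A \<Longrightarrow> mon_eval a m = (\<Prod>v\<in>A. a v ^ lookup m v)"
  unfolding mon_eval_def by (rule prod.mono_neutral_left) (auto simp: in_keys_iff)

lemma mon_eval_add: "mon_eval a (m + m') = mon_eval a m * mon_eval a m'"
  using mon_eval_superset[of "keys m \<union> keys m'" _ a] keys_add[of m m']
  by (simp add: lookup_add power_add prod.distrib)

lemma poly_eval_superset:
  "finite A \<Longrightarrow> keys p \<subseteq> A \<Longrightarrow> poly_eval a p = (\<Sum>m\<in>A. lookup p m * mon_eval a m)"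
  unfolding poly_eval_def mon_eval_def by (rule sum.mono_neutral_left) (auto simp: in_keys_iff)

lemma poly_eval_add: "poly_eval a (p + q) = poly_eval a p + poly_eval a q"
  using poly_eval_superset[of "keys p \<union> keys q" _ a] keys_add[of p q]
  by (simp add: lookup_add distrib_right sum.distrib)

lemma poly_eval_zero [simp]: "poly_eval a 0 = 0" by (simp add: poly_eval_def)

lemma poly_eval_sum: "poly_eval a (sum f A) = (\<Sum>i\<in>A. poly_eval a (f i))"
  by (induction A rule: infinite_finite_induct) (auto simp: poly_eval_add)

lemma poly_eval_single: "poly_eval a (single m c) = c * mon_eval a m"
  by (cases "c = 0") (auto simp: poly_eval_def mon_eval_def)

lemma poly_eval_mult:
  fixes p q :: "('v, 'k::comm_ring_1) mpoly"
  shows "poly_eval a (p * q) = poly_eval a p * poly_eval a q"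
proof -
  have "poly_eval a (p * q) = poly_eval a ((\<Sum>m\<in>keys p. single m (lookup p m)) *
     (\<Sum>m\<in>keys q. single m (lookup q m)))"
    by (simp only: poly_mapping_sum_single[symmetric])
  also have "\<dots> = (\<Sum>m\<in>keys p. lookup p m * mon_eval a m) *
     (\<Sum>m\<in>keys q. lookup q m * mon_eval a m)"
    unfolding sum_product mult_single poly_eval_sum poly_eval_single mon_eval_add
    by (intro sum.cong refl) (simp add: ac_simps)
  finally show ?thesis by (simp add: poly_eval_def mon_eval_def)
qed

lemma poly_eval_scale_coords:
  assumes "homogeneous d p" shows "poly_eval (\<lambda>s. c * a s) p = c ^ d * poly_eval a p"
proof -
  have "mon_eval (\<lambda>s. c * a s) m = c ^ mon_deg m * mon_eval a m" for m
    by (simp add: mon_eval_def mon_deg_def power_mult_distrib prod.distrib power_sum)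
  then show ?thesis
    using assms by (auto simp: poly_eval_def mon_eval_def[symmetric] homogeneous_def sum_distrib_left ac_simps intro!: sum.cong)
qed

subsection \<open>Homogeneous polynomial functions of the coordinates\<close>

text \<open>Homogeneity is what makes the nonvanishing of such a function a condition on points of
  projective space.\<close>

definition hpoly :: "'s set \<Rightarrow> nat \<Rightarrow> (('s \<Rightarrow> 'k::field) \<Rightarrow> 'k) \<Rightarrow> bool" where
  "hpoly U d f \<longleftrightarrow> (\<exists>g. homogeneous d g \<and> vars g \<subseteq> U \<and> (\<forall>a. f a = poly_eval a g))"

lemma hpoly_zero: "hpoly U d (\<lambda>_. 0)"
  unfolding hpoly_def by (rule exI[of _ 0]) (simp add: vars_def)

lemma hpoly_const: "hpoly U 0 (\<lambda>_. c)"
  unfolding hpoly_def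
  by (rule exI[of _ "single 0 c"])
    (simp add: vars_def poly_eval_single mon_eval_def homogeneous_def)

lemma hpoly_coord: "s \<in> U \<Longrightarrow> hpoly U 1 (\<lambda>a. a s)"
  unfolding hpoly_def
  by (rule exI[of _ "var s"])
    (simp add: vars_def var_def poly_eval_single mon_eval_def homogeneous_def)

lemma hpoly_add: assumes "hpoly U d f" "hpoly U d g" shows "hpoly U d (\<lambda>a. f a + g a)"
proof -
  obtain p q where "homogeneous d p" "vars p \<subseteq> U" "\<And>a. f a = poly_eval a p"
    "homogeneous d q" "vars q \<subseteq> U" "\<And>a. g a = poly_eval a q"
    using assms by (auto simp: hpoly_def)
  moreover have "vars (p + q) \<subseteq> vars p \<union> vars q" using keys_add[of p q] by (auto simp: vars_def)
  ultimately show ?thesis unfolding hpoly_def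
    by (intro exI[of _ "p + q"]) (auto simp: poly_eval_add homogeneous_add)
qed

lemma hpoly_mult: assumes "hpoly U d f" "hpoly U e g" shows "hpoly U (d + e) (\<lambda>a. f a * g a)"
proof -
  obtain p q where pq: "homogeneous d p" "vars p \<subseteq> U" "\<And>a. f a = poly_eval a p"
    "homogeneous e q" "vars q \<subseteq> U" "\<And>a. g a = poly_eval a q"
    using assms by (auto simp: hpoly_def)
  have "vars (p * q) \<subseteq> vars p \<union> vars q"
  proof
    fix v assume "v \<in> vars (p * q)"
    then obtain m where m: "m \<in> keys (p * q)" "v \<in> keys m" by (auto simp: vars_def)
    then obtain x y where xy: "x \<in> keys p" "y \<in> keys q" "m = x + y"
      using keys_mult[of p q] by blast
    then have "v \<in> keys x \<union> keys y" using m(2) keys_add[of x y] by blast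
    then show "v \<in> vars p \<union> vars q" using xy by (auto simp: vars_def)
  qed
  then show ?thesis unfolding hpoly_def using pq
    by (intro exI[of _ "p * q"]) (auto simp: poly_eval_mult homogeneous_mult)
qed

lemma hpoly_cmult: "hpoly U d f \<Longrightarrow> hpoly U d (\<lambda>a. c * f a)"
  using hpoly_mult[OF hpoly_const] by fastforce

lemma hpoly_diff: assumes "hpoly U d f" "hpoly U d g" shows "hpoly U d (\<lambda>a. f a - g a)"
  using hpoly_add[OF assms(1) hpoly_cmult[OF assms(2), of "-1"]] by simp

lemma hpoly_sum: "(\<And>i. i \<in> A \<Longrightarrow> hpoly U d (f i)) \<Longrightarrow> hpoly U d (\<lambda>a. \<Sum>i\<in>A. f i a)"
  by (induction A rule: infinite_finite_induct) (auto intro: hpoly_zero hpoly_add)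

text \<open>A property holds near a point if it holds on a basic open neighbourhood of it in the
  Zariski topology of the projective space.\<close>

definition near :: "'s set \<Rightarrow> ('s \<Rightarrow> 'k::field) \<Rightarrow> (('s \<Rightarrow> 'k) \<Rightarrow> bool) \<Rightarrow> bool" where
  "near U a0 P \<longleftrightarrow> (\<exists>d f. hpoly U d f \<and> f a0 \<noteq> 0 \<and> (\<forall>a. f a \<noteq> 0 \<longrightarrow> P a))"

lemma near_True: "near U a0 (\<lambda>_. True)"
  unfolding near_def using hpoly_const[of U 1] by (intro exI[of _ 0] exI[of _ "\<lambda>_. 1"]) simp

lemma near_conj: assumes "near U a0 P" "near U a0 P'" shows "near U a0 (\<lambda>a. P a \<and> P' a)"
proof -
  obtain d f e g where "hpoly U d f" "f a0 \<noteq> 0" "\<And>a. f a \<noteq> 0 \<Longrightarrow> P a"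
    "hpoly U e g" "g a0 \<noteq> 0" "\<And>a. g a \<noteq> 0 \<Longrightarrow> P' a"
    using assms unfolding near_def by blast
  then show ?thesis unfolding near_def
    by (intro exI[of _ "d + e"] exI[of _ "\<lambda>a. f a * g a"]) (simp add: hpoly_mult)
qed

lemma near_mono: "near U a0 P \<Longrightarrow> (\<And>a. P a \<Longrightarrow> P' a) \<Longrightarrow> near U a0 P'"
  unfolding near_def by blast

lemma near_ball: "finite A \<Longrightarrow> (\<And>i. i \<in> A \<Longrightarrow> near U a0 (P i)) \<Longrightarrow> near U a0 (\<lambda>a. \<forall>i\<in>A. P i a)"
proof (induction A rule: finite_induct)
  case empty then show ?case using near_True by simp
next
  case (insert x A) then show ?case using near_conj[of U a0 "P x" "\<lambda>a. \<forall>i\<in>A. P i a"] by simp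
qed

definition independent_family :: "'i set \<Rightarrow> ('i \<Rightarrow> 'x \<Rightarrow> 'k::field) \<Rightarrow> bool" where
  "independent_family J w \<longleftrightarrow> (\<forall>c. (\<forall>x. (\<Sum>i\<in>J. c i * w i x) = 0) \<longrightarrow> (\<forall>i\<in>J. c i = 0))"

text \<open>Linear independence of vectors with polynomial coordinates is an open condition. One step
  of Gaussian elimination clears a coordinate of all vectors but one and keeps the coordinates
  homogeneous polynomials, because it multiplies by the pivot instead of dividing by it.\<close>

lemma near_independent_family:
  assumes "finite J" "\<And>i. i \<in> J \<Longrightarrow> \<exists>d. \<forall>x. hpoly U d (\<lambda>a. w i a x)" "independent_family J (\<lambda>i. w i a0)"
  shows "near U a0 (\<lambda>a. independent_family J (\<lambda>i. w i a))"
  using assms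
proof (induction J arbitrary: w rule: finite_induct)
  case empty
  then show ?case using near_True by (simp add: independent_family_def)
next
  case (insert i J)
  have "\<exists>x. w i a0 x \<noteq> 0"
  proof (rule ccontr)
    assume "\<not> ?thesis"
    then have "\<forall>x. (\<Sum>j\<in>insert i J. (if j = i then 1 else 0) * w j a0 x) = 0"
      by (auto intro!: sum.neutral)
    from insert.prems(2)[unfolded independent_family_def, rule_format, OF this[rule_format], of i]
    show False by simp
  qed
  then obtain x0 where x0: "w i a0 x0 \<noteq> 0" by blast
  \<comment> \<open>Elimination of the coordinate \<open>x0\<close> with pivot \<open>w i a x0\<close>.\<close>
  define w' where "w' j a x = w i a x0 * w j a x - w j a x0 * w i a x" for j a x
  have lin: "(\<Sum>j\<in>J. c j * w' j a x) = (\<Sum>j\<in>J. c j * w i a x0 * w j a x) - (\<Sum>j\<in>J. c j * w j a x0) * w i a x" for c a x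
    unfolding w'_def right_diff_distrib sum_subtractf sum_distrib_right by (simp only: mult.assoc)
  obtain di where di: "\<And>x. hpoly U di (\<lambda>a. w i a x)" using insert.prems(1)[of i] by blast
  have "\<exists>d. \<forall>x. hpoly U d (\<lambda>a. w' j a x)" if "j \<in> J" for j
  proof -
    obtain dj where dj: "\<And>x. hpoly U dj (\<lambda>a. w j a x)" using insert.prems(1)[of j] \<open>j \<in> J\<close> by blast
    have "hpoly U (di + dj) (\<lambda>a. w' j a x)" for x
      unfolding w'_def using hpoly_diff[OF hpoly_mult[OF di dj]] hpoly_mult[OF dj di] by (simp add: add.commute)
    then show ?thesis by blast
  qed
  moreover have "independent_family J (\<lambda>j. w' j a0)"
    unfolding independent_family_def
  proof (intro allI impI ballI)
    fix c j assume c: "\<forall>x. (\<Sum>j\<in>J. c j * w' j a0 x) = 0" and j: "j \<in> J"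
    \<comment> \<open>A relation between the new vectors is a relation between the old ones.\<close>
    define c' where "c' j = (if j = i then - (\<Sum>j\<in>J. c j * w j a0 x0) else c j * w i a0 x0)" for j
    have "(\<Sum>j\<in>insert i J. c' j * w j a0 x) = 0" for x
    proof -
      have "(\<Sum>j\<in>J. c' j * w j a0 x) = (\<Sum>j\<in>J. c j * w i a0 x0 * w j a0 x)"
        using insert(2) by (intro sum.cong) (auto simp: c'_def)
      then show ?thesis using insert(1,2) c[rule_format, of x] unfolding lin by (simp add: c'_def)
    qed
    then have "c' j = 0" using insert.prems(2) j unfolding independent_family_def by blast
    then show "c j = 0" using j insert(2) x0 by (auto simp: c'_def split: if_splits)
  qed
  ultimately have "near U a0 (\<lambda>a. independent_family J (\<lambda>j. w' j a))"
    by (intro insert.IH) auto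
  moreover have "near U a0 (\<lambda>a. w i a x0 \<noteq> 0)"
    unfolding near_def using di x0 by blast
  ultimately have "near U a0 (\<lambda>a. independent_family J (\<lambda>j. w' j a) \<and> w i a x0 \<noteq> 0)" by (rule near_conj)
  then show ?case
  proof (rule near_mono)
    fix a assume a: "independent_family J (\<lambda>j. w' j a) \<and> w i a x0 \<noteq> 0"
    show "independent_family (insert i J) (\<lambda>i. w i a)"
      unfolding independent_family_def
    proof (intro allI impI)
      fix c assume "\<forall>x. (\<Sum>j\<in>insert i J. c j * w j a x) = 0"
      then have c: "c i * w i a x + (\<Sum>j\<in>J. c j * w j a x) = 0" for x using insert(1,2) by simp
      have "(\<Sum>j\<in>J. c j * w' j a x) = 0" for x
      proof -
        have "(\<Sum>j\<in>J. c j * w i a x0 * w j a x) = w i a x0 * (\<Sum>j\<in>J. c j * w j a x)"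
          by (simp add: sum_distrib_left ac_simps)
        moreover have "(\<Sum>j\<in>J. c j * w j a y) = - (c i * w i a y)" for y
          using c[of y] by (simp add: eq_neg_iff_add_eq_0 add.commute)
        ultimately show ?thesis unfolding lin by simp
      qed
      then have cJ: "\<forall>j\<in>J. c j = 0" using a unfolding independent_family_def by blast
      then have "c i * w i a x0 = 0" using c[of x0] by (simp add: sum.neutral)
      then show "\<forall>j\<in>insert i J. c j = 0" using cJ a by simp
    qed
  qed
qed

lemma chain_lookup_lin:
  "lookup ((\<Sum>i\<in>J. Q.csc (c i) (w i)) S) m = (\<Sum>i\<in>J. c i * lookup (w i S) m)"
  by (simp add: sum_fun_apply lookup_sum Q.csc_def Q.sc_def)

text \<open>Vectors that form a basis of the span at \<open>a0\<close> remain independent near \<open>a0\<close>.\<close>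

lemma near_dim_span:
  fixes w :: "'i \<Rightarrow> ('s \<Rightarrow> 'k::field) \<Rightarrow> ('v::{finite,linorder} set \<Rightarrow> ('v, 'k) mpoly)"
  assumes J: "finite J" and w: "\<And>i. i \<in> J \<Longrightarrow> \<exists>d. \<forall>S m. hpoly U d (\<lambda>a. lookup (w i a S) m)"
  shows "near U a0 (\<lambda>a. Q.C.vs.dim (Q.C.vs.span ((\<lambda>i. w i a0) ` J)) \<le> Q.C.vs.dim (Q.C.vs.span ((\<lambda>i. w i a) ` J)))"
proof -
  let ?f = "\<lambda>a i (S, m). lookup (w i a S) m"
  obtain B where B: "B \<subseteq> (\<lambda>i. w i a0) ` J" "Q.C.vs.independent B"
    "(\<lambda>i. w i a0) ` J \<subseteq> Q.C.vs.span B" "card B = Q.C.vs.dim ((\<lambda>i. w i a0) ` J)"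
    using Q.C.vs.basis_exists by metis
  obtain J' where J': "J' \<subseteq> J" "inj_on (\<lambda>i. w i a0) J'" "B = (\<lambda>i. w i a0) ` J'"
    using B(1) unfolding subset_image_inj by blast
  have fJ': "finite J'" using J' J finite_subset by blast
  have "independent_family J' (?f a0)"
    unfolding independent_family_def
  proof (intro allI impI ballI)
    fix c i assume c: "\<forall>x. (\<Sum>i\<in>J'. c i * ?f a0 i x) = 0" and i: "i \<in> J'"
    have "(\<Sum>i\<in>J'. Q.csc (c i) (w i a0)) = 0"
    proof (intro ext poly_mapping_eqI)
      fix S m show "lookup ((\<Sum>i\<in>J'. Q.csc (c i) (w i a0)) S) m = lookup (0 S) m"
        unfolding chain_lookup_lin using c[rule_format, of "(S, m)"] by simp
    qed
    moreover have "(\<Sum>i\<in>J'. Q.csc (c i) (w i a0)) = (\<Sum>b\<in>B. Q.csc (c (the_inv_into J' (\<lambda>i. w i a0) b)) b)"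
      unfolding J'(3) using J'(2) by (subst sum.reindex) (auto simp: the_inv_into_f_f[OF J'(2)] intro!: sum.cong)
    ultimately have "c (the_inv_into J' (\<lambda>i. w i a0) (w i a0)) = 0"
      using Q.C.vs.independentD[OF B(2) _ subset_refl, of "\<lambda>b. c (the_inv_into J' (\<lambda>i. w i a0) b)" "w i a0"] J' fJ' i
      by simp
    then show "c i = 0" using i by (simp add: the_inv_into_f_f[OF J'(2)])
  qed
  moreover have "\<exists>d. \<forall>x. hpoly U d (\<lambda>a. ?f a i x)" if "i \<in> J'" for i
    using w[of i] that J' by fastforce
  ultimately have "near U a0 (\<lambda>a. independent_family J' (?f a))"
    by (intro near_independent_family[OF fJ', where w = "\<lambda>i a. ?f a i"])
  then show ?thesis
  proof (rule near_mono)
    fix a assume a: "independent_family J' (?f a)"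
    have rel: "\<forall>i\<in>J'. c i = 0" if "(\<Sum>i\<in>J'. Q.csc (c i) (w i a)) = 0" for c
    proof -
      have "(\<Sum>i\<in>J'. c i * ?f a i x) = 0" for x
        using chain_lookup_lin[of c "\<lambda>i. w i a" J' "fst x" "snd x"] that by (simp add: case_prod_beta)
      then show ?thesis using a unfolding independent_family_def by blast
    qed
    have inj: "inj_on (\<lambda>i. w i a) J'"
    proof (rule inj_onI, rule ccontr)
      fix i k assume ik: "i \<in> J'" "k \<in> J'" "w i a = w k a" "i \<noteq> k"
      let ?c = "\<lambda>l. if l = i then 1 else if l = k then -1 else 0 :: 'k"
      have "(\<Sum>l\<in>J'. Q.csc (?c l) (w l a)) = (\<Sum>l\<in>{i, k}. Q.csc (?c l) (w l a))"
        using ik fJ' by (intro sum.mono_neutral_right) auto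
      also have "\<dots> = 0" using ik by simp
      finally show False using rel[of ?c] ik by auto
    qed
    have "Q.C.vs.independent ((\<lambda>i. w i a) ` J')"
    proof (rule Q.C.vs.independent_if_scalars_zero)
      fix r x assume "(\<Sum>x\<in>(\<lambda>i. w i a) ` J'. Q.csc (r x) x) = 0" "x \<in> (\<lambda>i. w i a) ` J'"
      then show "r x = 0" using rel[of "\<lambda>i. r (w i a)"] inj by (auto simp: sum.reindex)
    qed (use fJ' in simp)
    then have "card ((\<lambda>i. w i a) ` J') \<le> Q.C.vs.dim (Q.C.vs.span ((\<lambda>i. w i a) ` J))"
      using J' J by (intro Q.C.card_independent_le_dim Q.C.fd_span) (auto intro: Q.C.vs.span_base)
    moreover have "card ((\<lambda>i. w i a) ` J') = card B" unfolding J'(3) using inj J'(2) by (simp add: card_image)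
    ultimately show "Q.C.vs.dim (Q.C.vs.span ((\<lambda>i. w i a0) ` J)) \<le> Q.C.vs.dim (Q.C.vs.span ((\<lambda>i. w i a) ` J))"
      using B(4) by simp
  qed
qed

subsection \<open>Ideals with varying generators\<close>

lemma homogeneous_xpow_times: "homogeneous e p \<Longrightarrow> homogeneous (mon_deg m + e) (xpow m * p)"
  by (rule homogeneous_mult) simp

lemma hcomp_single_times:
  fixes p :: "('v, 'k::comm_ring_1) mpoly"
  shows "hcomp (e + mon_deg m) (single m c * p) = single m c * hcomp e p"
    "e < mon_deg m \<Longrightarrow> hcomp e (single m c * p) = 0"
proof -
  have d: "y \<in> hpiece d \<Longrightarrow> single m c * y \<in> hpiece (d + mon_deg m)" for d and y :: "('v, 'k) mpoly"
    using homogeneous_mult[OF homogeneous_single, of d y m c] by (simp add: add.commute)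
  show "hcomp (e + mon_deg m) (single m c * p) = single m c * hcomp e p"
    by (rule grading_map(1)[OF grading_hcomp grading_hcomp, of "\<lambda>p. single m c * p", OF distrib_left d]) auto
  show "e < mon_deg m \<Longrightarrow> hcomp e (single m c * p) = 0"
    by (rule grading_map(2)[OF grading_hcomp grading_hcomp, of "\<lambda>p. single m c * p", OF distrib_left d]) auto
qed

text \<open>The polynomials whose components are combinations of monomial multiples of the generators
  form an ideal that contains the generators.\<close>

lemma ipiece_span:
  fixes g :: "'i \<Rightarrow> ('v::{finite,linorder}, 'k::field) mpoly"
  assumes g: "\<And>k. k \<in> K \<Longrightarrow> homogeneous (dg k) (g k)"
  shows "ipiece (ideal_gen (g ` K)) e = Q.V.vs.span {xpow m * g k | m k. k \<in> K \<and> mon_deg m + dg k = e}"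
proof
  define G where "G e = {xpow m * g k | m k. k \<in> K \<and> mon_deg m + dg k = e}" for e
  have "Q.V.vs.span (G e) \<subseteq> ipiece (ideal_gen (g ` K)) e"
  proof (rule Q.V.vs.span_minimal)
    show "G e \<subseteq> ipiece (ideal_gen (g ` K)) e"
      using homogeneous_xpow_times[OF g]
      by (auto simp: G_def ipiece_def ideal_gen_def intro: Q.span_scale Q.span_base)
    show "Q.V.vs.subspace (ipiece (ideal_gen (g ` K)) e)"
      by (rule ipiece_subspace) (simp add: ideal_gen_def Q.subspace_span)
  qed
  then show "Q.V.vs.span {xpow m * g k | m k. k \<in> K \<and> mon_deg m + dg k = e} \<subseteq> ipiece (ideal_gen (g ` K)) e"
    by (simp add: G_def)
  define W where "W = {p. \<forall>e. hcomp e p \<in> Q.V.vs.span (G e)}"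
  \<comment> \<open>\<open>W\<close> is closed under multiplication by monomials, hence by all polynomials.\<close>
  have mono: "xpow m * p \<in> Q.V.vs.span (G (e + mon_deg m))" if "p \<in> Q.V.vs.span (G e)" for m p e
    using that
  proof (induction rule: Q.V.vs.span_induct_alt)
    case base then show ?case by (simp add: Q.V.vs.span_zero)
  next
    case (step c x y)
    then obtain m' k where x: "x = xpow m' * g k" "k \<in> K" "mon_deg m' + dg k = e" by (auto simp: G_def)
    have "xpow m * x = xpow (m + m') * g k" by (simp add: x mult.assoc[symmetric] mult_single)
    then have "xpow m * x \<in> G (e + mon_deg m)" using x unfolding G_def by (auto simp: ac_simps intro!: exI[of _ "m + m'"])
    moreover have "xpow m * (Q.sc c x + y) = Q.sc c (xpow m * x) + xpow m * y"
      by (simp add: Q.sc_def distrib_left ac_simps)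
    ultimately show ?case using step by (auto intro: Q.V.vs.span_add Q.V.vs.span_scale Q.V.vs.span_base)
  qed
  have single: "single m c * p \<in> W" if p: "p \<in> W" for m c p
    unfolding W_def
  proof (intro CollectI allI)
    fix e show "hcomp e (single m c * p) \<in> Q.V.vs.span (G e)"
    proof (cases "e < mon_deg m")
      case True then show ?thesis by (simp add: hcomp_single_times Q.V.vs.span_zero)
    next
      case False
      then have e: "e = (e - mon_deg m) + mon_deg m" by simp
      have "single m c * hcomp (e - mon_deg m) p = Q.sc c (xpow m * hcomp (e - mon_deg m) p)"
        by (simp add: Q.sc_def mult.assoc[symmetric] mult_single)
      then show ?thesis using mono[of "hcomp (e - mon_deg m) p" "e - mon_deg m" m] p
        by (subst e, subst hcomp_single_times(1)) (use False in \<open>simp add: W_def Q.V.vs.span_scale\<close>)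
    qed
  qed
  have "Q.subspace W"
  proof (rule Q.subspaceI)
    show z: "0 \<in> W" by (simp add: W_def hcomp_def Q.V.vs.span_zero)
    show add: "x + y \<in> W" if "x \<in> W" "y \<in> W" for x y
      using that by (simp add: W_def grading_add[OF grading_hcomp] Q.V.vs.span_add)
    show "r * x \<in> W" if x: "x \<in> W" for r x
    proof -
      have "(\<Sum>m\<in>A. single m (lookup r m) * x) \<in> W" if "finite A" for A
        using that by (induction A rule: finite_induct) (simp_all add: z add single[OF x])
      from this[of "keys r"]
      show ?thesis unfolding sum_distrib_right[symmetric] poly_mapping_sum_single[of r, symmetric] by simp
    qed
  qed
  moreover have "g ` K \<subseteq> W"
  proof
    fix x assume "x \<in> g ` K"
    then obtain k where k: "k \<in> K" "x = g k" by blast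
    have "hcomp e x \<in> Q.V.vs.span (G e)" for e
    proof (cases "e = dg k")
      case True
      have "xpow 0 * g k \<in> G (dg k)" using k(1) unfolding G_def by (force intro: exI[of _ 0])
      moreover have "hcomp e x = xpow 0 * g k" using grading_id[OF grading_hcomp, of x e] g[OF k(1)] k True by simp
      ultimately show ?thesis using True by (simp add: Q.V.vs.span_base)
    next
      case False
      then have "hcomp e x = 0" using grading_hcomp[where 'v = 'v and 'k = 'k] g[OF k(1)] k unfolding grading_def
        by (metis (mono_tags, lifting) mem_Collect_eq)
      then show ?thesis by (simp add: Q.V.vs.span_zero)
    qed
    then show "x \<in> W" by (simp add: W_def)
  qed
  ultimately have "ideal_gen (g ` K) \<subseteq> W"
    unfolding ideal_gen_def by (rule Q.span_minimal[rotated])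
  have "ipiece (ideal_gen (g ` K)) e \<subseteq> Q.V.vs.span (G e)"
  proof
    fix x assume "x \<in> ipiece (ideal_gen (g ` K)) e"
    then have "x \<in> W" "hcomp e x = x"
      using \<open>ideal_gen (g ` K) \<subseteq> W\<close> grading_id[OF grading_hcomp, of x e] by (auto simp: ipiece_def)
    moreover from this(1) have "hcomp e x \<in> Q.V.vs.span (G e)" unfolding W_def by blast
    ultimately show "x \<in> Q.V.vs.span (G e)" by simp
  qed
  then show "ipiece (ideal_gen (g ` K)) e \<subseteq> Q.V.vs.span {xpow m * g k | m k. k \<in> K \<and> mon_deg m + dg k = e}"
    by (simp add: G_def)
qed

lemma ideal_gen_subspace: "Q.subspace (ideal_gen G)"
  by (simp add: ideal_gen_def Q.subspace_span)

lemma chains_ideal_span: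
  fixes g :: "'i \<Rightarrow> ('v::{finite,linorder}, 'k::field) mpoly"
  assumes g: "\<And>k. k \<in> K \<Longrightarrow> homogeneous (dg k) (g k)"
  shows "Q.chains (ipiece (ideal_gen (g ` K))) q j =
    Q.C.vs.span {Q.place S (xpow m * g k) | S m k. k \<in> K \<and> card S = q \<and> q \<le> j \<and> mon_deg m + dg k = j - q}"
proof (cases "q \<le> j")
  case True
  let ?G = "{xpow m * g k | m k. k \<in> K \<and> mon_deg m + dg k = j - q}"
  have "Q.chains (ipiece (ideal_gen (g ` K))) q j = Q.C.vs.span {Q.place S x | S x. card S = q \<and> x \<in> ?G}"
    by (rule Q.chains_span[OF ipiece_graded[OF ideal_gen_subspace] True ipiece_span]) (rule g)
  also have "{Q.place S x | S x. card S = q \<and> x \<in> ?G} =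
    {Q.place S (xpow m * g k) | S m k. k \<in> K \<and> card S = q \<and> q \<le> j \<and> mon_deg m + dg k = j - q}"
    using True by blast
  finally show ?thesis .
next
  case False
  then have e: "{Q.place S (xpow m * g k) | S m k. k \<in> K \<and> card S = q \<and> q \<le> j \<and> mon_deg m + dg k = j - q} = {}" by auto
  show ?thesis unfolding e using False by (simp add: Q.chains_gt)
qed

text \<open>Indices of a family that spans the boundaries of \<open>L / N\<close>: the monomial multiples of the
  generators of \<open>L\<close> yield boundaries of chains of \<open>L\<close> (\<open>b\<close> true), those of the generators of \<open>N\<close>
  yield chains of \<open>N\<close> (\<open>b\<close> false).\<close>

definition bindex where
  "bindex KL KN dg q j = {(b :: bool, S :: 'v::{finite,linorder} set, m :: 'v \<Rightarrow>\<^sub>0 nat, k :: 'i).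
     if b then k \<in> KL \<and> card S = Suc q \<and> Suc q \<le> j \<and> mon_deg m + dg k = j - Suc q
     else k \<in> KN \<and> card S = q \<and> q \<le> j \<and> mon_deg m + dg k = j - q}"

definition bvec where
  "bvec g x = (case x of (b, S, m, k) \<Rightarrow> if b then Q.kd (Q.place S (xpow m * g k)) else Q.place S (xpow m * g k))"

lemma kboundaries_ideal_span:
  fixes g :: "'i \<Rightarrow> ('v::{finite,linorder}, 'k::field) mpoly"
  assumes g: "\<And>k. k \<in> KL \<union> KN \<Longrightarrow> homogeneous (dg k) (g k)"
  shows "Q.kboundaries (ipiece (ideal_gen (g ` KL))) (ipiece (ideal_gen (g ` KN))) q j = 
    Q.C.vs.span (bvec g ` bindex KL KN dg q j)"
proof -
  let ?A = "{Q.place S (xpow m * g k) | S m k. k \<in> KL \<and> card S = Suc q \<and> Suc q \<le> j \<and> mon_deg m + dg k = j - Suc q}"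
  let ?B = "{Q.place S (xpow m * g k) | S m k. k \<in> KN \<and> card S = q \<and> q \<le> j \<and> mon_deg m + dg k = j - q}"
  have "Q.kd ` Q.C.vs.span ?A = Q.C.vs.span (Q.kd ` ?A)"
    using module_hom.span_image[of Q.csc Q.csc Q.kd ?A] Q.linear_kd[where 'v = 'v and 'k = 'k] by (simp add: linear_iff_module_hom)
  then have "Q.kboundaries (ipiece (ideal_gen (g ` KL))) (ipiece (ideal_gen (g ` KN))) q j = Q.C.vs.span (Q.kd ` ?A \<union> ?B)"
    unfolding Q.kboundaries_def using g
    by (subst (1 2) chains_ideal_span[where dg = dg]) (auto simp: Q.C.sumset_span)
  also have "Q.kd ` ?A \<union> ?B = bvec g ` bindex KL KN dg q j"
  proof (intro equalityI subsetI)
    fix x assume "x \<in> Q.kd ` ?A \<union> ?B"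
    then show "x \<in> bvec g ` bindex KL KN dg q j"
    proof
      assume "x \<in> Q.kd ` ?A"
      then obtain S m k where "x = Q.kd (Q.place S (xpow m * g k))" "k \<in> KL" "card S = Suc q" "Suc q \<le> j" "mon_deg m + dg k = j - Suc q"
        by blast
      then show ?thesis by (intro image_eqI[of _ _ "(True, S, m, k)"]) (auto simp: bvec_def bindex_def)
    next
      assume "x \<in> ?B"
      then obtain S m k where "x = Q.place S (xpow m * g k)" "k \<in> KN" "card S = q" "q \<le> j" "mon_deg m + dg k = j - q"
        by blast
      then show ?thesis by (intro image_eqI[of _ _ "(False, S, m, k)"]) (auto simp: bvec_def bindex_def)
    qed
  next
    fix x assume "x \<in> bvec g ` bindex KL KN dg q j"
    then obtain b S m k where y: "(b, S, m, k) \<in> bindex KL KN dg q j" "x = bvec g (b, S, m, k)" by auto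
    show "x \<in> Q.kd ` ?A \<union> ?B"
    proof (cases b)
      case True
      then have "Q.place S (xpow m * g k) \<in> ?A" using y(1) by (auto simp: bindex_def)
      then show ?thesis using True y(2) by (simp add: bvec_def)
    next
      case False
      then have "Q.place S (xpow m * g k) \<in> ?B" using y(1) by (auto simp: bindex_def)
      then show ?thesis using False y(2) by (simp add: bvec_def)
    qed
  qed
  finally show ?thesis .
qed

lemma finite_bindex:
  assumes "finite KL" "finite KN"
  shows "finite (bindex KL KN dg q j :: (bool \<times> 'v::{finite,linorder} set \<times> ('v \<Rightarrow>\<^sub>0 nat) \<times> 'i) set)"
proof -
  have fm: "finite (\<Union>e\<in>{..j}. {m :: 'v \<Rightarrow>\<^sub>0 nat. mon_deg m = e})"
    by (intro finite_UN_I finite_mon_deg) simp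
  have "finite ((UNIV :: bool set) \<times> (UNIV :: 'v set set) \<times> (\<Union>e\<in>{..j}. {m :: 'v \<Rightarrow>\<^sub>0 nat. mon_deg m = e}) \<times> (KL \<union> KN))"
    using assms by (intro finite_cartesian_product fm) auto
  then show ?thesis by (rule finite_subset[rotated]) (auto simp: bindex_def split: if_splits)
qed

text \<open>The additional generator \<open>1\<close> makes \<open>Q\<close> itself one of the ideals generated by members of
  the family.\<close>

definition gen :: "('n, 'k) coeffs \<Rightarrow> nat \<Rightarrow> ('n::{finite,linorder}, 'k::field) mpoly" where
  "gen a k = (if k = 0 then 1 else quadric a k)"

abbreviation gdeg :: "nat \<Rightarrow> nat" where "gdeg k \<equiv> (if k = 0 then 0 else 2)"

lemma lookup_quadric: "lookup (quadric a k) m =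
   (\<Sum>(i, j)\<in>{(i, j). i \<le> j}. lookup (var i * var j) m * a (k, i, j))"
  by (simp add: quadric_def lookup_sum case_prod_beta mult.commute)

lemma homogeneous_quadric: "homogeneous 2 (quadric a k :: ('n::{finite,linorder}, 'k::field) mpoly)"
  unfolding quadric_def
proof (rule homogeneous_sum, clarify)
  fix i j :: 'n
  have "homogeneous (1 + 1) (var i * var j :: ('n, 'k) mpoly)" by (rule homogeneous_mult[OF homogeneous_var homogeneous_var])
  then show "homogeneous 2 (pm_scale (a (k, i, j)) (var i * var j) :: ('n, 'k) mpoly)"
    by (simp add: homogeneous_lookup)
qed

lemma homogeneous_gen: "homogeneous (gdeg k) (gen a k)"
  by (simp add: gen_def homogeneous_quadric) (simp add: homogeneous_def)

lemma hpoly_gen: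
  assumes "k \<le> CARD('n) + 1"
  shows "hpoly Upsilon (if k = 0 then 0 else 1) (\<lambda>a. lookup (gen a k :: ('n::{finite,linorder}, 'k::field) mpoly) m)"
proof (cases "k = 0")
  case True
  then show ?thesis using hpoly_const by (simp add: gen_def)
next
  case False
  have "hpoly Upsilon 1 (\<lambda>a. \<Sum>ij\<in>{(i, j). i \<le> j}. (case ij of (i, j) \<Rightarrow> lookup (var i * var j :: ('n, 'k) mpoly) m * a (k, i, j)))"
  proof (rule hpoly_sum, clarify)
    fix i j :: 'n assume "i \<le> j"
    then have "(k, i, j) \<in> Upsilon" using False assms by (simp add: Upsilon_def)
    from hpoly_cmult[OF hpoly_coord[OF this]]
    show "hpoly Upsilon 1 (\<lambda>a. lookup (var i * var j :: ('n, 'k) mpoly) m * a (k, i, j))" .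
  qed
  then show ?thesis using False by (simp add: gen_def lookup_quadric)
qed

lemma hpoly_xpow_times:
  assumes "\<And>m. hpoly U d (\<lambda>a. lookup (p a) m)"
  shows "hpoly U d (\<lambda>a. lookup (xpow m0 * p a) m)"
proof (cases "\<exists>m'. m = m0 + m'")
  case True
  then obtain m' where "m = m0 + m'" by blast
  then show ?thesis using assms[of m'] by (simp add: lookup_single_times)
next
  case False
  then show ?thesis using hpoly_zero by (simp add: lookup_single_times_0)
qed

lemma hpoly_place:
  assumes "\<And>m. hpoly U d (\<lambda>a. lookup (p a) m)"
  shows "hpoly U d (\<lambda>a. lookup (Q.place S (p a) T) m)"
  using assms hpoly_zero by (cases "T = S") (auto simp: Q.place_def)

lemma hpoly_kd:
  assumes "\<And>S m. hpoly U d (\<lambda>a. lookup (c a S) m)"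
  shows "hpoly U d (\<lambda>a. lookup (Q.kd (c a) T) m)"
  unfolding lookup_kd
proof (rule hpoly_sum)
  fix v assume "v \<in> - T"
  show "hpoly U d (\<lambda>a. ksgn v T * (if v \<in> keys m then lookup (c a (insert v T)) (m - X v) else 0))"
    using hpoly_cmult[OF assms] hpoly_zero by (cases "v \<in> keys m") auto
qed

abbreviation gpiece :: "('n, 'k) coeffs \<Rightarrow> nat set \<Rightarrow> nat \<Rightarrow> ('n::{finite,linorder}, 'k::field) mpoly set" where
  "gpiece a K \<equiv> ipiece (ideal_gen (gen a ` K))"

lemma gpiece_graded: "Q.graded_family (gpiece a K)"
  by (rule ipiece_graded[OF ideal_gen_subspace])

text \<open>The coordinates of the spanning vectors are constant or linear in the coefficients of the
  quadrics.\<close>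

lemma near_kboundaries:
  fixes a0 :: "('n::{finite,linorder}, 'k::field) coeffs"
  assumes "KL \<subseteq> {..CARD('n) + 1}" "KN \<subseteq> {..CARD('n) + 1}"
  shows "near Upsilon a0 (\<lambda>a. Q.C.vs.dim (Q.kboundaries (gpiece a0 KL) (gpiece a0 KN) q j)
     \<le> Q.C.vs.dim (Q.kboundaries (gpiece a KL) (gpiece a KN) q j))"
proof -
  have eq: "Q.kboundaries (gpiece a KL) (gpiece a KN) q j = Q.C.vs.span ((\<lambda>x. bvec (gen a) x) ` bindex KL KN gdeg q j)"
    for a :: "('n, 'k) coeffs"
    by (rule kboundaries_ideal_span) (rule homogeneous_gen)
  show ?thesis
    unfolding eq
  proof (rule near_dim_span)
    show "finite (bindex KL KN gdeg q j)"
      using assms by (intro finite_bindex) (auto intro: finite_subset)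
    fix x :: "bool \<times> 'n set \<times> ('n \<Rightarrow>\<^sub>0 nat) \<times> nat" assume x: "x \<in> bindex KL KN gdeg q j"
    obtain b S m k where x': "x = (b, S, m, k)" by (cases x)
    then have "k \<in> KL \<union> KN" using x by (auto simp: bindex_def split: if_splits)
    then have k: "k \<le> CARD('n) + 1" using assms by auto
    let ?d = "if k = 0 then 0 else 1 :: nat"
    have pl: "hpoly Upsilon ?d (\<lambda>a. lookup (Q.place S (xpow m * gen a k :: ('n, 'k) mpoly) T) m')" for T m'
      by (rule hpoly_place[OF hpoly_xpow_times[OF hpoly_gen[OF k]]])
    show "\<exists>d. \<forall>T m'. hpoly Upsilon d (\<lambda>a. lookup (bvec (gen a :: nat \<Rightarrow> ('n, 'k) mpoly) x T) m')"
    proof (cases b)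
      case True
      then show ?thesis using hpoly_kd[OF pl] by (intro exI[of _ ?d]) (simp add: bvec_def x')
    next
      case False
      then show ?thesis using pl by (intro exI[of _ ?d]) (simp add: bvec_def x')
    qed
  qed
qed

text \<open>The chains of homological degree \<open>0\<close> of an ideal \<open>N\<close> are the boundaries for \<open>L = 0\<close>.\<close>

lemma near_gpiece:
  fixes a0 :: "('n::{finite,linorder}, 'k::field) coeffs"
  assumes K: "K \<subseteq> {..CARD('n) + 1}"
  shows "near Upsilon a0 (\<lambda>a. Q.V.vs.dim (gpiece a0 K e) \<le> Q.V.vs.dim (gpiece a K e))"
proof -
  have z: "gpiece a {} = (\<lambda>_. {0})" for a :: "('n, 'k) coeffs"
    by (rule ext) (auto simp: ipiece_def ideal_gen_def)
  have "Q.kboundaries (\<lambda>_. {0}) (gpiece a K) 0 e = Q.chains (gpiece a K) 0 e" for a :: "('n, 'k) coeffs"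
    by (simp add: Q.kboundaries_def Q.chains_trivial Q.C.sumset_def)
  moreover have "Q.C.vs.dim (Q.chains (gpiece a K) 0 e) = Q.V.vs.dim (gpiece a K e)" for a :: "('n, 'k) coeffs"
  proof -
    have "{S :: 'n set. card S = 0} = {{}}" by auto
    then show ?thesis using Q.dim_chains[OF gpiece_graded, of a K 0 e] by simp
  qed
  ultimately show ?thesis using near_kboundaries[of "{}" K a0 0 e] K unfolding z by simp
qed

section \<open>Hilbert functions and regular sequences\<close>

lemma ideal_gen_mono:
  fixes G :: "('v::{finite,linorder}, 'k::field) mpoly set"
  shows "G \<subseteq> G' \<Longrightarrow> ideal_gen G \<subseteq> ideal_gen G'"
  unfolding ideal_gen_def by (rule Q.span_mono)

lemma in_ideal_gen_insert:
  fixes G :: "('v::{finite,linorder}, 'k::field) mpoly set"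
  shows "p \<in> ideal_gen (insert f G) \<longleftrightarrow> (\<exists>r. p - r * f \<in> ideal_gen G)"
  unfolding ideal_gen_def Q.span_insert by simp

context
  fixes f :: "('v::{finite,linorder}, 'k::field) mpoly" and d
  assumes f: "homogeneous d f"
begin

lemma hcomp_times: "hcomp (e + d) (p * f) = hcomp e p * f" "e < d \<Longrightarrow> hcomp e (p * f) = 0"
proof -
  have dd: "y \<in> hpiece d' \<Longrightarrow> y * f \<in> hpiece (d' + d)" for d' and y :: "('v, 'k) mpoly"
    using homogeneous_mult[OF _ f, of d' y] by simp
  show "hcomp (e + d) (p * f) = hcomp e p * f"
    by (rule grading_map(1)[OF grading_hcomp grading_hcomp, of "\<lambda>p. p * f", OF distrib_right dd]) auto
  show "e < d \<Longrightarrow> hcomp e (p * f) = 0"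
    by (rule grading_map(2)[OF grading_hcomp grading_hcomp, of "\<lambda>p. p * f", OF distrib_right dd]) auto
qed

lemma hcomp_diff: "hcomp e (p - q) = hcomp e p - hcomp e q"
  using grading_add[OF grading_hcomp, of e "p - q" q] by (simp add: algebra_simps)

lemma ideal_insert_piece:
  assumes J: "homogeneous_ideal (ideal_gen G)"
  shows "Q.V.sumset ((\<lambda>p. p * f) ` hpiece e) (ipiece (ideal_gen G) (e + d)) = ipiece (ideal_gen (insert f G)) (e + d)"
proof (intro equalityI subsetI)
  fix p assume "p \<in> Q.V.sumset ((\<lambda>p. p * f) ` hpiece e) (ipiece (ideal_gen G) (e + d))"
  then obtain r g where rg: "homogeneous e r" "g \<in> ideal_gen G" "homogeneous (e + d) g" "p = r * f + g"
    by (auto simp: Q.V.sumset_def ipiece_def)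
  have "homogeneous (e + d) p" unfolding rg(4) by (intro homogeneous_add homogeneous_mult[OF rg(1) f] rg(3))
  moreover have "p \<in> ideal_gen (insert f G)" unfolding in_ideal_gen_insert using rg by (intro exI[of _ r]) simp
  ultimately show "p \<in> ipiece (ideal_gen (insert f G)) (e + d)" by (simp add: ipiece_def)
next
  fix p assume "p \<in> ipiece (ideal_gen (insert f G)) (e + d)"
  then obtain r where r: "p - r * f \<in> ideal_gen G" "homogeneous (e + d) p"
    by (auto simp: ipiece_def in_ideal_gen_insert)
  have "hcomp (e + d) (p - r * f) = p - hcomp e r * f"
    using grading_id[OF grading_hcomp, of p "e + d"] r(2) by (simp add: hcomp_diff hcomp_times)
  moreover have "hcomp (e + d) (p - r * f) \<in> ipiece (ideal_gen G) (e + d)"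
    using J r(1) homogeneous_hcomp by (auto simp: homogeneous_ideal_def ipiece_def)
  ultimately have "p - hcomp e r * f \<in> ipiece (ideal_gen G) (e + d)" by simp
  then show "p \<in> Q.V.sumset ((\<lambda>p. p * f) ` hpiece e) (ipiece (ideal_gen G) (e + d))"
    unfolding Q.V.sumset_def using homogeneous_hcomp[of e r] by force
qed

lemma ideal_insert_low:
  assumes J: "homogeneous_ideal (ideal_gen G)" and e: "e < d"
  shows "ipiece (ideal_gen (insert f G)) e = ipiece (ideal_gen G) e"
proof (intro equalityI subsetI)
  fix p assume "p \<in> ipiece (ideal_gen (insert f G)) e"
  then obtain r where r: "p - r * f \<in> ideal_gen G" "homogeneous e p"
    by (auto simp: ipiece_def in_ideal_gen_insert)
  have "hcomp e (p - r * f) = p"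
    using grading_id[OF grading_hcomp, of p e] r(2) hcomp_times(2)[OF e] by (simp add: hcomp_diff)
  moreover have "hcomp e (p - r * f) \<in> ideal_gen G" using J r(1) by (simp add: homogeneous_ideal_def)
  ultimately show "p \<in> ipiece (ideal_gen G) e" using r(2) by (simp add: ipiece_def)
qed (use ideal_gen_mono[of G "insert f G"] in \<open>auto simp: ipiece_def\<close>)

lemma times_hom: "module_hom (*) (*) (\<lambda>p. p * f)"
  unfolding module_hom_def module_hom_axioms_def using module_ring_mult
  by (auto simp: distrib_right mult.assoc)

lemma colon_piece_iff: "homogeneous e p \<Longrightarrow> p * f \<in> ipiece J (e + d) \<longleftrightarrow> p \<in> ipiece (colon J f) e"
  using homogeneous_mult[OF _ f, of e p] by (auto simp: ipiece_def colon_def)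

text \<open>The dimension count in one degree for the exact sequence \<open>0 \<rightarrow> (J : f) / J \<rightarrow> Q / J \<rightarrow> Q / J
  \<rightarrow> Q / (J + f) \<rightarrow> 0\<close>, where \<open>J\<close> is generated by \<open>G\<close>.\<close>

lemma dim_insert_colon:
  assumes J: "homogeneous_ideal (ideal_gen G)"
  shows "Q.V.vs.dim (ipiece (colon (ideal_gen G) f) e) + Q.V.vs.dim (ipiece (ideal_gen (insert f G)) (e + d))
    = Q.V.vs.dim (hpiece e :: ('v, 'k) mpoly set) + Q.V.vs.dim (ipiece (ideal_gen G) (e + d))"
proof -
  have vp: "vspace_pair (Q.sc :: 'k \<Rightarrow> ('v, 'k) mpoly \<Rightarrow> _) Q.sc"
    by (simp add: vspace_pair_def Q.V.vspace_axioms)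
  have lin: "Vector_Spaces.linear Q.sc Q.sc (\<lambda>p. p * f)"
    by unfold_locales (auto simp: Q.sc_def distrib_right mult.assoc)
  have "{p \<in> hpiece e. p * f \<in> ipiece (ideal_gen G) (e + d)} = ipiece (colon (ideal_gen G) f) e"
    using colon_piece_iff by (auto simp: ipiece_def)
  then show ?thesis
    using vspace_pair.rank_nullity_modulo[OF vp lin hpiece_fd, of "ipiece (ideal_gen G) (e + d)" e]
      ipiece_graded[OF ideal_gen_subspace, of G] ideal_insert_piece[OF J, of e]
    by (simp add: Q.graded_family_def)
qed

lemma colon_piece_superset: "ipiece (ideal_gen G) e \<subseteq> ipiece (colon (ideal_gen G) f) e"
  using ideal_mult[OF ideal_gen_subspace, of _ G f] by (auto simp: ipiece_def colon_def mult.commute)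

lemma colon_subspace: "Q.subspace (colon (ideal_gen G) f)"
  using ideal_gen_subspace[of G] unfolding Q.subspace_def colon_def by (auto simp: distrib_right mult.assoc)

lemma dim_colon_ge: "Q.V.vs.dim (ipiece (ideal_gen G) e) \<le> Q.V.vs.dim (ipiece (colon (ideal_gen G) f) e)"
  using ipiece_graded[OF colon_subspace]
  by (intro Q.V.dim_mono_fd colon_piece_superset) (simp add: Q.graded_family_def)

lemma dim_colon_eq_iff: "Q.V.vs.dim (ipiece (colon (ideal_gen G) f) e) = Q.V.vs.dim (ipiece (ideal_gen G) e) \<longleftrightarrow>
   (\<forall>p. homogeneous e p \<and> p * f \<in> ideal_gen G \<longrightarrow> p \<in> ideal_gen G)" (is "?l \<longleftrightarrow> ?r")
proof
  assume ?l
  have "ipiece (ideal_gen G) e = ipiece (colon (ideal_gen G) f) e"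
    using ipiece_graded[OF colon_subspace] \<open>?l\<close>
    by (intro Q.V.fd_eqI[OF _ ipiece_subspace[OF ideal_gen_subspace] colon_piece_superset]) (simp_all add: Q.graded_family_def)
  then show ?r by (auto simp: ipiece_def colon_def)
next
  assume ?r
  then have "ipiece (colon (ideal_gen G) f) e = ipiece (ideal_gen G) e"
    using colon_piece_superset[of G e] by (auto simp: ipiece_def colon_def)
  then show ?l by simp
qed

text \<open>The ideal is homogeneous, so it is enough to test homogeneous elements.\<close>

lemma nonzerodivisor_iff:
  assumes J: "homogeneous_ideal (ideal_gen G)"
  shows "(\<forall>p. p * f \<in> ideal_gen G \<longrightarrow> p \<in> ideal_gen G) \<longleftrightarrow>
    (\<forall>e. Q.V.vs.dim (ipiece (colon (ideal_gen G) f) e) = Q.V.vs.dim (ipiece (ideal_gen G) e))"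
  unfolding dim_colon_eq_iff
proof (intro iffI allI impI)
  fix p assume h: "\<forall>e p. homogeneous e p \<and> p * f \<in> ideal_gen G \<longrightarrow> p \<in> ideal_gen G" and p: "p * f \<in> ideal_gen G"
  have "hcomp e p \<in> ideal_gen G" for e
  proof -
    have "hcomp (e + d) (p * f) \<in> ideal_gen G" using J p by (simp add: homogeneous_ideal_def)
    then show ?thesis using h homogeneous_hcomp[of e p] by (simp add: hcomp_times)
  qed
  moreover obtain E where "finite E" "p = (\<Sum>e\<in>E. hcomp e p)" using grading_sum[OF grading_hcomp] .
  ultimately show "p \<in> ideal_gen G" using Q.subspace_sum[OF ideal_gen_subspace, of E] by metis
qed auto

lemma surj_iff:
  assumes J: "homogeneous_ideal (ideal_gen G)"
  shows "Q.V.vs.dim (ipiece (ideal_gen (insert f G)) (e + d)) = Q.V.vs.dim (hpiece (e + d) :: ('v, 'k) mpoly set) \<longleftrightarrow>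
    (\<forall>q. homogeneous (e + d) q \<longrightarrow> (\<exists>p. homogeneous e p \<and> q - f * p \<in> ideal_gen G))" (is "?l \<longleftrightarrow> ?r")
proof -
  have sub: "ipiece (ideal_gen (insert f G)) (e + d) \<subseteq> hpiece (e + d)" by (auto simp: ipiece_def)
  have "?l \<longleftrightarrow> ipiece (ideal_gen (insert f G)) (e + d) = hpiece (e + d)"
    using Q.V.fd_eqI[OF hpiece_fd ipiece_subspace[OF ideal_gen_subspace] sub] by auto
  also have "\<dots> \<longleftrightarrow> ?r"
  proof
    assume eq: "ipiece (ideal_gen (insert f G)) (e + d) = hpiece (e + d)"
    show ?r
    proof (intro allI impI)
      fix q :: "('v, 'k) mpoly" assume "homogeneous (e + d) q"
      then have "q \<in> Q.V.sumset ((\<lambda>p. p * f) ` hpiece e) (ipiece (ideal_gen G) (e + d))"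
        unfolding ideal_insert_piece[OF J] eq by simp
      then obtain p g where "homogeneous e p" "g \<in> ideal_gen G" "q = p * f + g"
        by (auto simp: Q.V.sumset_def ipiece_def)
      then show "\<exists>p. homogeneous e p \<and> q - f * p \<in> ideal_gen G" by (intro exI[of _ p]) (simp add: mult.commute)
    qed
  next
    assume r: ?r
    show "ipiece (ideal_gen (insert f G)) (e + d) = hpiece (e + d)"
    proof (intro subset_antisym sub subsetI)
      fix q :: "('v, 'k) mpoly" assume q: "q \<in> hpiece (e + d)"
      then obtain p where "q - f * p \<in> ideal_gen G" using r by blast
      then have "q \<in> ideal_gen (insert f G)" unfolding in_ideal_gen_insert by (intro exI[of _ p]) (simp add: mult.commute)
      then show "q \<in> ipiece (ideal_gen (insert f G)) (e + d)" using q by (simp add: ipiece_def)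
    qed
  qed
  finally show ?thesis .
qed

end

abbreviation qideal :: "('n, 'k) coeffs \<Rightarrow> nat \<Rightarrow> ('n::{finite,linorder}, 'k::field) mpoly set" where
  "qideal a k \<equiv> ideal_gen (quadric a ` {1..k})"

definition qdim :: "(('n::{finite,linorder}, 'k::field) coeffs) \<Rightarrow> nat \<Rightarrow> nat \<Rightarrow> nat" where
  "qdim a k e = Q.V.vs.dim (ipiece (qideal a k :: ('n, 'k) mpoly set) e)"

definition cdim :: "(('n::{finite,linorder}, 'k::field) coeffs) \<Rightarrow> nat \<Rightarrow> nat \<Rightarrow> nat" where
  "cdim a k e = Q.V.vs.dim (ipiece (colon (qideal a k) (quadric a (Suc k)) :: ('n, 'k) mpoly set) e)"

lemma homogeneous_qideal: "homogeneous_ideal (qideal a k)"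
  by (rule homogeneous_ideal_gen) (use homogeneous_quadric in blast)

lemma qideal_Suc: "quadric a ` {1..Suc k} = insert (quadric a (Suc k)) (quadric a ` {1..k})"
  by (auto simp: atLeastAtMostSuc_conv)

lemma cdim_qdim: "cdim a k e + qdim a (Suc k) (e + 2) = 
   Q.V.vs.dim (hpiece e :: ('n::{finite,linorder}, 'k::field) mpoly set) + qdim (a :: ('n, 'k) coeffs) k (e + 2)"
  unfolding cdim_def qdim_def qideal_Suc by (rule dim_insert_colon[OF homogeneous_quadric homogeneous_qideal])

lemma qdim_le_cdim: "qdim a k e \<le> cdim a k e"
  unfolding cdim_def qdim_def by (rule dim_colon_ge[OF homogeneous_quadric])

lemma qdim_0: "qdim a 0 e = 0"
proof -
  have "ipiece (qideal a 0) e = {0}" by (auto simp: ipiece_def ideal_gen_def)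
  then show ?thesis unfolding qdim_def by (simp only: Q.V.dim_zero_space)
qed

lemma qideal_low: assumes "e < 2" shows "ipiece (qideal a k) e = {0}"
proof (induction k)
  case 0 show ?case by (auto simp: ipiece_def ideal_gen_def)
next
  case (Suc k)
  then show ?case unfolding qideal_Suc
    by (subst ideal_insert_low[OF homogeneous_quadric homogeneous_qideal assms])
qed

lemma qdim_low: "e < 2 \<Longrightarrow> qdim a k e = 0"
  unfolding qdim_def qideal_low using qdim_0[of a e] qideal_low[of e a 0] unfolding qdim_def by simp

text \<open>Here \<open>q\<close> counts forms, \<open>D k\<close> is the Hilbert function of the ideal of the first \<open>k\<close>
  quadrics, \<open>D'\<close> belongs to a regular sequence, and \<open>E\<close> measures zero divisors. In the lowest
  degree in which some \<open>E k\<close> is not zero, it makes all later ideals two degrees higher smaller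
  than those of the regular sequence, and nothing can compensate for this.\<close>

lemma hilbert_function_rigidity:
  fixes D D' E :: "nat \<Rightarrow> nat \<Rightarrow> int" and q :: "nat \<Rightarrow> int"
  assumes D: "\<And>k e. k < n \<Longrightarrow> D (Suc k) (e + 2) = q e + D k (e + 2) - D k e - E k e"
    and D': "\<And>k e. k < n \<Longrightarrow> D' (Suc k) (e + 2) = q e + D' k (e + 2) - D' k e"
    and E: "\<And>k e. 0 \<le> E k e" and z: "\<And>e. D 0 e = D' 0 e"
    and low: "\<And>k e. e < 2 \<Longrightarrow> D k e = D' k e" and le: "\<And>e. D' n e \<le> D n e"
  shows "k \<le> n \<Longrightarrow> D k e = D' k e" "k < n \<Longrightarrow> E k e = 0"
proof -
  have step: "(\<forall>k\<le>n. D k (e + 2) = D' k (e + 2)) \<and> (\<forall>k<n. E k e = 0)" if P: "\<forall>k\<le>n. D k e = D' k e" for e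
  proof -
    \<comment> \<open>The defect of the ideals grows with the number of quadrics, starts at zero and is not positive at the end.\<close>
    have inc: "D' (Suc k) (e + 2) - D (Suc k) (e + 2) = (D' k (e + 2) - D k (e + 2)) + E k e" if "k < n" for k
      using D[OF that, of e] D'[OF that, of e] P that by simp
    have mono: "D' k (e + 2) - D k (e + 2) \<le> D' (k + i) (e + 2) - D (k + i) (e + 2)" if "k + i \<le> n" for k i
      using that
    proof (induction i)
      case (Suc i)
      then show ?case using inc[of "k + i"] E[of "k + i" e] by simp
    qed simp
    have eq: "D k (e + 2) = D' k (e + 2)" if "k \<le> n" for k
      using mono[of 0 k] mono[of k "n - k"] z[of "e + 2"] le[of "e + 2"] that by simp
    moreover have "E k e = 0" if "k < n" for k using inc[OF that] eq that by simp
    ultimately show ?thesis by blast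
  qed
  have all: "\<forall>k\<le>n. D k e = D' k e" for e
  proof (induction e rule: less_induct)
    case (less e)
    show ?case
    proof (cases "e < 2")
      case True then show ?thesis using low by simp
    next
      case False
      then obtain i where i: "e = i + 2" by (metis add.commute le_iff_add not_less)
      then show ?thesis using step[of i] less[of i] by simp
    qed
  qed
  show "k \<le> n \<Longrightarrow> D k e = D' k e" using all by simp
  show "k < n \<Longrightarrow> E k e = 0" using step[OF all] by simp
qed

lemma regular_sequence_quadric_iff:
  fixes a :: "('n::{finite,linorder}, 'k::field) coeffs"
  shows "regular_sequence (quadric a) n \<longleftrightarrow> (\<forall>k<n. \<forall>e. cdim a k e = qdim a k e)"
proof -
  have "(1 :: ('n, 'k) mpoly) \<notin> qideal a n"
  proof
    assume "(1 :: ('n, 'k) mpoly) \<in> qideal a n"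
    moreover have "homogeneous 0 (1 :: ('n, 'k) mpoly)" by (simp add: homogeneous_def)
    ultimately have "1 \<in> ipiece (qideal a n) 0" by (simp add: ipiece_def)
    then show False using qideal_low[of 0 a n] by simp
  qed
  then have ne: "qideal a n \<noteq> (UNIV :: ('n, 'k) mpoly set)" by blast
  have "(\<forall>k\<in>{1..n}. \<forall>p. p * quadric a k \<in> ideal_gen (quadric a ` {1..<k}) \<longrightarrow> p \<in> ideal_gen (quadric a ` {1..<k}))
    \<longleftrightarrow> (\<forall>k<n. \<forall>p. p * quadric a (Suc k) \<in> qideal a k \<longrightarrow> p \<in> qideal a k)" (is "?l \<longleftrightarrow> ?r")
  proof
    assume l: ?l
    show ?r
    proof (intro allI impI)
      fix k p assume "k < n" "p * quadric a (Suc k) \<in> qideal a k"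
      then show "p \<in> qideal a k" using l[rule_format, of "Suc k" p] by (simp add: atLeastLessThanSuc_atLeastAtMost)
    qed
  next
    assume r: ?r
    show ?l
    proof (intro ballI allI impI)
      fix k p assume k: "k \<in> {1..n}" "p * quadric a k \<in> ideal_gen (quadric a ` {1..<k})"
      then obtain k' where k': "k = Suc k'" by (cases k) auto
      then show "p \<in> ideal_gen (quadric a ` {1..<k})" 
        using r k by (simp add: atLeastLessThanSuc_atLeastAtMost)
    qed
  qed
  also have "\<dots> \<longleftrightarrow> (\<forall>k<n. \<forall>e. cdim a k e = qdim a k e)"
    unfolding cdim_def qdim_def nonzerodivisor_iff[OF homogeneous_quadric homogeneous_qideal] ..
  finally show ?thesis using ne unfolding regular_sequence_def by simp
qed

lemma maximal_rank_quadric_iff: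
  fixes a :: "('n::{finite,linorder}, 'k::field) coeffs"
  shows "maximal_rank_element (qideal a n) 2 (quadric a (Suc n)) \<longleftrightarrow>
    (\<forall>e. cdim a n e = qdim a n e \<or> qdim a (Suc n) (e + 2) = Q.V.vs.dim (hpiece (e + 2) :: ('n, 'k) mpoly set))"
  unfolding maximal_rank_element_def cdim_def qdim_def qideal_Suc
    dim_colon_eq_iff[OF homogeneous_quadric] surj_iff[OF homogeneous_quadric homogeneous_qideal]
  by (simp add: mult.commute)

text \<open>Rigidity settles the first \<open>n\<close> quadrics. For the last one, maximal rank at \<open>a0\<close> means that
  the ideal is as large as the ideal of the first \<open>n\<close> allows, so the same value is attained at
  \<open>a\<close>.\<close>

lemma general_position_transfer:
  fixes a a0 :: "('n::{finite,linorder}, 'k::field) coeffs"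
  assumes a0: "general_position a0"
    and le: "\<And>e. qdim a0 CARD('n) e \<le> qdim a CARD('n) e"
    and le': "\<And>e. qdim a0 (Suc CARD('n)) e \<le> qdim a (Suc CARD('n)) e"
  shows "general_position a" "qdim a CARD('n) e = qdim a0 CARD('n) e"
    "qdim a (Suc CARD('n)) e = qdim a0 (Suc CARD('n)) e"
proof -
  let ?n = "CARD('n)"
  let ?q = "\<lambda>e. Q.V.vs.dim (hpiece e :: ('n, 'k) mpoly set)"
  have r0: "cdim a0 k e = qdim a0 k e" if "k < ?n" for k e
    using a0 that by (simp add: general_position_def regular_sequence_quadric_iff)
  have m0: "cdim a0 ?n e = qdim a0 ?n e \<or> qdim a0 (Suc ?n) (e + 2) = ?q (e + 2)" for e
    using a0 maximal_rank_quadric_iff[of a0 ?n] by (simp add: general_position_def)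
  have eq: "k \<le> ?n \<Longrightarrow> int (qdim a k e) = int (qdim a0 k e)"
    and ex: "k < ?n \<Longrightarrow> int (cdim a k e) - int (qdim a k e) = 0" for k e
  proof -
    note rig = hilbert_function_rigidity[where D = "\<lambda>k e. int (qdim a k e)" and D' = "\<lambda>k e. int (qdim a0 k e)"
        and E = "\<lambda>k e. int (cdim a k e) - int (qdim a k e)" and q = "\<lambda>e. int (?q e)" and n = ?n and k = k and e = e]
    have 1: "int (qdim a (Suc k) (e + 2)) = int (?q e) + int (qdim a k (e + 2)) - int (qdim a k e) - (int (cdim a k e) - int (qdim a k e))" for k e
      using cdim_qdim[of a k e] by simp
    have 2: "int (qdim a0 (Suc k) (e + 2)) = int (?q e) + int (qdim a0 k (e + 2)) - int (qdim a0 k e)" if "k < ?n" for k e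
      using cdim_qdim[of a0 k e] r0[OF that, of e] by simp
    show "k \<le> ?n \<Longrightarrow> int (qdim a k e) = int (qdim a0 k e)"
      by (rule rig(1)) (use 1 2 qdim_le_cdim le in \<open>simp_all add: qdim_0 qdim_low\<close>)
    show "k < ?n \<Longrightarrow> int (cdim a k e) - int (qdim a k e) = 0"
      by (rule rig(2)) (use 1 2 qdim_le_cdim le in \<open>simp_all add: qdim_0 qdim_low\<close>)
  qed
  show qn: "qdim a ?n e = qdim a0 ?n e" for e using eq[of ?n e] by simp
  have up: "qdim a (Suc ?n) e \<le> ?q e" for e
    unfolding qdim_def by (rule Q.V.dim_mono_fd[OF hpiece_fd]) (auto simp: ipiece_def)
  have m: "cdim a ?n e = qdim a ?n e \<or> qdim a (Suc ?n) (e + 2) = ?q (e + 2)"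
    "qdim a (Suc ?n) (e + 2) = qdim a0 (Suc ?n) (e + 2)" for e
    using m0[of e] cdim_qdim[of a ?n e] cdim_qdim[of a0 ?n e] qn[of e] qn[of "e + 2"] le'[of "e + 2"]
      up[of "e + 2"] qdim_le_cdim[of a ?n e] by linarith+
  show "qdim a (Suc ?n) e = qdim a0 (Suc ?n) e"
  proof (cases "e < 2")
    case True then show ?thesis by (simp add: qdim_low)
  next
    case False
    then have "e - 2 + 2 = e" by simp
    then show ?thesis using m(2)[of "e - 2"] by metis
  qed
  have "regular_sequence (quadric a) ?n" unfolding regular_sequence_quadric_iff using ex by simp
  moreover have "maximal_rank_element (qideal a ?n) 2 (quadric a (Suc ?n))"
    unfolding maximal_rank_quadric_iff using m(1) by simp
  ultimately show "general_position a" by (simp add: general_position_def)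
qed

text \<open>Every monomial of degree \<open>e + 1\<close> is a variable times a monomial of degree \<open>e\<close>.\<close>

lemma hpiece_full_mono:
  fixes I :: "('v::{finite,linorder}, 'k::field) mpoly set"
  assumes I: "Q.subspace I" and full: "hpiece d \<subseteq> I" and e: "d \<le> e"
  shows "hpiece e \<subseteq> I"
  using e
proof (induction e rule: dec_induct)
  case base show ?case by (rule full)
next
  case (step e)
  show ?case
  proof
    fix p :: "('v, 'k) mpoly" assume "p \<in> hpiece (Suc e)"
    then have p: "homogeneous (Suc e) p" by simp
    have "single m (lookup p m) \<in> I" if m: "m \<in> keys p" for m
    proof -
      have "mon_deg m = Suc e" using p m by (simp add: homogeneous_def)
      then have "m \<noteq> 0" using mon_deg_zero by (metis nat.distinct(1))
      then have "keys m \<noteq> {}" by simp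
      then obtain v where v: "v \<in> keys m" by blast
      let ?p = "single (m - X v) (lookup p m)"
      have "mon_deg (m - X v) = e" using arg_cong[OF X_plus_minus[OF v], of mon_deg] \<open>mon_deg m = Suc e\<close> by simp
      then have "homogeneous e ?p" using homogeneous_single by metis
      then have "?p \<in> I" using step.IH by blast
      then have "var v * ?p \<in> I" by (rule ideal_mult[OF I])
      moreover have "var v * ?p = single m (lookup p m)"
        unfolding var_def mult_single X_plus_minus[OF v] by simp
      ultimately show ?thesis by simp
    qed
    then show "p \<in> I" by (subst poly_mapping_sum_single) (rule Q.subspace_sum[OF I])
  qed
qed

section \<open>The Lefschetz property of the squares of the variables\<close>

subsection \<open>The raising and lowering operators on the subset lattice\<close>

text \<open>A function on sets of variables stands for the squarefree polynomial with these
  coefficients. Then \<open>up\<close> is multiplication by the sum of the variables modulo their squares,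
  and \<open>dn\<close> is the sum of the partial derivatives.\<close>

definition up :: "('n::finite set \<Rightarrow> 'k::field) \<Rightarrow> 'n set \<Rightarrow> 'k" where
  "up f S = (\<Sum>v\<in>S. f (S - {v}))"

definition dn :: "('n::finite set \<Rightarrow> 'k::field) \<Rightarrow> 'n set \<Rightarrow> 'k" where
  "dn f S = (\<Sum>v\<in>-S. f (insert v S))"

definition level :: "nat \<Rightarrow> ('n::finite set \<Rightarrow> 'k::field) \<Rightarrow> bool" where
  "level d f \<longleftrightarrow> (\<forall>S. f S \<noteq> 0 \<longrightarrow> card S = d)"

lemma up_lin: "up (\<lambda>S. c * f S + g S) S = c * up f S + up g S"
  by (simp add: up_def sum.distrib sum_distrib_left)

lemma dn_lin: "dn (\<lambda>S. c * f S + g S) S = c * dn f S + dn g S"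
  by (simp add: dn_def sum.distrib sum_distrib_left)

lemma up_zero: "up (\<lambda>_. 0) = (\<lambda>_. 0)" by (simp add: up_def fun_eq_iff)

lemma dn_zero: "dn (\<lambda>_. 0) = (\<lambda>_. 0)" by (simp add: dn_def fun_eq_iff)

lemma level_up: assumes "level d f" shows "level (Suc d) (up f)"
  unfolding level_def
proof (intro allI impI)
  fix S assume "up f S \<noteq> 0"
  then obtain v where "v \<in> S" "f (S - {v}) \<noteq> 0"
    unfolding up_def by (meson sum.not_neutral_contains_not_neutral)
  then show "card S = Suc d" using assms card.remove[of S v] by (auto simp: level_def)
qed

lemma level_dn: assumes "level (Suc d) f" shows "level d (dn f)"
  unfolding level_def
proof (intro allI impI)
  fix S assume "dn f S \<noteq> 0"
  then obtain v where "v \<in> -S" "f (insert v S) \<noteq> 0"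
    unfolding dn_def by (meson sum.not_neutral_contains_not_neutral)
  then show "card S = d" using assms by (auto simp: level_def)
qed

lemma level_dn_0: assumes "level 0 f" shows "dn f = (\<lambda>_. 0)"
  using assms by (auto simp: dn_def level_def fun_eq_iff intro!: sum.neutral)

lemma level_big: "level d (f :: 'n::finite set \<Rightarrow> 'k::field) \<Longrightarrow> CARD('n) < d \<Longrightarrow> f = (\<lambda>_. 0)"
  unfolding level_def fun_eq_iff using card_mono[of "UNIV :: 'n set"] by (metis finite not_less subset_UNIV)

lemma level_dn_pow: "level (d + i) f \<Longrightarrow> level d ((dn ^^ i) f)"
proof (induction i arbitrary: d)
  case (Suc i)
  then have "level (Suc d + i) f" by simp
  from level_dn[OF Suc.IH[OF this]] show ?case by simp
qed simp

lemma level_up_pow: "level d f \<Longrightarrow> level (d + i) ((up ^^ i) f)"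
  by (induction i) (auto intro: level_up)

text \<open>The commutation relation of \<open>sl\<^sub>2\<close>: removing and then adding an element differs from
  adding and then removing one only when the element is the same, which happens for each element
  of \<open>S\<close> in the one case and for each element of the complement in the other.\<close>

lemma up_dn:
  fixes f :: "'n::finite set \<Rightarrow> 'k::field"
  shows "up (dn f) S = dn (up f) S + of_int (2 * int (card S) - int CARD('n)) * f S"
proof -
  have "up (dn f) S = (\<Sum>w\<in>S. f S + (\<Sum>v\<in>-S. f (insert v (S - {w}))))"
    unfolding up_def
  proof (rule sum.cong[OF refl])
    fix w assume w: "w \<in> S"
    have "- (S - {w}) = insert w (- S)" using w by auto
    then show "dn f (S - {w}) = f S + (\<Sum>v\<in>-S. f (insert v (S - {w})))"
      using w by (simp add: dn_def insert_absorb)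
  qed
  also have "\<dots> = of_nat (card S) * f S + (\<Sum>w\<in>S. \<Sum>v\<in>-S. f (insert v (S - {w})))"
    by (simp add: sum.distrib)
  finally have 1: "up (dn f) S = of_nat (card S) * f S + (\<Sum>w\<in>S. \<Sum>v\<in>-S. f (insert v (S - {w})))" .
  have "dn (up f) S = (\<Sum>v\<in>-S. f S + (\<Sum>w\<in>S. f (insert v (S - {w}))))"
    unfolding dn_def
  proof (rule sum.cong[OF refl])
    fix v assume v: "v \<in> -S"
    have "(\<Sum>w\<in>S. f (insert v S - {w})) = (\<Sum>w\<in>S. f (insert v (S - {w})))"
      using v by (intro sum.cong refl arg_cong[where f = f]) auto
    then show "up f (insert v S) = f S + (\<Sum>w\<in>S. f (insert v (S - {w})))"
      using v by (simp add: up_def)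
  qed
  also have "\<dots> = of_nat (card (-S)) * f S + (\<Sum>v\<in>-S. \<Sum>w\<in>S. f (insert v (S - {w})))"
    by (simp add: sum.distrib)
  also have "(\<Sum>v\<in>-S. \<Sum>w\<in>S. f (insert v (S - {w}))) = (\<Sum>w\<in>S. \<Sum>v\<in>-S. f (insert v (S - {w})))"
    by (rule sum.swap)
  finally have 2: "dn (up f) S = of_nat (card (-S)) * f S + (\<Sum>w\<in>S. \<Sum>v\<in>-S. f (insert v (S - {w})))" .
  have "card (- S) = CARD('n) - card S" by (simp add: Compl_eq_Diff_UNIV card_Diff_subset)
  moreover have "card S \<le> CARD('n)" by (simp add: card_mono)
  ultimately show ?thesis unfolding 1 2 by (simp add: of_nat_diff algebra_simps)
qed

text \<open>Moving \<open>up\<close> past \<open>i + 1\<close> copies of \<open>dn\<close> adds up the weights \<open>2 m - n\<close>, \<open>2 (m - 1) - n\<close>,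
  \<open>\<dots>\<close>, \<open>2 (m - i) - n\<close> of the levels passed, where \<open>n\<close> is the number of variables.\<close>

lemma up_dn_pow:
  fixes z :: "'n::finite set \<Rightarrow> 'k::field"
  assumes z: "level m z" and i: "i \<le> m"
  shows "up ((dn ^^ Suc i) z) S = (dn ^^ Suc i) (up z) S
    + of_int (int (Suc i) * (2 * int m - int CARD('n) - int i)) * (dn ^^ i) z S"
  using i
proof (induction i arbitrary: S)
  case 0
  show ?case using up_dn[of z S] z by (cases "z S = 0") (auto simp: level_def)
next
  case (Suc i)
  let ?c = "of_int (int (Suc i) * (2 * int m - int CARD('n) - int i)) :: 'k"
  define g where "g = (dn ^^ Suc i) z"
  have lg: "level (m - Suc i) g" unfolding g_def using Suc.prems z by (intro level_dn_pow) simp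
  have ug: "up g = (\<lambda>S. ?c * (dn ^^ i) z S + (dn ^^ Suc i) (up z) S)"
    using Suc by (auto simp: g_def fun_eq_iff)
  have "up (dn g) S = dn (up g) S + of_int (2 * int (m - Suc i) - int CARD('n)) * g S"
    using up_dn[of g S] lg by (cases "g S = 0") (auto simp: level_def)
  also have "dn (up g) S = ?c * g S + (dn ^^ Suc (Suc i)) (up z) S"
    unfolding ug dn_lin by (simp add: g_def)
  also have "?c * g S + (dn ^^ Suc (Suc i)) (up z) S + of_int (2 * int (m - Suc i) - int CARD('n)) * g S
    = (dn ^^ Suc (Suc i)) (up z) S + of_int (int (Suc i) * (2 * int m - int CARD('n) - int i) + (2 * int (m - Suc i) - int CARD('n))) * g S"
    by (simp only: of_int_add distrib_left distrib_right ac_simps)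
  also have "int (Suc i) * (2 * int m - int CARD('n) - int i) + (2 * int (m - Suc i) - int CARD('n))
     = int (Suc (Suc i)) * (2 * int m - int CARD('n) - int (Suc i))"
    using Suc.prems by (simp add: of_nat_diff algebra_simps)
  finally show ?case by (simp add: g_def)
qed

context
  assumes char: "CHAR('k::field) = 0 \<or> CARD('n::finite) < CHAR('k)"
begin

lemma of_int_unit: "0 < i \<Longrightarrow> i \<le> int CARD('n) \<Longrightarrow> (of_int i :: 'k) \<noteq> 0"
proof
  assume i: "0 < i" "i \<le> int CARD('n)" and z: "(of_int i :: 'k) = 0"
  then have "(of_nat (nat i) :: 'k) = 0" by (metis of_int_of_nat_eq int_nat_eq less_imp_le)
  then have "CHAR('k) dvd nat i" by (simp add: of_nat_eq_0_iff_char_dvd)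
  then show False using char i by (auto dest: dvd_imp_le)
qed

text \<open>As \<open>up f\<close> is zero, the commutation relation shows that a nonzero multiple of \<open>dn\<^sup>k f\<close> is
  zero if \<open>dn\<^sup>k\<^sup>+\<^sup>1 f\<close> is. Lowering \<open>d + 1\<close> times gives zero, whence the claim by descent to \<open>k
  = 0\<close>.\<close>

lemma up_injective:
  fixes f :: "'n set \<Rightarrow> 'k"
  assumes f: "level d f" and d: "2 * d < CARD('n)" and z: "up f = (\<lambda>_. 0)"
  shows "f = (\<lambda>_. 0)"
proof -
  have dz: "(dn ^^ i) (\<lambda>_. 0) = ((\<lambda>_. 0) :: 'n set \<Rightarrow> 'k)" for i by (induction i) (simp_all add: dn_zero)
  have "(dn ^^ (Suc d - i)) f = (\<lambda>_. 0)" if "i \<le> Suc d" for i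
    using that
  proof (induction i)
    case 0
    have "level 0 ((dn ^^ d) f)" by (rule level_dn_pow) (use f in simp)
    then show ?case by (simp add: level_dn_0)
  next
    case (Suc i)
    define k where "k = d - i"
    have k: "Suc d - i = Suc k" "Suc d - Suc i = k" "k \<le> d" using Suc.prems by (auto simp: k_def)
    show ?case
    proof
      fix S
      have IH: "(dn ^^ Suc k) f = (\<lambda>_. 0)" using Suc.IH Suc.prems unfolding k(1) by simp
      have "0 = of_int (int (Suc k) * (2 * int d - int CARD('n) - int k)) * (dn ^^ k) f S"
        using up_dn_pow[OF f k(3), of S] unfolding IH z dz up_zero by (simp only: add_0)
      moreover have "(of_int (int (Suc k)) :: 'k) \<noteq> 0" using k d by (intro of_int_unit) auto
      moreover have "(of_int (- (2 * int d - int CARD('n) - int k)) :: 'k) \<noteq> 0" using k d by (intro of_int_unit) auto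
      ultimately have "(dn ^^ k) f S = 0"
        by (simp only: of_int_mult of_int_minus mult_eq_0_iff neg_equal_0_iff_equal eq_commute[of 0] simp_thms)
      then show "(dn ^^ (Suc d - Suc i)) f S = 0" by (simp only: k(2))
    qed
  qed
  from this[of "Suc d"] show ?thesis by simp
qed

text \<open>By the commutation relation, \<open>dn\<^sup>i (up\<^sup>i y)\<close> is in the image of \<open>up\<close> if the same holds for
  \<open>i + 1\<close>. Raising past the top level gives zero, whence the claim by descent to \<open>i = 0\<close>.\<close>

lemma up_surjective:
  fixes y :: "'n set \<Rightarrow> 'k"
  assumes y: "level (Suc d) y" and d: "CARD('n) < 2 * Suc d"
  obtains x where "level d x" "up x = y"
proof (cases "Suc d \<le> CARD('n)")
  case False
  then have "y = (\<lambda>_. 0)" using level_big[OF y] by simp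
  then show ?thesis using that[of "\<lambda>_. 0"] by (simp add: up_zero level_def)
next
  case True
  let ?n = "CARD('n)" and ?e = "Suc d"
  have dz: "(dn ^^ i) (\<lambda>_. 0) = ((\<lambda>_. 0) :: 'n set \<Rightarrow> 'k)" for i by (induction i) (simp_all add: dn_zero)
  have "\<exists>x. level d x \<and> up x = (dn ^^ (?n - d - l)) ((up ^^ (?n - d - l)) y)" if "l \<le> ?n - d" for l
    using that
  proof (induction l)
    case 0
    have "(up ^^ (?n - d)) y = (\<lambda>_. 0)"
      by (rule level_big[OF level_up_pow[OF y]]) (use True in simp)
    then show ?case by (intro exI[of _ "\<lambda>_. 0"]) (simp add: dz up_zero level_def)
  next
    case (Suc l)
    define i where "i = ?n - d - Suc l"
    have i: "?n - d - l = Suc i" "i \<le> ?n - ?e" using Suc.prems by (auto simp: i_def)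
    obtain x where x: "level d x" "up x = (dn ^^ Suc i) ((up ^^ Suc i) y)" using Suc i(1) by auto
    define z where "z = (up ^^ i) y"
    have z: "level (?e + i) z" unfolding z_def by (rule level_up_pow[OF y])
    define c where "c = (of_int (int (Suc i) * (2 * int (?e + i) - int ?n - int i)) :: 'k)"
    have "(of_int (int (Suc i)) :: 'k) \<noteq> 0" using i True d by (intro of_int_unit) auto
    moreover have "(of_int (2 * int (?e + i) - int ?n - int i) :: 'k) \<noteq> 0"
      using i True d by (intro of_int_unit) auto
    ultimately have c: "c \<noteq> 0" by (simp add: c_def)
    have eq: "up ((dn ^^ Suc i) z) S = up x S + c * (dn ^^ i) z S" for S
      using up_dn_pow[OF z, of i S] by (simp add: c_def z_def x(2))
    let ?x = "\<lambda>S. inverse c * (dn ^^ Suc i) z S + (- inverse c) * x S"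
    have "up ?x S = (dn ^^ i) z S" for S
    proof -
      have "up ?x S = inverse c * up ((dn ^^ Suc i) z) S + up (\<lambda>S. (- inverse c) * x S + 0) S"
        by (subst up_lin) simp
      also have "\<dots> = inverse c * up ((dn ^^ Suc i) z) S - inverse c * up x S"
        by (subst up_lin) (simp add: up_zero)
      finally show ?thesis unfolding eq using c by (simp add: distrib_left)
    qed
    moreover have "level d ((dn ^^ Suc i) z)" by (rule level_dn_pow) (use z in simp)
    have "level d ?x"
      unfolding level_def
    proof (intro allI impI)
      fix S assume "?x S \<noteq> 0"
      then have "(dn ^^ Suc i) z S \<noteq> 0 \<or> x S \<noteq> 0" by auto
      then show "card S = d"
        using \<open>level d ((dn ^^ Suc i) z)\<close> x(1) unfolding level_def by blast
    qed
    ultimately show ?case unfolding i_def[symmetric] z_def by blast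
  qed
  from this[of "?n - d"] show ?thesis using that by auto
qed

end

subsection \<open>Monomial ideals\<close>

text \<open>The ideal generated by the squares of the variables in \<open>V\<close>, described by its monomials.\<close>

definition sq_ideal :: "'v set \<Rightarrow> ('v, 'k::comm_ring_1) mpoly set" where
  "sq_ideal V = {p. \<forall>m. lookup p m \<noteq> 0 \<longrightarrow> (\<exists>v\<in>V. 2 \<le> lookup m v)}"

lemma var_sq: "(var v)\<^sup>2 = xpow (single v 2)"
  by (simp add: var_def power2_eq_square mult_single single_add[symmetric] numeral_2_eq_2)

lemma sq_split: "2 \<le> lookup m v \<Longrightarrow> m = single v 2 + (m - single v 2)"
  for m :: "'v \<Rightarrow>\<^sub>0 nat"
  by (rule poly_mapping_eqI) (auto simp: lookup_add lookup_minus lookup_single when_def)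

lemma ideal_gen_squares:
  fixes V :: "'v::{finite,linorder} set"
  shows "ideal_gen ((\<lambda>v. (var v)\<^sup>2) ` V) = (sq_ideal V :: ('v, 'k::field) mpoly set)"
proof
  have sub: "Q.subspace (sq_ideal V :: ('v, 'k) mpoly set)"
  proof (rule Q.subspaceI)
    fix x y c :: "('v, 'k) mpoly"
    show "0 \<in> (sq_ideal V :: ('v, 'k) mpoly set)" by (simp add: sq_ideal_def)
    assume x: "x \<in> sq_ideal V"
    show "c * x \<in> sq_ideal V"
      unfolding sq_ideal_def
    proof (intro CollectI allI impI)
      fix m assume "lookup (c * x) m \<noteq> 0"
      then obtain a b where "b \<in> keys x" "m = a + b" using keys_mult[of c x] by (auto simp: in_keys_iff)
      then show "\<exists>v\<in>V. 2 \<le> lookup m v" using x by (force simp: sq_ideal_def in_keys_iff lookup_add)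
    qed
    assume y: "y \<in> sq_ideal V"
    show "x + y \<in> sq_ideal V"
      unfolding sq_ideal_def
    proof (intro CollectI allI impI)
      fix m assume "lookup (x + y) m \<noteq> 0"
      then have "lookup x m \<noteq> 0 \<or> lookup y m \<noteq> 0" by (auto simp: lookup_add)
      then show "\<exists>v\<in>V. 2 \<le> lookup m v" using x y unfolding sq_ideal_def by blast
    qed
  qed
  have "(\<lambda>v. (var v)\<^sup>2) ` V \<subseteq> (sq_ideal V :: ('v, 'k) mpoly set)"
  proof clarify
    fix v assume v: "v \<in> V"
    show "(var v)\<^sup>2 \<in> (sq_ideal V :: ('v, 'k) mpoly set)"
      unfolding sq_ideal_def
    proof (intro CollectI allI impI)
      fix m assume "lookup ((var v)\<^sup>2 :: ('v, 'k) mpoly) m \<noteq> 0"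
      then have "m = single v 2" by (auto simp: var_sq lookup_single when_def split: if_splits)
      then show "\<exists>v\<in>V. 2 \<le> lookup m v" using v by (intro bexI[of _ v]) simp_all
    qed
  qed
  then show "ideal_gen ((\<lambda>v. (var v)\<^sup>2) ` V) \<subseteq> (sq_ideal V :: ('v, 'k) mpoly set)"
    unfolding ideal_gen_def by (rule Q.span_minimal[OF _ sub])
  let ?G = "(\<lambda>v. (var v)\<^sup>2) ` V :: ('v, 'k) mpoly set"
  show "(sq_ideal V :: ('v, 'k) mpoly set) \<subseteq> ideal_gen ((\<lambda>v. (var v)\<^sup>2) ` V)"
  proof
    fix p :: "('v, 'k) mpoly" assume p: "p \<in> sq_ideal V"
    have "single m (lookup p m) \<in> ideal_gen ?G" if m: "m \<in> keys p" for m
    proof -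
      obtain v where v: "v \<in> V" "2 \<le> lookup m v" using p m by (auto simp: sq_ideal_def in_keys_iff)
      have "(var v)\<^sup>2 \<in> ideal_gen ?G"
        using v(1) by (auto simp: ideal_gen_def intro: Q.span_base)
      then have "single (m - single v 2) (lookup p m) * (var v)\<^sup>2 \<in> ideal_gen ?G"
        by (rule ideal_mult[OF ideal_gen_subspace])
      moreover have "single (m - single v 2) (lookup p m) * (var v)\<^sup>2 = single m (lookup p m)"
        using sq_split[OF v(2)] by (simp add: var_sq mult_single add.commute)
      ultimately show ?thesis by simp
    qed
    then show "p \<in> ideal_gen ?G"
      by (subst poly_mapping_sum_single) (rule Q.subspace_sum[OF ideal_gen_subspace])
  qed
qed

lemma sq_ideal_colon:
  fixes p :: "('v::{finite,linorder}, 'k::field) mpoly"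
  assumes "p * (var w)\<^sup>2 \<in> sq_ideal V" "w \<notin> V" shows "p \<in> sq_ideal V"
  unfolding sq_ideal_def
proof (intro CollectI allI impI)
  fix m assume "lookup p m \<noteq> 0"
  then have "lookup (p * (var w)\<^sup>2) (single w 2 + m) \<noteq> 0"
    using lookup_single_times[of "single w 2" 1 p m] by (simp add: var_sq mult.commute)
  then obtain v where "v \<in> V" "2 \<le> lookup (single w 2 + m) v"
    using assms(1) by (auto simp: sq_ideal_def)
  then show "\<exists>v\<in>V. 2 \<le> lookup m v"
    using assms(2) by (intro bexI[of _ v]) (auto simp: lookup_add lookup_single when_def split: if_splits)
qed

definition ind :: "'v::finite set \<Rightarrow> ('v \<Rightarrow>\<^sub>0 nat)" where
  "ind S = (\<Sum>v\<in>S. X v)"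

definition sqfree_part :: "('v::finite, 'k::zero) mpoly \<Rightarrow> 'v set \<Rightarrow> 'k" where
  "sqfree_part p S = lookup p (ind S)"

lemma lookup_ind: "lookup (ind S) v = (if v \<in> S then 1 else 0)"
proof -
  have "lookup (ind S) v = (\<Sum>w\<in>S. if w = v then 1 else 0)"
    unfolding ind_def lookup_sum by (rule sum.cong) (auto simp: lookup_single)
  then show ?thesis by simp
qed

lemma keys_ind: "keys (ind S) = S" by (auto simp: in_keys_iff lookup_ind split: if_splits)

lemma mon_deg_ind: "mon_deg (ind S) = card S"
  by (simp add: mon_deg_def keys_ind lookup_ind)

lemma inj_ind: "ind S = ind T \<longleftrightarrow> S = T" by (metis keys_ind)

lemma sq_ideal_iff: "p \<in> sq_ideal UNIV \<longleftrightarrow> sqfree_part p = (\<lambda>_. 0)"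
proof
  assume p: "p \<in> sq_ideal UNIV"
  show "sqfree_part p = (\<lambda>_. 0)"
  proof (rule ext, rule ccontr)
    fix S assume "sqfree_part p S \<noteq> 0"
    then obtain v where "2 \<le> lookup (ind S) v" using p by (auto simp: sq_ideal_def sqfree_part_def)
    then show False by (auto simp: lookup_ind split: if_splits)
  qed
next
  assume z: "sqfree_part p = (\<lambda>_. 0)"
  show "p \<in> sq_ideal UNIV"
    unfolding sq_ideal_def
  proof (intro CollectI allI impI, rule ccontr)
    fix m assume m: "lookup p m \<noteq> 0" and "\<not> (\<exists>v\<in>UNIV. 2 \<le> lookup m v)"
    then have le1: "lookup m v \<le> 1" for v using not_less_eq_eq by (auto simp: numeral_2_eq_2 not_le)
    have "lookup (ind (keys m)) v = lookup m v" for v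
      using le1[of v] by (cases "lookup m v = 0") (simp_all add: lookup_ind in_keys_iff)
    then have "ind (keys m) = m" by (rule poly_mapping_eqI)
    then have "sqfree_part p (keys m) \<noteq> 0" using m by (simp add: sqfree_part_def)
    then show False using z by simp
  qed
qed

text \<open>A squarefree monomial arises by multiplication with a variable from the monomials with one
  of its variables removed.\<close>

lemma sqfree_part_sum_vars:
  fixes p :: "('v::finite, 'k::field) mpoly"
  shows "sqfree_part ((\<Sum>i\<in>UNIV. var i) * p) = up (sqfree_part p)"
proof
  fix S :: "'v set"
  have "ind S - X v = ind (S - {v})" if "v \<in> S" for v
    by (rule poly_mapping_eqI) (use that in \<open>auto simp: lookup_minus lookup_ind lookup_single when_def\<close>)
  then have "sqfree_part ((\<Sum>i\<in>UNIV. var i) * p) S = (\<Sum>v\<in>UNIV. if v \<in> S then sqfree_part p (S - {v}) else 0)"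
    unfolding sqfree_part_def sum_distrib_right lookup_sum lookup_var_times keys_ind by (intro sum.cong) auto
  then show "sqfree_part ((\<Sum>i\<in>UNIV. var i) * p) S = up (sqfree_part p) S"
    by (simp add: up_def sum.If_cases)
qed

lemma level_sqfree_part: "homogeneous d p \<Longrightarrow> level d (sqfree_part p)"
  by (auto simp: level_def sqfree_part_def homogeneous_lookup mon_deg_ind)

lemma sqfree_part_diff: "sqfree_part (p - q) S = sqfree_part p S - sqfree_part q S"
  by (simp add: sqfree_part_def lookup_minus)

lemma level_realize:
  fixes g :: "'v::finite set \<Rightarrow> 'k::field"
  assumes "level d g" obtains p :: "('v, 'k) mpoly" where "homogeneous d p" "sqfree_part p = g"
proof
  let ?p = "\<Sum>S\<in>UNIV. single (ind S) (g S)"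
  show "homogeneous d ?p"
    using assms by (intro homogeneous_sum) (auto simp: homogeneous_def mon_deg_ind level_def)
  show "sqfree_part ?p = g"
  proof
    fix T
    have "sqfree_part ?p T = (\<Sum>S\<in>UNIV. if S = T then g T else 0)"
      unfolding sqfree_part_def lookup_sum by (rule sum.cong) (auto simp: lookup_single inj_ind when_def)
    then show "sqfree_part ?p T = g T" by simp
  qed
qed

text \<open>Multiplication by the square of the sum of the variables is two raising steps, from level
  \<open>d\<close> to level \<open>d + 2\<close>. As \<open>n\<close> is odd, the level in between is not the middle: both steps are
  injective if it is below the middle, and both are surjective if it is above.\<close>

lemma maximal_rank_squares:
  assumes char: "CHAR('k::field) = 0 \<or> CARD('n::{finite,linorder}) < CHAR('k)" and odd: "odd CARD('n)"
  shows "maximal_rank_element (sq_ideal UNIV :: ('n, 'k) mpoly set) 2 ((\<Sum>i\<in>UNIV. var i)\<^sup>2)"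
  unfolding maximal_rank_element_def
proof
  fix d
  let ?l = "\<Sum>i\<in>UNIV. var i :: ('n, 'k) mpoly"
  have sq: "sqfree_part (?l\<^sup>2 * p) = up (up (sqfree_part p))" for p
    by (simp add: power2_eq_square mult.assoc sqfree_part_sum_vars)
  have "2 * Suc d \<noteq> CARD('n)" using odd by presburger
  then consider "2 * Suc d < CARD('n)" | "CARD('n) < 2 * Suc d" by linarith
  then show "(\<forall>p. homogeneous d p \<and> ?l\<^sup>2 * p \<in> sq_ideal UNIV \<longrightarrow> p \<in> sq_ideal UNIV) \<or>
     (\<forall>q. homogeneous (d + 2) q \<longrightarrow> (\<exists>p. homogeneous d p \<and> q - ?l\<^sup>2 * p \<in> sq_ideal UNIV))"
  proof cases
    case 1
    have "p \<in> sq_ideal UNIV" if p: "homogeneous d p" "?l\<^sup>2 * p \<in> sq_ideal UNIV" for p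
    proof -
      have "up (up (sqfree_part p)) = (\<lambda>_. 0)" using p(2) unfolding sq_ideal_iff sq .
      then have "up (sqfree_part p) = (\<lambda>_. 0)"
        by (rule up_injective[OF char level_up[OF level_sqfree_part[OF p(1)]] 1])
      then have "sqfree_part p = (\<lambda>_. 0)"
        by (rule up_injective[OF char level_sqfree_part[OF p(1)], rotated]) (use 1 in simp)
      then show ?thesis by (simp add: sq_ideal_iff)
    qed
    then show ?thesis by blast
  next
    case 2
    have "\<exists>p. homogeneous d p \<and> q - ?l\<^sup>2 * p \<in> sq_ideal UNIV" if q: "homogeneous (d + 2) q" for q
    proof -
      have lq: "level (Suc (Suc d)) (sqfree_part q)" using level_sqfree_part[OF q] by simp
      obtain x where x: "level (Suc d) x" "up x = sqfree_part q"
        by (rule up_surjective[OF char lq]) (use 2 in auto)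
      obtain y where y: "level d y" "up y = x" by (rule up_surjective[OF char x(1) 2])
      obtain p :: "('n, 'k) mpoly" where p: "homogeneous d p" "sqfree_part p = y" using level_realize[OF y(1)] .
      have "sqfree_part (q - ?l\<^sup>2 * p) = (\<lambda>_. 0)"
        unfolding fun_eq_iff sqfree_part_diff sq p(2) y(2) x(2) by simp
      then show ?thesis using p(1) by (auto simp: sq_ideal_iff)
    qed
    then show ?thesis by blast
  qed
qed

text \<open>A monomial of degree \<open>n + 1\<close> in \<open>n\<close> variables contains some variable at least twice.\<close>

lemma hpiece_sq_ideal: "hpiece (CARD('n) + 1) \<subseteq> (sq_ideal UNIV :: ('n::finite, 'k::comm_ring_1) mpoly set)"
proof
  fix p :: "('n, 'k) mpoly" assume "p \<in> hpiece (CARD('n) + 1)"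
  then have p: "homogeneous (CARD('n) + 1) p" by simp
  show "p \<in> sq_ideal UNIV"
    unfolding sq_ideal_def
  proof (intro CollectI allI impI, rule ccontr)
    fix m assume m: "lookup p m \<noteq> 0" "\<not> (\<exists>v\<in>UNIV. 2 \<le> lookup m v)"
    then have "mon_deg m \<le> (\<Sum>v\<in>(UNIV :: 'n set). 1)" unfolding mon_deg_sum
      by (intro sum_mono) (auto simp: not_le numeral_2_eq_2 less_Suc_eq_le)
    moreover have "mon_deg m = CARD('n) + 1" using p m by (simp add: homogeneous_lookup)
    ultimately show False by simp
  qed
qed

section \<open>The special point and its neighbourhood\<close>

text \<open>The squares of the variables, enumerated by \<open>\<sigma>\<close>, followed by the square of their sum, in
  which the mixed products have coefficient \<open>2\<close>.\<close>

definition special :: "(nat \<Rightarrow> 'n) \<Rightarrow> ('n::{finite,linorder}, 'k::field) coeffs" where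
  "special \<sigma> = (\<lambda>(k, i, j). if (k, i, j) \<notin> Upsilon then 0
     else if k = CARD('n) + 1 then (if i = j then 1 else 2)
     else (if i = j \<and> i = \<sigma> k then 1 else 0))"

lemma quadric_special_square:
  assumes "k \<in> {1..CARD('n)}"
  shows "quadric (special \<sigma>) k = ((var (\<sigma> k))\<^sup>2 :: ('n::{finite,linorder}, 'k::field) mpoly)"
proof -
  have "quadric (special \<sigma>) k = (\<Sum>ij\<in>{(i, j). i \<le> j}. if ij = (\<sigma> k, \<sigma> k) then (var (\<sigma> k))\<^sup>2 else 0 :: ('n, 'k) mpoly)"
    unfolding quadric_def
  proof (rule sum.cong[OF refl], clarify)
    fix i j :: 'n assume "i \<le> j"
    then have "special \<sigma> (k, i, j) = (if i = j \<and> i = \<sigma> k then 1 else 0 :: 'k)"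
      using assms by (auto simp: special_def Upsilon_def)
    then show "pm_scale (special \<sigma> (k, i, j)) (var i * var j) = (if (i, j) = (\<sigma> k, \<sigma> k) then (var (\<sigma> k))\<^sup>2 else 0 :: ('n, 'k) mpoly)"
      by (auto intro!: poly_mapping_eqI simp: power2_eq_square)
  qed
  then show ?thesis by (simp add: sum.delta)
qed

lemma pm_scale_two: "pm_scale 2 p = p + p"
  by (rule poly_mapping_eqI) (simp only: lookup_pm_scale lookup_add mult_2)

lemma quadric_special_last:
  "quadric (special \<sigma>) (CARD('n) + 1) = ((\<Sum>i\<in>UNIV. var i)\<^sup>2 :: ('n::{finite,linorder}, 'k::field) mpoly)"
proof -
  let ?h = "\<lambda>(i, j). var i * var j :: ('n, 'k) mpoly"
  have "quadric (special \<sigma>) (CARD('n) + 1) = (\<Sum>ij\<in>{(i, j). i \<le> j}. ?h ij + (if fst ij = snd ij then 0 else ?h ij))"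
    unfolding quadric_def
  proof (rule sum.cong[OF refl])
    fix ij :: "'n \<times> 'n" assume "ij \<in> {(i, j). i \<le> j}"
    then obtain i j where ij: "ij = (i, j)" "i \<le> j" by blast
    then have "special \<sigma> (CARD('n) + 1, i, j) = (if i = j then 1 else 2 :: 'k)"
      by (auto simp: special_def Upsilon_def)
    then show "(case ij of (i, j) \<Rightarrow> pm_scale (special \<sigma> (CARD('n) + 1, i, j)) (var i * var j)) = ?h ij + (if fst ij = snd ij then 0 else ?h ij)"
      unfolding ij(1)
      by (cases "i = j") (simp_all only: pm_scale_two fst_conv snd_conv if_True if_False case_prod_conv
          add_0_right simp_thms module.scale_one[OF module_pm_scale])
  qed
  also have "\<dots> = (\<Sum>ij\<in>{(i, j). i \<le> j}. ?h ij) + (\<Sum>ij\<in>{(i, j). i \<le> j}. if fst ij = snd ij then 0 else ?h ij)"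
    by (rule sum.distrib)
  also have "(\<Sum>ij\<in>{(i, j). i \<le> j}. if fst ij = snd ij then 0 else ?h ij) = (\<Sum>ij\<in>{(i, j). i < j}. ?h ij)"
    by (rule sum.mono_neutral_cong_right) auto
  also have "\<dots> = (\<Sum>ij\<in>{(i, j). j < i}. ?h ij)"
    by (rule sum.reindex_bij_witness[of _ prod.swap prod.swap]) (auto simp: mult.commute)
  also have "(\<Sum>ij\<in>{(i, j). i \<le> j}. ?h ij) + (\<Sum>ij\<in>{(i, j). j < i}. ?h ij) = (\<Sum>ij\<in>{(i, j). i \<le> j} \<union> {(i, j). j < i}. ?h ij)"
    by (rule sum.union_disjoint[symmetric]) auto
  also have "{(i, j). i \<le> j} \<union> {(i, j). j < i} = (UNIV \<times> UNIV :: ('n \<times> 'n) set)" by auto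
  also have "(\<Sum>ij\<in>UNIV \<times> UNIV. ?h ij) = (\<Sum>i\<in>UNIV. var i)\<^sup>2"
    by (simp add: power2_eq_square sum_product sum.cartesian_product)
  finally show ?thesis .
qed

context
  fixes \<sigma> :: "nat \<Rightarrow> 'n::{finite,linorder}"
  assumes \<sigma>: "bij_betw \<sigma> {1..CARD('n)} UNIV"
begin

lemma special_squares:
  assumes "A \<subseteq> {1..CARD('n)}"
  shows "quadric (special \<sigma>) ` A = (\<lambda>v. (var v)\<^sup>2 :: ('n, 'k::field) mpoly) ` (\<sigma> ` A)"
proof -
  have "quadric (special \<sigma>) ` A = (\<lambda>k. (var (\<sigma> k))\<^sup>2 :: ('n, 'k) mpoly) ` A"
    using assms quadric_special_square by (intro image_cong refl) blast
  then show ?thesis by (simp add: image_image)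
qed

lemma special_all: "quadric (special \<sigma>) ` {1..CARD('n)} = range (\<lambda>v. (var v)\<^sup>2 :: ('n, 'k::field) mpoly)"
  using special_squares[OF subset_refl] \<sigma> by (simp add: bij_betw_def)

lemma special_coord_vecs: "(special \<sigma> :: _ \<Rightarrow> 'k::field) \<in> coord_vecs Upsilon"
proof -
  have "(1, \<sigma> 1, \<sigma> 1) \<in> Upsilon" by (simp add: Upsilon_def)
  moreover have "special \<sigma> (1, \<sigma> 1, \<sigma> 1) = (1 :: 'k)" by (simp add: special_def Upsilon_def)
  ultimately have "\<exists>s\<in>Upsilon. special \<sigma> s \<noteq> (0 :: 'k)" by (metis zero_neq_one)
  then show ?thesis by (auto simp: coord_vecs_def special_def)
qed

lemma ideal_R_special: "ideal_R (special \<sigma>) = (ideal_R_tilde :: ('n, 'k::field) mpoly set)"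
proof -
  have "{1..CARD('n) + 1} = insert (CARD('n) + 1) {1..CARD('n)}" by auto
  then show ?thesis
    unfolding ideal_R_def ideal_R_tilde_def by (simp only: image_insert special_all quadric_special_last)
qed

lemma ideal_A_special: "ideal_A (special \<sigma>) = (ideal_A_tilde :: ('n, 'k::field) mpoly set)"
  unfolding ideal_A_def ideal_A_tilde_def by (simp only: special_all quadric_special_last)

lemma general_position_special:
  assumes char: "CHAR('k::field) = 0 \<or> CARD('n) < CHAR('k)" and odd: "odd CARD('n)"
  shows "general_position (special \<sigma> :: _ \<Rightarrow> 'k)"
  unfolding general_position_def regular_sequence_def
proof (intro conjI ballI allI impI)
  fix k and p :: "('n, 'k) mpoly"
  assume k: "k \<in> {1..CARD('n)}" and p: "p * quadric (special \<sigma>) k \<in> ideal_gen (quadric (special \<sigma>) ` {1..<k})"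
  have eq: "ideal_gen (quadric (special \<sigma>) ` {1..<k}) = (sq_ideal (\<sigma> ` {1..<k}) :: ('n, 'k) mpoly set)"
    using k by (subst special_squares) (auto simp: ideal_gen_squares)
  have inj: "inj_on \<sigma> {1..CARD('n)}" using \<sigma> by (simp add: bij_betw_def)
  have "\<sigma> k \<notin> \<sigma> ` {1..<k}"
  proof
    assume "\<sigma> k \<in> \<sigma> ` {1..<k}"
    then obtain k' where "k' \<in> {1..<k}" "\<sigma> k = \<sigma> k'" by blast
    then show False using inj_onD[OF inj, of k k'] k by auto
  qed
  then show "p \<in> ideal_gen (quadric (special \<sigma>) ` {1..<k})"
    using p sq_ideal_colon[of p "\<sigma> k" "\<sigma> ` {1..<k}"] unfolding eq quadric_special_square[OF k] by blast
next
  have "(1 :: ('n, 'k) mpoly) \<notin> sq_ideal UNIV"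
    unfolding sq_ideal_def by (auto intro!: exI[of _ 0] simp: lookup_one)
  then show "ideal_gen (quadric (special \<sigma>) ` {1..CARD('n)}) \<noteq> (UNIV :: ('n, 'k) mpoly set)"
    unfolding special_all ideal_gen_squares by blast
next
  show "maximal_rank_element (ideal_gen (quadric (special \<sigma>) ` {1..CARD('n)})) 2 (quadric (special \<sigma>) (CARD('n) + 1) :: ('n, 'k) mpoly)"
    unfolding special_all quadric_special_last ideal_gen_squares using maximal_rank_squares[OF char odd] .
qed

end

lemma gpiece_quadrics: "gpiece a {1..k} = ipiece (qideal a k)"
proof -
  have "gen a ` {1..k} = quadric a ` {1..k}" by (rule image_cong) (auto simp: gen_def)
  then show ?thesis by simp
qed

lemma gpiece_0: "gpiece a {0} = (hpiece :: nat \<Rightarrow> ('n::{finite,linorder}, 'k::field) mpoly set)"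
proof
  fix e
  have "(1 :: ('n, 'k) mpoly) \<in> ideal_gen {1}" by (simp add: ideal_gen_def Q.span_base)
  then have "p \<in> ideal_gen {1}" for p :: "('n, 'k) mpoly"
    using ideal_mult[OF ideal_gen_subspace, of 1 "{1}" p] by simp
  then show "gpiece a {0} e = (hpiece e :: ('n, 'k) mpoly set)" by (auto simp: gen_def ipiece_def)
qed

text \<open>Multiplication by the last quadric \<open>f\<close> induces an isomorphism from \<open>Q / (J : f)\<close> to \<open>(J +
  f) / J\<close> that raises degrees by \<open>2\<close>.\<close>

lemma kdim_A:
  fixes a :: "('n::{finite,linorder}, 'k::field) coeffs"
  shows "Q.kdim hpiece (ipiece (ideal_A a)) i j = Q.kdim (gpiece a {1..Suc CARD('n)}) (gpiece a {1..CARD('n)}) i (j + 2)"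
proof -
  let ?f = "quadric a (Suc CARD('n)) :: ('n, 'k) mpoly" and ?J = "qideal a CARD('n) :: ('n, 'k) mpoly set"
  have A: "ideal_A a = colon ?J ?f" by (simp add: ideal_A_def)
  have qp: "qmodule_pair ((*) :: ('n, 'k) mpoly \<Rightarrow> _ \<Rightarrow> _) (*)"
    unfolding qmodule_pair_def qmodule_def using module_ring_mult by blast
  show ?thesis unfolding A gpiece_quadrics qideal_Suc
  proof (rule qmodule_pair.kdim_iso[OF qp times_hom[OF homogeneous_quadric] hpiece_graded
        ipiece_graded[OF colon_subspace[OF homogeneous_quadric]] ipiece_graded[OF ideal_gen_subspace] ipiece_graded[OF ideal_gen_subspace]])
    show "ipiece ?J e \<subseteq> ipiece (ideal_gen (insert ?f (quadric a ` {1..CARD('n)}))) e" for e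
      using ideal_gen_mono[of "quadric a ` {1..CARD('n)}" "insert ?f (quadric a ` {1..CARD('n)})"] by (auto simp: ipiece_def)
    show "Q.V.sumset ((\<lambda>p. p * ?f) ` hpiece e) (ipiece ?J (e + 2)) = ipiece (ideal_gen (insert ?f (quadric a ` {1..CARD('n)}))) (e + 2)" for e
      by (rule ideal_insert_piece[OF homogeneous_quadric homogeneous_qideal])
    show "ipiece (ideal_gen (insert ?f (quadric a ` {1..CARD('n)}))) e = ipiece ?J e" if "e < 2" for e
      by (rule ideal_insert_low[OF homogeneous_quadric homogeneous_qideal that])
    show "(x * ?f \<in> ipiece ?J (e + 2)) = (x \<in> ipiece (colon ?J ?f) e)" if "x \<in> hpiece e" for e x
      using colon_piece_iff[OF homogeneous_quadric, of e x] that by simp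
    show "ipiece (colon ?J ?f) e \<subseteq> hpiece e" for e by (auto simp: ipiece_def)
  qed
qed

lemma betti_R:
  fixes a :: "('n::{finite,linorder}, 'k::field) coeffs"
  shows "int (graded_betti (ideal_R a) i j) = Q.kdim (gpiece a {0}) (gpiece a {1..Suc CARD('n)}) i j"
proof -
  have "ideal_R a = qideal a (Suc CARD('n))" by (simp add: ideal_R_def)
  then show ?thesis unfolding gpiece_0 gpiece_quadrics using graded_betti_eq_kdim[OF homogeneous_qideal] by metis
qed

lemma betti_A:
  fixes a :: "('n::{finite,linorder}, 'k::field) coeffs"
  shows "int (graded_betti (ideal_A a) i j) = Q.kdim (gpiece a {1..Suc CARD('n)}) (gpiece a {1..CARD('n)}) i (j + 2)"
proof -
  have "homogeneous_ideal (ideal_A a)"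
    unfolding ideal_A_def by (rule homogeneous_ideal_colon[OF homogeneous_qideal homogeneous_quadric])
  then show ?thesis using graded_betti_eq_kdim kdim_A by metis
qed

lemma gpiece_mono: "K \<subseteq> K' \<Longrightarrow> gpiece a K e \<subseteq> gpiece a K' e"
  using ideal_gen_mono[of "gen a ` K" "gen a ` K'"] by (auto simp: ipiece_def image_mono)

text \<open>There are no sets of more than \<open>n\<close> variables, and in degrees above \<open>n\<close> the modules \<open>L\<close> and
  \<open>N\<close> agree.\<close>

lemma kdim_out_of_range:
  fixes a :: "('n::{finite,linorder}, 'k::field) coeffs"
  assumes NL: "\<And>e. gpiece a KN e \<subseteq> gpiece a KL e"
    and full: "\<And>e. CARD('n) < e \<Longrightarrow> hpiece e \<subseteq> gpiece a KN e"
    and out: "CARD('n) < q \<or> q + CARD('n) < j"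
  shows "Q.kdim (gpiece a KL) (gpiece a KN) q j = 0"
proof (rule Q.kdim_eq_0[OF gpiece_graded gpiece_graded NL])
  show "Q.chains (gpiece a KL) q j \<subseteq> Q.chains (gpiece a KN) q j"
  proof
    fix c assume c: "c \<in> Q.chains (gpiece a KL) q j"
    show "c \<in> Q.chains (gpiece a KN) q j"
    proof (rule Q.chainsI)
      fix S :: "'n set" assume S: "card S = q" "q \<le> j"
      have "card S \<le> CARD('n)" by (simp add: card_mono)
      then have "CARD('n) < j - q" using out S by auto
      moreover have "c S \<in> hpiece (j - q)" using Q.chainsD(1)[OF c S] by (simp add: ipiece_def)
      ultimately show "c S \<in> gpiece a KN (j - q)" using full by blast
    qed (use Q.chainsD(2)[OF c] in blast)
  qed
qed

text \<open>The bounds on the degrees are those beyond which nothing is left to control: all forms of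
  degree \<open>n + 1\<close> are in the ideal, and the Koszul homology is zero unless \<open>q \<le> n\<close> and \<open>j \<le> q +
  n\<close>. The two pairs of ideals are those for \<open>R\<close> and for \<open>A\<close>.\<close>

definition rank_conditions :: "(('n::{finite,linorder}, 'k::field) coeffs) \<Rightarrow> ('n, 'k) coeffs \<Rightarrow> bool" where
  "rank_conditions a0 a \<longleftrightarrow>
    (\<forall>(k, e)\<in>{CARD('n), Suc CARD('n)} \<times> {..CARD('n) + 1}.
       Q.V.vs.dim (gpiece a0 {1..k} e) \<le> Q.V.vs.dim (gpiece a {1..k} e)) \<and>
    (\<forall>((KL, KN), q, j)\<in>{({0}, {1..Suc CARD('n)}), ({1..Suc CARD('n)}, {1..CARD('n)})} \<times> {..CARD('n)} \<times> {..2 * CARD('n)}.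
       Q.C.vs.dim (Q.kboundaries (gpiece a0 KL) (gpiece a0 KN) q j)
       \<le> Q.C.vs.dim (Q.kboundaries (gpiece a KL) (gpiece a KN) q j))"

lemma near_rank_conditions: "near Upsilon a0 (rank_conditions a0)"
  for a0 :: "('n::{finite,linorder}, 'k::field) coeffs"
  unfolding rank_conditions_def
proof (rule near_conj)
  show "near Upsilon a0 (\<lambda>a. \<forall>(k, e)\<in>{CARD('n), Suc CARD('n)} \<times> {..CARD('n) + 1}.
       Q.V.vs.dim (gpiece a0 {1..k} e) \<le> Q.V.vs.dim (gpiece a {1..k} e))"
  proof (rule near_ball)
    fix x assume "x \<in> {CARD('n), Suc CARD('n)} \<times> {..CARD('n) + 1}"
    then obtain k e where x: "x = (k, e)" "k \<le> Suc CARD('n)" by auto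
    then show "near Upsilon a0 (\<lambda>a. case x of (k, e) \<Rightarrow> Q.V.vs.dim (gpiece a0 {1..k} e) \<le> Q.V.vs.dim (gpiece a {1..k} e))"
      using near_gpiece[of "{1..k}" a0 e] by (simp add: atMost_def subset_iff)
  qed simp
  show "near Upsilon a0 (\<lambda>a. \<forall>((KL, KN), q, j)\<in>{({0}, {1..Suc CARD('n)}), ({1..Suc CARD('n)}, {1..CARD('n)})} \<times> {..CARD('n)} \<times> {..2 * CARD('n)}.
       Q.C.vs.dim (Q.kboundaries (gpiece a0 KL) (gpiece a0 KN) q j)
       \<le> Q.C.vs.dim (Q.kboundaries (gpiece a KL) (gpiece a KN) q j))"
  proof (rule near_ball)
    fix x :: "(nat set \<times> nat set) \<times> nat \<times> nat"
    assume "x \<in> {({0}, {1..Suc CARD('n)}), ({1..Suc CARD('n)}, {1..CARD('n)})} \<times> {..CARD('n)} \<times> {..2 * CARD('n)}"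
    then obtain KL KN q j where x: "x = ((KL, KN), q, j)" "KL \<subseteq> {..CARD('n) + 1}" "KN \<subseteq> {..CARD('n) + 1}" by auto
    then show "near Upsilon a0 (\<lambda>a. case x of (x, xa) \<Rightarrow> (case x of (KL, KN) \<Rightarrow> \<lambda>(q, j).
         Q.C.vs.dim (Q.kboundaries (gpiece a0 KL) (gpiece a0 KN) q j)
       \<le> Q.C.vs.dim (Q.kboundaries (gpiece a KL) (gpiece a KN) q j)) xa)"
      using near_kboundaries[of KL KN a0 q j] by simp
  qed simp
qed

text \<open>The conditions up to degree \<open>n + 1\<close> give the lower bounds on Hilbert functions in all
  degrees, because in higher degrees both sides consist of all forms. Then the Hilbert functions
  are equal, and the remaining conditions bound the Koszul homology.\<close>

lemma rank_conditions_imp: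
  fixes a a0 :: "('n::{finite,linorder}, 'k::field) coeffs"
  assumes a0: "general_position a0" and full0: "hpiece (CARD('n) + 1) \<subseteq> qideal a0 CARD('n)"
    and rc: "rank_conditions a0 a"
  shows "general_position a"
    "graded_betti (ideal_R a) i j \<le> graded_betti (ideal_R a0) i j"
    "graded_betti (ideal_A a) i j \<le> graded_betti (ideal_A a0) i j"
proof -
  let ?n = "CARD('n)"
  have c1: "Q.V.vs.dim (ipiece (qideal a0 k) e) \<le> Q.V.vs.dim (ipiece (qideal a k) e)"
    if "k \<in> {?n, Suc ?n}" "e \<le> ?n + 1" for k e
    using rc that unfolding rank_conditions_def gpiece_quadrics by auto
  have c2: "Q.C.vs.dim (Q.kboundaries (gpiece a0 KL) (gpiece a0 KN) q j)
       \<le> Q.C.vs.dim (Q.kboundaries (gpiece a KL) (gpiece a KN) q j)"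
    if "(KL, KN) \<in> {({0}, {1..Suc ?n}), ({1..Suc ?n}, {1..?n})}" "q \<le> ?n" "j \<le> 2 * ?n" for KL KN q j
    using conjunct2[OF rc[unfolded rank_conditions_def]] that by (force simp del: insert_iff)
  have full_upto: "hpiece e \<subseteq> qideal b k" if "hpiece (?n + 1) \<subseteq> qideal b ?n" "?n < e" "k \<in> {?n, Suc ?n}"
    for b :: "('n, 'k) coeffs" and e k
  proof -
    have "hpiece e \<subseteq> qideal b ?n" by (rule hpiece_full_mono[OF ideal_gen_subspace that(1)]) (use that in simp)
    also have "\<dots> \<subseteq> qideal b k" using that(3) by (intro ideal_gen_mono image_mono) auto
    finally show ?thesis .
  qed
  have fulla: "hpiece (?n + 1) \<subseteq> qideal a ?n"
  proof -
    have "ipiece (qideal a0 ?n) (?n + 1) = hpiece (?n + 1)" using full0 by (auto simp: ipiece_def)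
    then have "Q.V.vs.dim (hpiece (?n + 1) :: ('n, 'k) mpoly set) \<le> Q.V.vs.dim (ipiece (qideal a ?n) (?n + 1))"
      using c1[of ?n "?n + 1"] by simp
    then have "ipiece (qideal a ?n) (?n + 1) = hpiece (?n + 1)"
      by (intro Q.V.fd_eqI[OF hpiece_fd ipiece_subspace[OF ideal_gen_subspace]]) (auto simp: ipiece_def)
    then show ?thesis by (auto simp: ipiece_def)
  qed
  have dims: "qdim a0 k e \<le> qdim a k e" if k: "k \<in> {?n, Suc ?n}" for k e
  proof (cases "e \<le> ?n + 1")
    case True then show ?thesis using c1[OF k] by (simp add: qdim_def)
  next
    case False
    then have "ipiece (qideal b k) e = hpiece e" if "hpiece (?n + 1) \<subseteq> qideal b ?n" for b :: "('n, 'k) coeffs"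
      using full_upto[OF that, of e k] k by (auto simp: ipiece_def)
    then show ?thesis using full0 fulla by (simp add: qdim_def)
  qed
  note gp = general_position_transfer[OF a0 dims dims]
  show "general_position a" by (rule gp) auto
  have eqn: "qdim a ?n e = qdim a0 ?n e" and eqSn: "qdim a (Suc ?n) e = qdim a0 (Suc ?n) e" for e
    by (rule gp; simp)+
  have deq: "Q.V.vs.dim (gpiece a K e) = Q.V.vs.dim (gpiece a0 K e)" if K: "K \<in> {{0}, {1..Suc ?n}, {1..?n}}" for K e
  proof -
    consider "K = {0}" | "K = {1..Suc ?n}" | "K = {1..?n}" using K by blast
    then show ?thesis
    proof cases
      case 1 show ?thesis unfolding 1 gpiece_0 ..
    next
      case 2 show ?thesis unfolding 2 gpiece_quadrics using eqSn[of e] by (simp add: qdim_def)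
    next
      case 3 show ?thesis unfolding 3 gpiece_quadrics using eqn[of e] by (simp add: qdim_def)
    qed
  qed
  have main: "Q.kdim (gpiece a KL) (gpiece a KN) q j \<le> Q.kdim (gpiece a0 KL) (gpiece a0 KN) q j"
    if K: "(KL, KN) \<in> {({0}, {1..Suc ?n}), ({1..Suc ?n}, {1..?n})}" for KL KN q j
  proof -
    have sub: "gpiece b KN e \<subseteq> gpiece b KL e" for b :: "('n, 'k) coeffs" and e
    proof (cases "KL = {0}")
      case True then show ?thesis unfolding True gpiece_0 by (auto simp: ipiece_def)
    next
      case False then show ?thesis using K by (intro gpiece_mono) auto
    qed
    have KN: "KN = {1..?n} \<or> KN = {1..Suc ?n}" using K by auto
    show ?thesis
    proof (cases "?n < q \<or> q + ?n < j")
      case True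
      have "hpiece e \<subseteq> gpiece a KN e" if "?n < e" for e
      proof -
        obtain k where k: "KN = {1..k}" "k \<in> {?n, Suc ?n}" using KN by blast
        show ?thesis unfolding k(1) gpiece_quadrics using full_upto[OF fulla that k(2)] by (auto simp: ipiece_def)
      qed
      then have "Q.kdim (gpiece a KL) (gpiece a KN) q j = 0"
        by (intro kdim_out_of_range[OF sub _ True])
      then show ?thesis using Q.kdim_nonneg[OF gpiece_graded gpiece_graded sub] by metis
    next
      case False
      then have "q \<le> ?n" "q - 1 \<le> ?n" "j \<le> 2 * ?n" by auto
      then show ?thesis
        using K by (intro Q.kdim_le gpiece_graded sub deq c2) auto
    qed
  qed
  show "graded_betti (ideal_R a) i j \<le> graded_betti (ideal_R a0) i j"
    using main[of "{0}" "{1..Suc ?n}" i j] unfolding betti_R[symmetric] by simp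
  show "graded_betti (ideal_A a) i j \<le> graded_betti (ideal_A a0) i j"
    using main[of "{1..Suc ?n}" "{1..?n}" i "j + 2"] unfolding betti_A[symmetric] by simp
qed

text \<open>The neighbourhood is not empty, as it contains the point itself.\<close>

lemma general_quotient_if_near:
  fixes a0 :: "('n::{finite,linorder}, 'k::field) coeffs"
  assumes "a0 \<in> coord_vecs Upsilon" "near Upsilon a0 (\<lambda>a. general_position a \<and> P a)"
  shows "general_quotient P"
proof -
  obtain d g where g: "homogeneous d g" "vars g \<subseteq> Upsilon" "poly_eval a0 g \<noteq> 0"
    "\<And>a. poly_eval a g \<noteq> 0 \<Longrightarrow> general_position a \<and> P a"
    using assms(2) by (auto simp: near_def hpoly_def)
  define U where "U = {p \<in> proj_space Upsilon. \<exists>h\<in>{g}. \<forall>a\<in>p. poly_eval a h \<noteq> 0}"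
  have "zariski_open Upsilon U"
    unfolding zariski_open_def U_def using g(1,2) by blast
  moreover have "proj_rel Upsilon `` {a0} \<in> U"
  proof -
    have "poly_eval b g \<noteq> 0" if b: "b \<in> proj_rel Upsilon `` {a0}" for b
    proof -
      obtain c where "c \<noteq> 0" "b = (\<lambda>s. c * a0 s)" using b by (auto simp: proj_rel_def)
      then show ?thesis using poly_eval_scale_coords[OF g(1), of c a0] g(3) by simp
    qed
    moreover have "proj_rel Upsilon `` {a0} \<in> proj_space Upsilon"
      unfolding proj_space_def by (rule quotientI) (rule assms(1))
    ultimately show ?thesis unfolding U_def by blast
  qed
  ultimately show ?thesis
    unfolding general_quotient_def using g(4) by (intro exI[of _ U]) (auto simp: U_def)
qed

theorem theorem8p3:
  assumes "3 \<le> CARD('n::{finite,linorder})" and "odd (CARD('n))"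
    and "infinite (UNIV :: 'k::field set)"
    and "CHAR('k) = 0 \<or> CARD('n) < CHAR('k)"
  shows "general_quotient (\<lambda>a :: nat \<times> 'n \<times> 'n \<Rightarrow> 'k.
    (\<forall>i j. graded_betti (ideal_R a) i j \<le>
       graded_betti (ideal_R_tilde :: ('n, 'k) mpoly set) i j) \<and>
    (\<forall>i j. graded_betti (ideal_A a) i j \<le>
       graded_betti (ideal_A_tilde :: ('n, 'k) mpoly set) i j))"
proof -
  obtain \<sigma> :: "nat \<Rightarrow> 'n" where \<sigma>: "bij_betw \<sigma> {1..CARD('n)} UNIV"
    using ex_bij_betw_nat_finite_1[of "UNIV :: 'n set"] by auto
  let ?a0 = "special \<sigma> :: ('n, 'k) coeffs"
  have gp: "general_position ?a0" by (rule general_position_special[OF \<sigma> assms(4,2)])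
  have full: "hpiece (CARD('n) + 1) \<subseteq> (qideal ?a0 CARD('n) :: ('n, 'k) mpoly set)"
    unfolding special_all[OF \<sigma>] ideal_gen_squares by (rule hpiece_sq_ideal)
  show ?thesis
  proof (rule general_quotient_if_near[OF special_coord_vecs[OF \<sigma>]])
    show "near Upsilon ?a0 (\<lambda>a. general_position a \<and>
      (\<forall>i j. graded_betti (ideal_R a) i j \<le> graded_betti (ideal_R_tilde :: ('n, 'k) mpoly set) i j) \<and>
      (\<forall>i j. graded_betti (ideal_A a) i j \<le> graded_betti (ideal_A_tilde :: ('n, 'k) mpoly set) i j))"
      unfolding ideal_R_special[OF \<sigma>, symmetric] ideal_A_special[OF \<sigma>, symmetric]
      by (rule near_mono[OF near_rank_conditions]) (intro conjI allI rank_conditions_imp[OF gp full])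
  qed
qed

end
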